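(* Let $M\ge 2$ be an integer and let $\mathrm{Art}_{23M}$ be the triangle Artin group with labels $2,3,M$. (i) If $M$ is odd, then $\mathrm{Art}_{23M}$ does not split as a nontrivial graph of free groups. (ii) If $M>4$ is even, then $\mathrm{Art}_{23M}$ is isomorphic to an amalgamated product $F_3 *_{F_7} F_4$ of a free group $F_3$ of rank $3$ and a free group $F_4$ of rank $4$ over a common subgroup $F_7$ that is free of rank $7$.
   Context: For integers $2\le M,N,P<\infty$, the triangle Artin group is $\mathrm{Art}_{MNP}=\langle a,b,c\mid \{a,b\}_M=\{b,a\}_M,\ \{b,c\}_N=\{c,b\}_N,\ \{c,a\}_P=\{a,c\}_P\rangle$, where $\{a,b\}_M$ denotes the alternating word $aba\cdots$ of length $M$ starting with $a$. Permuting the labels gives an isomorphic group. A group splits as a graph of free groups if it is isomorphic to the fundamental group of a connected graph of groups all of whose vertex groups are free (of finite or infinite rank; edge groups inject into the vertex groups). The splitting is nontrivial if the group acts on the corresponding Bass--Serre tree without a global fixed point. *)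

theory Defs
  imports "HOL-Algebra.Coset"
begin

section \<open>Group presentations, free groups and amalgamated products\<close>

text \<open>A letter \<open>(s, True)\<close> stands for the generator \<open>s\<close>, and \<open>(s, False)\<close> for its formal inverse.\<close>

type_synonym 'a word = "('a \<times> bool) list"

definition words_on :: "'a set \<Rightarrow> 'a word set"
  where "words_on S = lists (S \<times> UNIV)"

abbreviation pos :: "'a list \<Rightarrow> 'a word"
  where "pos xs \<equiv> map (\<lambda>x. (x, True)) xs"

inductive_set word_eq :: "'a set \<Rightarrow> ('a word \<times> 'a word) set \<Rightarrow> ('a word \<times> 'a word) set"
  for S :: "'a set" and R :: "('a word \<times> 'a word) set"
where
  refl: "u \<in> words_on S \<Longrightarrow> (u, u) \<in> word_eq S R"
| sym: "(u, v) \<in> word_eq S R \<Longrightarrow> (v, u) \<in> word_eq S R"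
| trans: "(u, v) \<in> word_eq S R \<Longrightarrow> (v, w) \<in> word_eq S R \<Longrightarrow> (u, w) \<in> word_eq S R"
| congr: "(u, v) \<in> word_eq S R \<Longrightarrow> x \<in> words_on S \<Longrightarrow> y \<in> words_on S
    \<Longrightarrow> (x @ u @ y, x @ v @ y) \<in> word_eq S R"
| cancel: "s \<in> S \<Longrightarrow> ([(s, p), (s, \<not> p)], []) \<in> word_eq S R"
| relation: "(u, v) \<in> R \<Longrightarrow> u \<in> words_on S \<Longrightarrow> v \<in> words_on S \<Longrightarrow> (u, v) \<in> word_eq S R"

definition word_class :: "'a set \<Rightarrow> ('a word \<times> 'a word) set \<Rightarrow> 'a word \<Rightarrow> 'a word set"
  where "word_class S R w = word_eq S R `` {w}"

text \<open>The group \<open>\<langle>S | u = v for (u, v) \<in> R\<rangle>\<close>.\<close>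

definition presented_group :: "'a set \<Rightarrow> ('a word \<times> 'a word) set \<Rightarrow> 'a word set monoid"
  where "presented_group S R =
    \<lparr>carrier = words_on S // word_eq S R,
     mult = (\<lambda>A B. \<Union>u\<in>A. \<Union>v\<in>B. word_class S R (u @ v)),
     one = word_class S R []\<rparr>"

definition free_group :: "'a set \<Rightarrow> 'a word set monoid"
  where "free_group X = presented_group X {}"

text \<open>Every basis of a free group \<open>G\<close> is a subset of \<open>G\<close>, so it is no restriction that the
  elements of \<open>X\<close> have the same type as those of \<open>G\<close>.  The set \<open>X\<close> may be empty or infinite.\<close>

definition is_free_group :: "('a, 'm) monoid_scheme \<Rightarrow> bool"
  where "is_free_group G \<longleftrightarrow> group G \<and> (\<exists>X :: 'a set. G \<cong> free_group X)"

text \<open>The amalgamated product \<open>A *\<^bsub>C\<^esub> B\<close> along \<open>\<phi> : C \<rightarrow> A\<close> and \<open>\<psi> : C \<rightarrow> B\<close>.  The first two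
  families of relations are the multiplication tables of \<open>A\<close> and \<open>B\<close>.\<close>

definition amalgamated_product ::
  "('a, 'm) monoid_scheme \<Rightarrow> ('b, 'n) monoid_scheme \<Rightarrow> ('c, 'k) monoid_scheme \<Rightarrow>
    ('c \<Rightarrow> 'a) \<Rightarrow> ('c \<Rightarrow> 'b) \<Rightarrow> ('a + 'b) word set monoid"
  where "amalgamated_product A B C \<phi> \<psi> =
    presented_group (carrier A <+> carrier B)
      ({(pos [Inl x, Inl y], pos [Inl (x \<otimes>\<^bsub>A\<^esub> y)]) | x y. x \<in> carrier A \<and> y \<in> carrier A}
       \<union> {(pos [Inr x, Inr y], pos [Inr (x \<otimes>\<^bsub>B\<^esub> y)]) | x y. x \<in> carrier B \<and> y \<in> carrier B}
       \<union> {(pos [Inl (\<phi> z)], pos [Inr (\<psi> z)]) | z. z \<in> carrier C})"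


section \<open>Triangle Artin groups\<close>

fun alternating :: "'a \<Rightarrow> 'a \<Rightarrow> nat \<Rightarrow> 'a list"
  where
    "alternating x y 0 = []"
  | "alternating x y (Suc n) = x # alternating y x n"

datatype artin_gen = Gen_a | Gen_b | Gen_c

definition triangle_artin :: "nat \<Rightarrow> nat \<Rightarrow> nat \<Rightarrow> artin_gen word set monoid"
  where "triangle_artin M N P = presented_group {Gen_a, Gen_b, Gen_c}
    {(pos (alternating Gen_a Gen_b M), pos (alternating Gen_b Gen_a M)),
     (pos (alternating Gen_b Gen_c N), pos (alternating Gen_c Gen_b N)),
     (pos (alternating Gen_c Gen_a P), pos (alternating Gen_a Gen_c P))}"


section \<open>Graphs of groups and Bass--Serre trees\<close>

text \<open>Graphs in the sense of Serre: \<open>edges\<close> consists of oriented edges, and \<open>opp\<close> reverses the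
  orientation.\<close>

record ('v, 'e) serre_graph =
  verts :: "'v set"
  edges :: "'e set"
  src :: "'e \<Rightarrow> 'v"
  opp :: "'e \<Rightarrow> 'e"

definition tgt :: "('v, 'e, 'm) serre_graph_scheme \<Rightarrow> 'e \<Rightarrow> 'v"
  where "tgt Y e = src Y (opp Y e)"

locale serre_graph =
  fixes Y :: "('v, 'e, 'm) serre_graph_scheme"
  assumes src_in: "e \<in> edges Y \<Longrightarrow> src Y e \<in> verts Y"
    and opp_in: "e \<in> edges Y \<Longrightarrow> opp Y e \<in> edges Y"
    and opp_opp: "e \<in> edges Y \<Longrightarrow> opp Y (opp Y e) = e"
    and opp_neq: "e \<in> edges Y \<Longrightarrow> opp Y e \<noteq> e"

definition connected_graph :: "('v, 'e, 'm) serre_graph_scheme \<Rightarrow> bool"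
  where "connected_graph Y \<longleftrightarrow> verts Y \<noteq> {} \<and>
    (\<forall>u\<in>verts Y. \<forall>v\<in>verts Y. (u, v) \<in> {(src Y e, tgt Y e) | e. e \<in> edges Y}\<^sup>*)"

text \<open>The map \<open>emb e\<close> embeds the edge group of \<open>e\<close> into the vertex group of the source of \<open>e\<close>; the
  embedding at the target is \<open>emb (opp e)\<close>.\<close>

record ('v, 'e, 'g, 'h) graph_of_groups = "('v, 'e) serre_graph" +
  vgroup :: "'v \<Rightarrow> 'g monoid"
  egroup :: "'e \<Rightarrow> 'h monoid"
  emb :: "'e \<Rightarrow> 'h \<Rightarrow> 'g"

locale graph_of_groups = serre_graph Y
  for Y :: "('v, 'e, 'g, 'h) graph_of_groups" +
  assumes group_vgroup: "v \<in> verts Y \<Longrightarrow> group (vgroup Y v)"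
    and group_egroup: "e \<in> edges Y \<Longrightarrow> group (egroup Y e)"
    and egroup_opp: "e \<in> edges Y \<Longrightarrow> egroup Y (opp Y e) = egroup Y e"
    and emb_mon: "e \<in> edges Y \<Longrightarrow> emb Y e \<in> mon (egroup Y e) (vgroup Y (src Y e))"

datatype ('v, 'e, 'g) path_letter = Vert 'v 'g | Edge 'e

definition path_gens :: "('v, 'e, 'g, 'h) graph_of_groups \<Rightarrow> ('v, 'e, 'g) path_letter set"
  where "path_gens Y = {Vert v g | v g. v \<in> verts Y \<and> g \<in> carrier (vgroup Y v)} \<union> Edge ` edges Y"

definition path_rels :: "('v, 'e, 'g, 'h) graph_of_groups \<Rightarrow>
    (('v, 'e, 'g) path_letter word \<times> ('v, 'e, 'g) path_letter word) set"
  where "path_rels Y =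
    {(pos [Vert v g, Vert v h], pos [Vert v (g \<otimes>\<^bsub>vgroup Y v\<^esub> h)]) | v g h.
       v \<in> verts Y \<and> g \<in> carrier (vgroup Y v) \<and> h \<in> carrier (vgroup Y v)}
    \<union> {([(Edge (opp Y e), True)], [(Edge e, False)]) | e. e \<in> edges Y}
    \<union> {([(Edge e, True), (Vert (tgt Y e) (emb Y (opp Y e) x), True), (Edge e, False)],
        [(Vert (src Y e) (emb Y e x), True)]) | e x. e \<in> edges Y \<and> x \<in> carrier (egroup Y e)}"

definition path_group ::
    "('v, 'e, 'g, 'h) graph_of_groups \<Rightarrow> ('v, 'e, 'g) path_letter word set monoid"
  where "path_group Y = presented_group (path_gens Y) (path_rels Y)"

definition path_class :: "('v, 'e, 'g, 'h) graph_of_groups \<Rightarrow> ('v, 'e, 'g) path_letter list \<Rightarrow>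
    ('v, 'e, 'g) path_letter word set"
  where "path_class Y xs = word_class (path_gens Y) (path_rels Y) (pos xs)"

text \<open>\<open>gog_path Y u v p\<close>: \<open>p\<close> has the form \<open>g\<^sub>0 e\<^sub>1 g\<^sub>1 \<dots> e\<^sub>n g\<^sub>n\<close>, where \<open>e\<^sub>1 \<dots> e\<^sub>n\<close> is an edge path
  from \<open>u\<close> to \<open>v\<close> and each \<open>g\<^sub>i\<close> lies in the group of the vertex reached after \<open>e\<^sub>i\<close>.\<close>

inductive gog_path :: "('v, 'e, 'g, 'h) graph_of_groups \<Rightarrow> 'v \<Rightarrow> 'v \<Rightarrow>
    ('v, 'e, 'g) path_letter list \<Rightarrow> bool"
  for Y :: "('v, 'e, 'g, 'h) graph_of_groups" and u :: 'v
where
  start: "u \<in> verts Y \<Longrightarrow> g \<in> carrier (vgroup Y u) \<Longrightarrow> gog_path Y u u [Vert u g]"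
| step: "gog_path Y u (src Y e) p \<Longrightarrow> e \<in> edges Y \<Longrightarrow> g \<in> carrier (vgroup Y (tgt Y e))
    \<Longrightarrow> gog_path Y u (tgt Y e) (p @ [Edge e, Vert (tgt Y e) g])"

definition path_elems :: "('v, 'e, 'g, 'h) graph_of_groups \<Rightarrow> 'v \<Rightarrow> 'v \<Rightarrow>
    ('v, 'e, 'g) path_letter word set set"
  where "path_elems Y u v = {path_class Y p | p. gog_path Y u v p}"

definition fundamental_group :: "('v, 'e, 'g, 'h) graph_of_groups \<Rightarrow> 'v \<Rightarrow>
    ('v, 'e, 'g) path_letter word set monoid"
  where "fundamental_group Y v\<^sub>0 = (path_group Y)\<lparr>carrier := path_elems Y v\<^sub>0 v\<^sub>0\<rparr>"

definition vgroup_image :: "('v, 'e, 'g, 'h) graph_of_groups \<Rightarrow> 'v \<Rightarrow>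
    ('v, 'e, 'g) path_letter word set set"
  where "vgroup_image Y v = {path_class Y [Vert v g] | g. g \<in> carrier (vgroup Y v)}"

definition egroup_image :: "('v, 'e, 'g, 'h) graph_of_groups \<Rightarrow> 'e \<Rightarrow>
    ('v, 'e, 'g) path_letter word set set"
  where "egroup_image Y e =
    {path_class Y [Vert (src Y e) (emb Y e x)] | x. x \<in> carrier (egroup Y e)}"

text \<open>The Bass--Serre tree relative to the base vertex \<open>v\<^sub>0\<close>.  Write \<open>P v\<close> for \<open>path_elems Y v\<^sub>0 v\<close>.
  The vertices over \<open>v\<close> are the cosets \<open>g G\<^sub>v\<close> with \<open>g \<in> P v\<close>.  The oriented edges over \<open>e\<close> are the
  cosets \<open>g G\<^sub>e\<close> with \<open>g \<in> P (src e)\<close>, where \<open>G\<^sub>e\<close> is regarded as a subgroup of the source vertex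
  group; such an edge goes from \<open>g G\<^bsub>src e\<^esub>\<close> to \<open>g e G\<^bsub>tgt e\<^esub>\<close>.  Its opposite is the coset of \<open>g e\<close>
  over \<open>opp e\<close>, which as a set is \<open>g G\<^sub>e e\<close> because \<open>G\<^sub>e e = e G\<^bsub>opp e\<^esub>\<close> in the path group.\<close>

definition bass_serre_tree :: "('v, 'e, 'g, 'h) graph_of_groups \<Rightarrow> 'v \<Rightarrow>
    ('v \<times> ('v, 'e, 'g) path_letter word set set,
     'e \<times> ('v, 'e, 'g) path_letter word set set) serre_graph"
  where "bass_serre_tree Y v\<^sub>0 =
    \<lparr>verts = {(v, g <#\<^bsub>path_group Y\<^esub> vgroup_image Y v) | v g.
       v \<in> verts Y \<and> g \<in> path_elems Y v\<^sub>0 v},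
     edges = {(e, g <#\<^bsub>path_group Y\<^esub> egroup_image Y e) | e g.
       e \<in> edges Y \<and> g \<in> path_elems Y v\<^sub>0 (src Y e)},
     src = (\<lambda>(e, K). (src Y e, K <#>\<^bsub>path_group Y\<^esub> vgroup_image Y (src Y e))),
     opp = (\<lambda>(e, K). (opp Y e, K #>\<^bsub>path_group Y\<^esub> path_class Y [Edge e]))\<rparr>"

text \<open>The action of the fundamental group by left translation, on vertices as well as on edges.\<close>

definition bass_serre_act :: "('v, 'e, 'g, 'h) graph_of_groups \<Rightarrow>
    ('v, 'e, 'g) path_letter word set \<Rightarrow> 'x \<times> ('v, 'e, 'g) path_letter word set set \<Rightarrow>
    'x \<times> ('v, 'e, 'g) path_letter word set set"
  where "bass_serre_act Y g = (\<lambda>(x, K). (x, g <#\<^bsub>path_group Y\<^esub> K))"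

text \<open>A point of the geometric realization of the tree is a vertex or lies inside an unoriented
  edge \<open>{e, opp e}\<close>.  In the second case, if the point is fixed by the group then so is the set
  \<open>{e, opp e}\<close>; conversely, if this set is fixed then so is the midpoint of the edge.\<close>

definition has_global_fixed_point :: "('v, 'e, 'g, 'h) graph_of_groups \<Rightarrow> 'v \<Rightarrow> bool"
  where "has_global_fixed_point Y v\<^sub>0 \<longleftrightarrow>
    (let \<Gamma> = carrier (fundamental_group Y v\<^sub>0); T = bass_serre_tree Y v\<^sub>0 in
      (\<exists>x\<in>verts T. \<forall>g\<in>\<Gamma>. bass_serre_act Y g x = x) \<or>
      (\<exists>y\<in>edges T. \<forall>g\<in>\<Gamma>. bass_serre_act Y g ` {y, opp T y} = {y, opp T y}))"

text \<open>\<open>G\<close> splits nontrivially as the graph of free groups \<open>Y\<close>, with base vertex \<open>v\<^sub>0\<close>.  An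
  isomorphism between \<open>G\<close> and the fundamental group makes \<open>G\<close> act on the tree, and the global fixed
  points of \<open>G\<close> are then those of the fundamental group.\<close>

definition nontrivial_free_splitting ::
    "('a, 'm) monoid_scheme \<Rightarrow> ('v, 'e, 'g, 'h) graph_of_groups \<Rightarrow> 'v \<Rightarrow> bool"
  where "nontrivial_free_splitting G Y v\<^sub>0 \<longleftrightarrow>
    graph_of_groups Y \<and> connected_graph Y \<and> v\<^sub>0 \<in> verts Y \<and>
    (\<forall>v\<in>verts Y. is_free_group (vgroup Y v)) \<and>
    G \<cong> fundamental_group Y v\<^sub>0 \<and>
    \<not> has_global_fixed_point Y v\<^sub>0"

end

theory Submission
  imports Defs "HOL-Analysis.Euclidean_Space"
begin

text \<open>Odd labels.  Let \<open>M = 2 k + 1\<close>, and suppose that the Artin group is the fundamental group of a graph of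
  free groups.  Then it lies in the path group, a multiple HNN extension of the free product of the
  vertex groups, and acts on the tree of this extension with stabilizers that embed in a free group
  (\<open>hnn.res_tfn_stab\<close>).  Free groups are residually torsion-free nilpotent (\<open>res_tfn_free\<close>, by Magnus),
  so two elements \<open>x\<close>, \<open>u\<close> of a stabilizer commute as soon as they satisfy a relation with exponent
  sum zero in \<open>u\<close> and nonzero in \<open>x\<close> (\<open>commute_if_exponent_sum\<close>).  The theorem
  \<open>odd_artin_tree_action\<close> finds such relations among the Artin generators: if the centers of the
  parabolic subgroups \<open>\<langle>b, c\<rangle>\<close> and \<open>\<langle>a, c\<rangle>\<close> do not both fix points, all generators translate a common
  line along which \<open>a b\<^sup>-\<^sup>1\<close> becomes trivial; if they do, the geometry of the fixed trees of \<open>b c\<close> and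
  \<open>b c b\<close> pins down a vertex stabilizer that contains a suitable pair.  In all cases \<open>a = b\<close>, whereas a
  representation by reflections separates \<open>a\<close> from \<open>b\<close> (\<open>odd_artin_generators_distinct\<close>).\<close>

text \<open>Even labels.  Let \<open>M = 2 k\<close>.  The relations of the Artin group can be rewritten as seven equations,
  each with one side in \<open>u = b c\<close>, \<open>v = a b\<^sup>-\<^sup>1 c b\<close>, \<open>y = (a c)\<^sup>k\<close> and the other side in \<open>\<delta> = b c b\<close>,
  \<open>x = a b\<^sup>-\<^sup>3\<close>, \<open>y\<close> and one further generator \<open>s\<close>, which one of the equations defines.  This is the
  presentation of an amalgam of free groups of ranks \<open>3\<close> and \<open>4\<close> once the seven words on either side
  are known to be free generators of the subgroups that they generate.  For \<open>F\<^sub>4\<close> they are a basis of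
  the subgroup of index two in which the exponent sum of \<open>\<delta>\<close> is even, and for \<open>F\<^sub>3\<close> part of a basis of
  a subgroup of index \<open>k\<close>; both facts are proved by letting the free group act on a labelled
  covering graph (\<open>words3_mon\<close>, \<open>words4_mon\<close>).\<close>



section \<open>Groups as a type class, and groups of bijections\<close>

text \<open>The class is multiplicative so that powers and the product of a list are those of monoids.\<close>

class grp = monoid_mult + inverse +
  assumes inverse_mult [simp]: "inverse a * a = 1"
begin

lemma inverse_mult_assoc [simp]: "inverse a * (a * b) = b"
  by (simp flip: mult.assoc)

lemma mult_left_cancel [simp]: "a * b = a * c \<longleftrightarrow> b = c"
  by (metis inverse_mult_assoc)

lemma mult_inverse [simp]: "a * inverse a = 1"
proof -
  have "inverse a * (a * inverse a) = inverse a * 1" by simp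
  then show ?thesis by (simp only: mult_left_cancel)
qed

lemma mult_inverse_assoc [simp]: "a * (inverse a * b) = b"
  by (simp flip: mult.assoc)

lemma mult_right_cancel [simp]: "b * a = c * a \<longleftrightarrow> b = c"
  by (metis mult.assoc mult_1_right mult_inverse)

lemma inverse_unique: "a * b = 1 \<Longrightarrow> inverse a = b"
  by (metis mult_inverse mult_left_cancel)

lemma inverse_inverse [simp]: "inverse (inverse a) = a"
  by (rule inverse_unique) simp

lemma inverse_one [simp]: "inverse 1 = 1"
  by (rule inverse_unique) simp

lemma inverse_of_mult [simp]: "inverse (a * b) = inverse b * inverse a"
  by (rule inverse_unique) (simp add: mult.assoc)

lemma commute_inverse: "a * b = b * a \<Longrightarrow> a * inverse b = inverse b * a"
  by (metis mult.assoc mult_inverse mult_1_right inverse_mult_assoc)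

lemma conj_power: "(g * a * inverse g) ^ n = g * a ^ n * inverse g"
  by (induction n) (simp_all add: mult.assoc)

lemma commute_power: "a * b = b * a \<Longrightarrow> a ^ n * b = b * a ^ n"
  by (induction n) (simp_all add: mult.assoc, metis mult.assoc)

end

lemma commute_assoc: "a * b = b * a \<Longrightarrow> a * (b * c) = b * (a * c)" for a b c :: "'a::semigroup_mult"
  by (metis mult.assoc)

lemma commute_mult: "a * b = b * a \<Longrightarrow> a * c = c * a \<Longrightarrow> a * (b * c) = b * c * a" for a b c :: "'a::semigroup_mult"
  by (metis mult.assoc)

lemma power_mult_commute:
  fixes a b :: "'a::monoid_mult"
  assumes "a * b = b * a"
  shows "(a * b) ^ n = a ^ n * b ^ n"
proof (induction n)
  case (Suc n)
  have "b * a ^ n = a ^ n * b" using assms by (metis power_commuting_commutes)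
  then have "a * b * (a ^ n * b ^ n) = a * (a ^ n * b) * b ^ n" by (simp add: mult.assoc flip: mult.assoc [of b])
  with Suc show ?case by (simp add: mult.assoc)
qed simp

text \<open>Groups with an arbitrary carrier enter through their actions: bijections of a type form a group of
  class \<open>grp\<close>, and quotients, presented groups and HNN extensions are all realized as groups of bijections.\<close>

typedef 'a sym = "{f :: 'a \<Rightarrow> 'a. bij f}"
  morphisms app Sym by (rule exI [of _ id]) simp

setup_lifting type_definition_sym

instantiation sym :: (type) grp
begin

lift_definition one_sym :: "'a sym" is id by simp
lift_definition times_sym :: "'a sym \<Rightarrow> 'a sym \<Rightarrow> 'a sym" is "(\<circ>)" by (rule bij_comp)
lift_definition inverse_sym :: "'a sym \<Rightarrow> 'a sym" is "inv_into UNIV" by (rule bij_imp_bij_inv)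

instance
proof
  fix a b c :: "'a sym"
  show "a * b * c = a * (b * c)" by transfer (simp add: comp_assoc)
  show "1 * a = a" by transfer simp
  show "a * 1 = a" by transfer simp
  show "inverse a * a = 1" by transfer (simp add: bij_is_inj)
qed

end

lemma app_one [simp]: "app 1 x = x"
  by transfer simp

lemma app_mult [simp]: "app (f * g) x = app f (app g x)"
  by transfer simp

lemma sym_eqI: "(\<And>x. app f x = app g x) \<Longrightarrow> f = g"
  by transfer auto

lemma app_eq_iff [simp]: "app f x = app f y \<longleftrightarrow> x = y"
  by transfer (auto simp: bij_def inj_def)

lemma app_inverse_eq: "app f x = y \<Longrightarrow> app (inverse f) y = x"
  by (metis app_mult app_one inverse_mult)

lemma app_Sym: "bij f \<Longrightarrow> app (Sym f) x = f x"
  by (simp add: Sym_inverse)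

text \<open>The actions below live on subsets of a type.  The identity outside of the subset makes products
  of such maps again maps of this kind.\<close>

definition perm_on :: "'a set \<Rightarrow> ('a \<Rightarrow> 'a) \<Rightarrow> 'a sym"
  where "perm_on X f = Sym (\<lambda>x. if x \<in> X then f x else x)"

lemma app_perm_on:
  assumes "\<And>x. x \<in> X \<Longrightarrow> f x \<in> X \<and> g (f x) = x" and "\<And>x. x \<in> X \<Longrightarrow> g x \<in> X \<and> f (g x) = x"
  shows "app (perm_on X f) x = (if x \<in> X then f x else x)"
proof -
  have "bij (\<lambda>x. if x \<in> X then f x else x)"
    by (rule o_bij [of "\<lambda>x. if x \<in> X then g x else x"]) (use assms in \<open>auto simp: fun_eq_iff\<close>)
  then show ?thesis unfolding perm_on_def by (subst app_Sym) auto
qed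

definition subgrp :: "'g::grp set \<Rightarrow> bool"
  where "subgrp S \<longleftrightarrow> 1 \<in> S \<and> (\<forall>a\<in>S. \<forall>b\<in>S. a * b \<in> S) \<and> (\<forall>a\<in>S. inverse a \<in> S)"

lemma subgrpI: "1 \<in> S \<Longrightarrow> (\<And>a b. a \<in> S \<Longrightarrow> b \<in> S \<Longrightarrow> a * b \<in> S) \<Longrightarrow> (\<And>a. a \<in> S \<Longrightarrow> inverse a \<in> S)
    \<Longrightarrow> subgrp S"
  by (simp add: subgrp_def)

lemma subgrpD:
  assumes "subgrp S"
  shows "1 \<in> S" and "a \<in> S \<Longrightarrow> b \<in> S \<Longrightarrow> a * b \<in> S" and "a \<in> S \<Longrightarrow> inverse a \<in> S"
    and "a \<in> S \<Longrightarrow> a ^ n \<in> S"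
proof -
  show *: "1 \<in> S" "a \<in> S \<Longrightarrow> b \<in> S \<Longrightarrow> a * b \<in> S" "a \<in> S \<Longrightarrow> inverse a \<in> S" for a b
    using assms by (simp_all add: subgrp_def)
  show "a \<in> S \<Longrightarrow> a ^ n \<in> S" by (induction n) (auto intro: *)
qed

definition hom_on :: "'g::grp set \<Rightarrow> ('g \<Rightarrow> 'k::grp) \<Rightarrow> bool"
  where "hom_on S \<theta> \<longleftrightarrow> (\<forall>a\<in>S. \<forall>b\<in>S. \<theta> (a * b) = \<theta> a * \<theta> b)"

lemma hom_onD:
  assumes "hom_on S \<theta>" "subgrp S"
  shows "a \<in> S \<Longrightarrow> b \<in> S \<Longrightarrow> \<theta> (a * b) = \<theta> a * \<theta> b" and "\<theta> 1 = 1"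
    and "a \<in> S \<Longrightarrow> \<theta> (inverse a) = inverse (\<theta> a)" and "a \<in> S \<Longrightarrow> \<theta> (a ^ n) = \<theta> a ^ n"
proof -
  show *: "a \<in> S \<Longrightarrow> b \<in> S \<Longrightarrow> \<theta> (a * b) = \<theta> a * \<theta> b" for a b
    using assms(1) by (simp add: hom_on_def)
  have "\<theta> 1 * \<theta> 1 = \<theta> 1 * 1" using * [of 1 1] subgrpD(1) [OF assms(2)] by simp
  then show one: "\<theta> 1 = 1" by (simp only: mult_left_cancel)
  show "a \<in> S \<Longrightarrow> \<theta> (inverse a) = inverse (\<theta> a)"
    using * [of a "inverse a"] subgrpD(3) [OF assms(2), of a] one by (metis inverse_unique mult_inverse)
  show "a \<in> S \<Longrightarrow> \<theta> (a ^ n) = \<theta> a ^ n"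
    by (induction n) (simp_all add: one * subgrpD [OF assms(2)])
qed

text \<open>A quotient of a group, realized as a group of bijections: \<open>G\<close> permutes the cosets of \<open>N\<close>.\<close>

lemma quotient_hom:
  fixes G N :: "'g::grp set"
  assumes G: "subgrp G" and N: "subgrp N" "N \<subseteq> G"
    and normal: "\<And>g n. g \<in> G \<Longrightarrow> n \<in> N \<Longrightarrow> g * n * inverse g \<in> N"
  obtains \<theta> :: "'g \<Rightarrow> 'g set sym" where "hom_on G \<theta>" "\<And>g. g \<in> G \<Longrightarrow> \<theta> g = 1 \<longleftrightarrow> g \<in> N"
proof
  define X where "X = (\<lambda>h. (*) h ` N) ` G"
  define \<theta> where "\<theta> g = perm_on X (\<lambda>A. (*) g ` A)" for g
  have im: "(*) g ` (*) h ` N = (*) (g * h) ` N" for g h by (auto simp: image_iff mult.assoc)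
  have app_\<theta>: "app (\<theta> g) A = (if A \<in> X then (*) g ` A else A)" if "g \<in> G" for g A
    unfolding \<theta>_def
    by (rule app_perm_on [of _ _ "\<lambda>A. (*) (inverse g) ` A"])
       (use that in \<open>auto simp: X_def im intro!: imageI subgrpD[OF G]\<close>)
  have X: "A \<in> X \<Longrightarrow> g \<in> G \<Longrightarrow> (*) g ` A \<in> X" for g A
    by (auto simp: X_def im intro!: imageI subgrpD[OF G])
  show "hom_on G \<theta>"
    unfolding hom_on_def
  proof (intro ballI sym_eqI)
    fix a b A assume "a \<in> G" "b \<in> G"
    then show "app (\<theta> (a * b)) A = app (\<theta> a * \<theta> b) A"
      using X [of A b] by (auto simp: app_\<theta> subgrpD[OF G] image_image mult.assoc)
  qed
  fix g assume g: "g \<in> G"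
  show "\<theta> g = 1 \<longleftrightarrow> g \<in> N"
  proof
    assume "\<theta> g = 1"
    moreover have "N \<in> X" unfolding X_def using subgrpD(1)[OF G] by (force intro: image_eqI[of _ _ 1])
    ultimately have "(*) g ` N = N" using app_\<theta> [OF g, of N] by simp
    then show "g \<in> N" using subgrpD(1)[OF N(1)] by (metis image_eqI mult_1_right)
  next
    assume gN: "g \<in> N"
    have "(*) (g * h) ` N = (*) h ` N" if h: "h \<in> G" for h
    proof -
      have 1: "inverse h * g' * h \<in> N" if "g' \<in> N" for g'
        using normal [of "inverse h" g'] that h subgrpD(3)[OF G] by simp
      have e: "g * h * n = h * (inverse h * g * h * n)"
        "h * n = g * h * (inverse h * inverse g * h * n)" for n
        by (simp_all add: mult.assoc)
      show ?thesis
      proof (intro equalityI image_subsetI)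
        fix n assume n: "n \<in> N"
        show "g * h * n \<in> (*) h ` N"
          by (subst e(1), rule imageI, rule subgrpD(2)[OF N(1) 1 [OF gN] n])
        show "h * n \<in> (*) (g * h) ` N"
          by (subst e(2), rule imageI, rule subgrpD(2)[OF N(1) 1 [OF subgrpD(3)[OF N(1) gN]] n])
      qed
    qed
    then have "(*) g ` A = A" if "A \<in> X" for A
      using that unfolding X_def by (elim imageE) (simp only: im)
    then show "\<theta> g = 1"
      by (intro sym_eqI) (simp add: app_\<theta> [OF g])
  qed
qed


section \<open>Evaluation of words\<close>

definition letter_val :: "('a \<Rightarrow> 'g::grp) \<Rightarrow> 'a \<times> bool \<Rightarrow> 'g"
  where "letter_val f l = (if snd l then f (fst l) else inverse (f (fst l)))"

definition weval :: "('a \<Rightarrow> 'g::grp) \<Rightarrow> 'a word \<Rightarrow> 'g"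
  where "weval f w = prod_list (map (letter_val f) w)"

lemma weval_simps [simp]:
  "weval f [] = 1"
  "weval f ((s, True) # w) = f s * weval f w"
  "weval f ((s, False) # w) = inverse (f s) * weval f w"
  "weval f (u @ w) = weval f u * weval f w"
  by (simp_all add: weval_def letter_val_def)

lemma weval_Cons: "weval f (l # w) = letter_val f l * weval f w"
  by (simp add: weval_def)

lemma letter_val_simps [simp]: "letter_val f (s, True) = f s" "letter_val f (s, False) = inverse (f s)"
  by (simp_all add: letter_val_def)

lemma words_on_simps [simp]:
  "[] \<in> words_on S"
  "l # w \<in> words_on S \<longleftrightarrow> fst l \<in> S \<and> w \<in> words_on S"
  "u @ w \<in> words_on S \<longleftrightarrow> u \<in> words_on S \<and> w \<in> words_on S"
  by (auto simp: words_on_def mem_Times_iff)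

lemma pos_words_on [simp]: "pos xs \<in> words_on S \<longleftrightarrow> set xs \<subseteq> S"
  by (induction xs) auto

lemma word_eq_words_on: "(u, v) \<in> word_eq S R \<Longrightarrow> u \<in> words_on S \<and> v \<in> words_on S"
  by (induction rule: word_eq.induct) auto

definition satisfies :: "'a set \<Rightarrow> ('a word \<times> 'a word) set \<Rightarrow> ('a \<Rightarrow> 'g::grp) \<Rightarrow> bool"
  where "satisfies S R f \<longleftrightarrow>
    (\<forall>(u, v)\<in>R. u \<in> words_on S \<longrightarrow> v \<in> words_on S \<longrightarrow> weval f u = weval f v)"

lemma weval_cong_word_eq: "(u, v) \<in> word_eq S R \<Longrightarrow> satisfies S R f \<Longrightarrow> weval f u = weval f v"
proof (induction rule: word_eq.induct)
  case (cancel s p) then show ?case by (cases p) simp_all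
qed (auto simp: satisfies_def)

lemma equiv_word_eq: "equiv (words_on S) (word_eq S R)"
  by (rule equivI)
     (auto simp: refl_on_def sym_def trans_def dest: word_eq_words_on
       intro: word_eq.refl word_eq.sym word_eq.trans)

lemma word_eq_append:
  assumes "(u, u') \<in> word_eq S R" "(v, v') \<in> word_eq S R"
  shows "(u @ v, u' @ v') \<in> word_eq S R"
  using word_eq.congr [OF assms(1), of "[]" v] word_eq.congr [OF assms(2), of u' "[]"]
    assms [THEN word_eq_words_on] by (auto intro: word_eq.trans)

definition inv_word :: "'a word \<Rightarrow> 'a word"
  where "inv_word w = rev (map (\<lambda>(s, p). (s, \<not> p)) w)"

lemma weval_inv_word [simp]: "weval f (inv_word w) = inverse (weval f w)"
  by (induction w) (auto simp: inv_word_def weval_Cons letter_val_def)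

lemma inv_word_words_on [simp]: "inv_word w \<in> words_on S \<longleftrightarrow> w \<in> words_on S"
  by (induction w) (auto simp: inv_word_def)

lemma cancel_word:
  assumes "w \<in> words_on S"
  shows "(inv_word w @ w, []) \<in> word_eq S R" and "(w @ inv_word w, []) \<in> word_eq S R"
proof -
  have *: "(inv_word w @ w, []) \<in> word_eq S R" if "w \<in> words_on S" for w
    using that
  proof (induction w)
    case Nil show ?case by (simp add: inv_word_def word_eq.refl)
  next
    case (Cons l w)
    obtain s p where l: "l = (s, p)" by fastforce
    have "([(s, \<not> p), (s, p)], []) \<in> word_eq S R"
      using word_eq.cancel [of s S "\<not> p"] Cons.prems l by simp
    from word_eq.congr [OF this, of "inv_word w" w] Cons.prems l
    have "(inv_word (l # w) @ l # w, inv_word w @ w) \<in> word_eq S R"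
      by simp (simp add: inv_word_def)
    with Cons show ?case by (auto intro: word_eq.trans)
  qed
  show "(inv_word w @ w, []) \<in> word_eq S R" by (rule * [OF assms])
  have "inv_word (inv_word w) = w" by (induction w) (auto simp: inv_word_def)
  with * [of "inv_word w"] assms show "(w @ inv_word w, []) \<in> word_eq S R" by simp
qed

text \<open>The generators act on the set of classes of words by left multiplication.  This action satisfies
  the relations, and a word is recovered from it, up to equivalence, as the image of the class of the
  empty word.  So an equivalence of words can be derived by computing in groups of class \<open>grp\<close>.\<close>

lemma word_eq_if_weval_eq:
  fixes u v :: "'a word"
  assumes u: "u \<in> words_on S" and v: "v \<in> words_on S"
    and eq: "\<And>f :: 'a \<Rightarrow> 'a word set sym. satisfies S R f \<Longrightarrow> weval f u = weval f v"
  shows "(u, v) \<in> word_eq S R"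
proof -
  define X where "X = words_on S // word_eq S R"
  define cl where "cl w = word_eq S R `` {w}" for w
  note eqv = equiv_word_eq [of S R]
  have cl_eq: "cl w = cl w' \<longleftrightarrow> (w, w') \<in> word_eq S R" if "w \<in> words_on S" "w' \<in> words_on S" for w w'
    unfolding cl_def using eq_equiv_class_iff [OF eqv that] by simp
  have X: "X = cl ` words_on S" by (auto simp: X_def quotient_def cl_def)
  define act where "act w A = \<Union>((\<lambda>w'. cl (w @ w')) ` A)" for w A
  have act_cl: "act w (cl w') = cl (w @ w')" if w: "w \<in> words_on S" and w': "w' \<in> words_on S" for w w'
  proof -
    have "cl (w @ w'') = cl (w @ w')" if "w'' \<in> cl w'" for w''
    proof -
      have "(w', w'') \<in> word_eq S R" using that by (simp add: cl_def)
      with w w' show ?thesis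
        by (subst cl_eq) (auto intro: word_eq_append word_eq.refl word_eq.sym dest: word_eq_words_on)
    qed
    moreover have "w' \<in> cl w'" using w' by (simp add: cl_def word_eq.refl)
    ultimately show ?thesis unfolding act_def by blast
  qed
  define f where "f s = perm_on X (act [(s, True)])" for s
  have canc: "act w (act (inv_word w) A) = A" "act (inv_word w) (act w A) = A" "act w A \<in> X"
    if A: "A \<in> X" and w: "w \<in> words_on S" for w A
  proof -
    obtain w' where w': "A = cl w'" "w' \<in> words_on S" using A by (auto simp: X)
    have "(w @ inv_word w @ w', w') \<in> word_eq S R" "(inv_word w @ w @ w', w') \<in> word_eq S R"
      using word_eq_append [OF cancel_word(2) [OF w] word_eq.refl [OF w'(2)]]
        word_eq_append [OF cancel_word(1) [OF w] word_eq.refl [OF w'(2)]] by simp_all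
    then show "act w (act (inv_word w) A) = A" "act (inv_word w) (act w A) = A" "act w A \<in> X"
      using w w' by (simp_all add: act_cl cl_eq X)
  qed
  have app_f: "app (f s) A = act [(s, True)] A" "app (inverse (f s)) A = act [(s, False)] A"
    if s: "s \<in> S" and A: "A \<in> X" for s A
  proof -
    have 1: "app (f s) A = act [(s, True)] A" if "A \<in> X" for A
      unfolding f_def using that
      by (subst app_perm_on [of X "act [(s, True)]" "act [(s, False)]"])
         (use canc [where w = "[(s, True)]"] canc [where w = "[(s, False)]"] s in \<open>auto simp: inv_word_def\<close>)
    show "app (f s) A = act [(s, True)] A" by (rule 1 [OF A])
    show "app (inverse (f s)) A = act [(s, False)] A"
      by (rule app_inverse_eq)
         (use 1 [of "act [(s, False)] A"] canc [OF A, of "[(s, False)]"] canc [OF A, of "[(s, True)]"] s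
           in \<open>auto simp: inv_word_def\<close>)
  qed
  have app_weval: "app (weval f w) (cl w') = cl (w @ w')" if "w \<in> words_on S" "w' \<in> words_on S" for w w'
    using that
  proof (induction w)
    case (Cons l w)
    obtain s p where l: "l = (s, p)" by fastforce
    have "app (letter_val f l) (cl (w @ w')) = cl (l # w @ w')"
      using Cons.prems l app_f [of s "cl (w @ w')"] act_cl [of "[(s, p)]" "w @ w'"]
      by (cases p) (auto simp: X)
    with Cons show ?case by (simp add: weval_Cons)
  qed simp
  have out: "app (f s) A = A" if "A \<notin> X" "s \<in> S" for s A
    unfolding f_def using that
    by (subst app_perm_on [of X "act [(s, True)]" "act [(s, False)]"])
       (use canc [where w = "[(s, True)]"] canc [where w = "[(s, False)]"] in \<open>auto simp: inv_word_def\<close>)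
  have out': "app (weval f w) A = A" if "A \<notin> X" "w \<in> words_on S" for w A
    using that(2)
  proof (induction w)
    case (Cons l w)
    then show ?case
      using out [OF that(1), of "fst l"] by (auto simp: weval_Cons letter_val_def app_inverse_eq)
  qed simp
  have "satisfies S R f"
    unfolding satisfies_def
  proof clarify
    fix l r assume lr: "(l, r) \<in> R" "l \<in> words_on S" "r \<in> words_on S"
    then have e: "(l, r) \<in> word_eq S R" by (rule word_eq.relation)
    show "weval f l = weval f r"
    proof (rule sym_eqI)
      fix A
      show "app (weval f l) A = app (weval f r) A"
      proof (cases "A \<in> X")
        case True
        then obtain w where w: "A = cl w" "w \<in> words_on S" by (auto simp: X)
        with lr e show ?thesis
          by (simp add: app_weval cl_eq word_eq_append word_eq.refl)
      next
        case False with lr show ?thesis by (simp add: out')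
      qed
    qed
  qed
  from eq [OF this] have "app (weval f u) (cl []) = app (weval f v) (cl [])" by simp
  then show ?thesis using u v by (simp add: app_weval cl_eq)
qed


section \<open>Simplicial trees as integer metric spaces\<close>

text \<open>The vertices of a simplicial tree with the path metric.  The four-point condition says that the metric
  embeds in a real tree, parity excludes branch points in the middle of an edge, and the last
  assumption provides geodesics.\<close>

locale int_tree =
  fixes V :: "'p set" and d :: "'p \<Rightarrow> 'p \<Rightarrow> nat"
  assumes dist_zero: "x \<in> V \<Longrightarrow> y \<in> V \<Longrightarrow> d x y = 0 \<longleftrightarrow> x = y"
    and dist_sym: "x \<in> V \<Longrightarrow> y \<in> V \<Longrightarrow> d x y = d y x"
    and four_point: "x \<in> V \<Longrightarrow> y \<in> V \<Longrightarrow> z \<in> V \<Longrightarrow> w \<in> V \<Longrightarrow>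
      d x y + d z w \<le> max (d x z + d y w) (d x w + d y z)"
    and dist_even: "x \<in> V \<Longrightarrow> y \<in> V \<Longrightarrow> z \<in> V \<Longrightarrow> even (d x y + d y z + d x z)"
    and between: "x \<in> V \<Longrightarrow> y \<in> V \<Longrightarrow> i \<le> d x y \<Longrightarrow> \<exists>z\<in>V. d x z = i \<and> d z y = d x y - i"
begin

lemma dist_refl [simp]: "x \<in> V \<Longrightarrow> d x x = 0"
  by (simp add: dist_zero)

lemma triangle: "x \<in> V \<Longrightarrow> y \<in> V \<Longrightarrow> z \<in> V \<Longrightarrow> d x y \<le> d x z + d z y"
  using four_point [of x y z z] by (simp add: dist_sym [of z y])

lemma between_unique:
  assumes "x \<in> V" "y \<in> V" "z \<in> V" "z' \<in> V"
    and "d x z + d z y = d x y" "d x z' + d z' y = d x y" "d x z = d x z'"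
  shows "z = z'"
  using four_point [of z z' x y] assms dist_sym [of z x] dist_sym [of z' x] dist_zero [of z z']
  by simp

text \<open>Two geodesics that overlap in a nontrivial segment fit together, as a tree has no circuits.\<close>

lemma local_to_global:
  assumes "x \<in> V" "y \<in> V" "z \<in> V" "w \<in> V"
    and "d x z = d x y + d y z" "d y w = d y z + d z w" "y \<noteq> z"
  shows "d x w = d x y + d y z + d z w"
  using four_point [of x z y w] triangle [of x w z] dist_zero [of y z] dist_sym [of z y] assms
  by simp

lemma between_dist:
  assumes "x \<in> V" "y \<in> V" "z \<in> V" "w \<in> V"
    and "d x z + d z y = d x y" "d x w + d w y = d x y" "d x z \<le> d x w"
  shows "d z w = d x w - d x z"
  using four_point [of z w x y] triangle [of x w z] assms dist_sym [of z x] dist_sym [of w x]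
  by simp

definition line :: "(int \<Rightarrow> 'p) \<Rightarrow> bool"
  where "line f \<longleftrightarrow> (\<forall>i. f i \<in> V) \<and> (\<forall>i j. int (d (f i) (f j)) = \<bar>i - j\<bar>)"

lemma lineD: "line f \<Longrightarrow> f i \<in> V" "line f \<Longrightarrow> int (d (f i) (f j)) = \<bar>i - j\<bar>"
  by (simp_all add: line_def)

lemma line_inj: "line f \<Longrightarrow> f i = f j \<longleftrightarrow> i = j"
  using dist_zero [of "f i" "f j"] lineD(1) [of f] lineD(2) [of f i j] by auto

text \<open>A path that does not backtrack extends a geodesic in every step, by \<open>local_to_global\<close>.\<close>

lemma lineI:
  assumes V: "\<And>i. f i \<in> V"
    and 1: "\<And>i. d (f i) (f (i + 1)) = 1" and 2: "\<And>i. d (f i) (f (i + 2)) = 2"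
  shows "line f"
proof -
  have *: "d (f i) (f (i + int n)) = n \<and> d (f i) (f (i + int n + 1)) = n + 1" for i n
  proof (induction n)
    case 0 show ?case using V 1 by simp
  next
    case (Suc n)
    have "f (i + int n) \<noteq> f (i + int n + 1)" using 1 [of "i + int n"] V dist_zero by fastforce
    with local_to_global [of "f i" "f (i + int n)" "f (i + int n + 1)" "f (i + int n + 2)"]
      Suc 1 [of "i + int n"] 1 [of "i + int n + 1"] 2 [of "i + int n"] V
    show ?case by (simp add: algebra_simps)
  qed
  have "int (d (f i) (f j)) = \<bar>i - j\<bar>" if "i \<le> j" for i j
    using * [of i "nat (j - i)"] that by simp
  then show ?thesis
    unfolding line_def using V dist_sym by (metis abs_minus_commute linear)
qed

end

locale tree_action = int_tree V d for V :: "'p set" and d +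
  fixes G :: "'g::grp set" and act :: "'g \<Rightarrow> 'p \<Rightarrow> 'p"
  assumes G: "subgrp G"
    and act_in [simp]: "g \<in> G \<Longrightarrow> x \<in> V \<Longrightarrow> act g x \<in> V"
    and act_one [simp]: "x \<in> V \<Longrightarrow> act 1 x = x"
    and act_mult: "g \<in> G \<Longrightarrow> h \<in> G \<Longrightarrow> x \<in> V \<Longrightarrow> act (g * h) x = act g (act h x)"
    and act_isom [simp]: "g \<in> G \<Longrightarrow> x \<in> V \<Longrightarrow> y \<in> V \<Longrightarrow> d (act g x) (act g y) = d x y"
    and no_inversion: "g \<in> G \<Longrightarrow> x \<in> V \<Longrightarrow> d x (act g x) = 1 \<Longrightarrow> act g (act g x) \<noteq> x"
begin

lemmas G_closed [simp] = subgrpD [OF G]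

lemma act_inverse [simp]:
  "g \<in> G \<Longrightarrow> x \<in> V \<Longrightarrow> act (inverse g) (act g x) = x"
  "g \<in> G \<Longrightarrow> x \<in> V \<Longrightarrow> act g (act (inverse g) x) = x"
  by (simp_all flip: act_mult)

lemma act_eq_iff [simp]: "g \<in> G \<Longrightarrow> x \<in> V \<Longrightarrow> y \<in> V \<Longrightarrow> act g x = act g y \<longleftrightarrow> x = y"
  by (metis act_inverse(1))

lemma act_fix_inverse: "g \<in> G \<Longrightarrow> x \<in> V \<Longrightarrow> act g x = y \<Longrightarrow> act (inverse g) y = x"
  by auto

lemma act_fix_power: "g \<in> G \<Longrightarrow> x \<in> V \<Longrightarrow> act g x = x \<Longrightarrow> act (g ^ n) x = x"
  by (induction n) (simp_all add: act_mult)

definition stab :: "'p \<Rightarrow> 'g set"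
  where "stab x = {g \<in> G. act g x = x}"

lemma subgrp_stab: "x \<in> V \<Longrightarrow> subgrp (stab x)"
  by (rule subgrpI) (auto simp: stab_def act_mult act_fix_inverse)

text \<open>An element with a fixed point \<open>q\<close> fixes the midpoint of every segment from \<open>v\<close> to its image,
  since the segments from \<open>q\<close> to \<open>v\<close> and to the image of \<open>v\<close> branch there.\<close>

lemma midpoint_fixed:
  assumes g: "g \<in> G" and q: "q \<in> V" "act g q = q" and v: "v \<in> V"
  obtains y where "y \<in> V" "act g y = y" "2 * d v y = d v (act g v)" "d y (act g v) = d v y"
    "d q v = d q y + d y v"
proof -
  have qv: "d q (act g v) = d q v" using act_isom [OF g q(1) v] q(2) by simp
  have "even (d v (act g v))" using dist_even [of q v "act g v"] qv g q v by (auto simp: even_add)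
  then obtain s where s: "d v (act g v) = 2 * s" by auto
  have "s \<le> d q v" using triangle [of v "act g v" q] s qv g q v by (simp add: dist_sym [of v q])
  then obtain y where y: "y \<in> V" "d q y = d q v - s" "d y v = s"
    using between [of q v "d q v - s"] q v by auto
  have gy: "d q (act g y) = d q v - s" "d (act g y) (act g v) = s"
    using act_isom [OF g q(1) y(1)] y g q v by simp_all
  have "d y (act g y) = 0"
    using four_point [of y "act g y" q v] four_point [of "act g y" v q "act g v"]
      y gy qv s \<open>s \<le> d q v\<close> g q v
      dist_sym [of y q] dist_sym [of "act g y" q] dist_sym [of "act g y" v] dist_sym [of v q] by simp
  then have fx: "act g y = y" using dist_zero g y by simp
  show ?thesis
    by (rule that [of y]) (use y gy fx s \<open>s \<le> d q v\<close> dist_sym [of v y] v in simp_all)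
qed

definition shifts :: "'g \<Rightarrow> (int \<Rightarrow> 'p) \<Rightarrow> int \<Rightarrow> bool"
  where "shifts g f n \<longleftrightarrow> (\<forall>i. act g (f i) = f (i + n))"

lemma shiftsD: "shifts g f n \<Longrightarrow> act g (f i) = f (i + n)"
  by (simp add: shifts_def)

lemma shifts_one: "line f \<Longrightarrow> shifts 1 f 0"
  by (simp add: shifts_def lineD)

lemma shifts_mult:
  "line f \<Longrightarrow> g \<in> G \<Longrightarrow> h \<in> G \<Longrightarrow> shifts g f m \<Longrightarrow> shifts h f n \<Longrightarrow> shifts (g * h) f (m + n)"
  by (simp add: shifts_def lineD act_mult add_ac)

lemma shifts_inverse: "line f \<Longrightarrow> g \<in> G \<Longrightarrow> shifts g f m \<Longrightarrow> shifts (inverse g) f (- m)"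
  by (auto simp: shifts_def lineD intro!: act_fix_inverse)

lemma shifts_power: "line f \<Longrightarrow> g \<in> G \<Longrightarrow> shifts g f m \<Longrightarrow> shifts (g ^ n) f (int n * m)"
  by (induction n) (auto simp: shifts_one distrib_right intro: shifts_mult)

lemma shifts_unique: "line f \<Longrightarrow> shifts g f m \<Longrightarrow> shifts g f n \<Longrightarrow> m = n"
  using line_inj [of f m n] by (metis add_0 shiftsD)

text \<open>The powers of a translation move the point \<open>f 0\<close> arbitrarily far, while the powers of an element with
  a fixed point \<open>x\<close> move it at most by twice the distance to \<open>x\<close>.\<close>

lemma shift_no_fixed_point:
  assumes f: "line f" and g: "g \<in> G" "shifts g f m" and x: "x \<in> V" "act (g ^ n) x = x"
  shows "int n * m = 0"
proof (rule ccontr)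
  assume nm: "int n * m \<noteq> 0"
  define k where "k = 2 * d x (f 0) + 1"
  have "shifts (g ^ n) f (int n * m)" by (rule shifts_power [OF f g])
  from shifts_power [OF f _ this, of k] g have "shifts ((g ^ n) ^ k) f (int k * (int n * m))" by simp
  then have 1: "act ((g ^ n) ^ k) (f 0) = f (int k * (int n * m))" by (simp add: shifts_def)
  have 2: "act ((g ^ n) ^ k) x = x" using act_fix_power [of "g ^ n" x k] g x by simp
  have "d (f 0) (f (int k * (int n * m))) \<le> d (f 0) x + d x (act ((g ^ n) ^ k) (f 0))"
    using 1 triangle [of "f 0" "f (int k * (int n * m))" x] lineD(1)[OF f] x by simp
  also have "d x (act ((g ^ n) ^ k) (f 0)) = d x (f 0)"
    using act_isom [of "(g ^ n) ^ k" x "f 0"] 2 g x lineD(1)[OF f] by simp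
  finally have "d (f 0) (f (int k * (int n * m))) < k"
    unfolding k_def using dist_sym [of x "f 0"] x lineD(1)[OF f] by simp
  moreover have "int (d (f 0) (f (int k * (int n * m)))) = int k * \<bar>int n * m\<bar>"
    using lineD(2)[OF f] by (simp add: abs_mult)
  moreover have "1 \<le> \<bar>int n * m\<bar>" using nm by linarith
  then have "int k * 1 \<le> int k * \<bar>int n * m\<bar>" by (intro mult_left_mono) auto
  ultimately show False by linarith
qed

text \<open>If \<open>v\<close>, \<open>g v\<close>, \<open>g\<^sup>2 v\<close> lie on a geodesic in this order, then the translates of the segment from \<open>v\<close>
  to \<open>g v\<close> under the powers of \<open>g\<close> fit together without backtracking.\<close>

lemma axis_through:
  assumes g: "g \<in> G" and v: "v \<in> V" "act g v \<noteq> v" and 2: "d v (act g (act g v)) = 2 * d v (act g v)"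
  obtains f where "line f" "shifts g f (int (d v (act g v)))" "f 0 = v"
proof -
  define l where "l = d v (act g v)"
  have gv: "act g v \<in> V" and l: "0 < l" using v g dist_zero [of v "act g v"] by (auto simp: l_def)
  have "\<exists>z. z \<in> V \<and> d v z = i \<and> d z (act g v) = l - i" if "i \<le> l" for i
    using between [OF v(1) gv, of i] that unfolding l_def by auto
  then obtain c where c: "i \<le> l \<Longrightarrow> c i \<in> V \<and> d v (c i) = i \<and> d (c i) (act g v) = l - i" for i
    by metis
  have c0: "c 0 = v" and cl: "c l = act g v"
    using c [of 0] c [of l] dist_zero [of v "c 0"] dist_zero [of "c l" "act g v"] v gv by auto
  have cc: "d (c i) (c j) = j - i" if "i \<le> j" "j \<le> l" for i j
    using between_dist [of v "act g v" "c i" "c j"] c [of i] c [of j] that v gv by (simp add: l_def)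
  \<comment> \<open>no backtracking at \<open>g v\<close>\<close>
  have turn: "d (c (l - 1)) (act g (c 1)) = 2"
  proof -
    have 1: "c (l - 1) \<in> V" "d v (c (l - 1)) = l - 1" "d (c (l - 1)) (act g v) = 1"
      "c 1 \<in> V" "d v (c 1) = 1" "d (c 1) (act g v) = l - 1"
      using c [of "l - 1"] c [of 1] l by auto
    have 2: "2 * l = d v (act g (act g v))" using 2 by (simp add: l_def)
    have "2 * l \<le> (l - 1) + d (c (l - 1)) (act g (act g v))"
      using triangle [of v "act g (act g v)" "c (l - 1)"] 1 2 g v by simp
    moreover have "d (c (l - 1)) (act g (act g v)) \<le> d (c (l - 1)) (act g (c 1)) + (l - 1)"
      using triangle [of "c (l - 1)" "act g (act g v)" "act g (c 1)"] act_isom [of g "c 1" "act g v"] 1 g v by simp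
    moreover have "d (c (l - 1)) (act g (c 1)) \<le> 2"
      using triangle [of "c (l - 1)" "act g (c 1)" "act g v"] act_isom [of g v "c 1"] 1 g v by simp
    ultimately show ?thesis using l by linarith
  qed
  \<comment> \<open>the powers of \<open>g\<close> with integer exponents\<close>
  define pw where "pw k = (if k \<ge> 0 then g ^ nat k else inverse g ^ nat (- k))" for k :: int
  have pw: "pw k \<in> G" for k using g by (simp add: pw_def)
  have pw1: "pw (k + 1) = g * pw k" "pw (k + 1) = pw k * g" for k
  proof -
    have "pw (k + 1) = g * pw k \<and> pw (k + 1) = pw k * g"
    proof (cases "k \<ge> 0")
      case True
      then have "nat (k + 1) = Suc (nat k)" by simp
      with True show ?thesis by (simp add: pw_def power_commutes)
    next
      case False
      then have "nat (- k) = Suc (nat (- (k + 1)))" by simp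
      then have "pw k = inverse g * inverse g ^ nat (- (k + 1))" "pw k = inverse g ^ nat (- (k + 1)) * inverse g"
        using False by (simp_all add: pw_def flip: power_Suc2)
      moreover have "pw (k + 1) = inverse g ^ nat (- (k + 1))"
        using False by (cases "k = -1") (auto simp: pw_def)
      ultimately show ?thesis by (metis inverse_mult mult.assoc mult_1_right mult_inverse_assoc)
    qed
    then show "pw (k + 1) = g * pw k" "pw (k + 1) = pw k * g" by blast+
  qed
  define f where "f i = act (pw (i div int l)) (c (nat (i mod int l)))" for i
  have f_eq: "f (k * int l + int r) = act (pw k) (c r)" if "r \<le> l" for k r
  proof (cases "r = l")
    case True
    have "k * int l + int r = (k + 1) * int l" using True by (simp add: algebra_simps)
    then have "f (k * int l + int r) = act (pw (k + 1)) (c 0)" using l by (simp add: f_def)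
    also have "\<dots> = act (pw k) (c r)"
      unfolding pw1(2) using True c0 cl act_mult [OF pw g v(1)] by simp
    finally show ?thesis .
  next
    case False
    with that l show ?thesis by (simp add: f_def)
  qed
  have split: "\<exists>k r. i = k * int l + int r \<and> r < l" for i
    by (rule exI [of _ "i div int l"], rule exI [of _ "nat (i mod int l)"]) (use l in \<open>simp add: nat_less_iff\<close>)
  have inV: "f i \<in> V" for i
    using split [of i] f_eq c pw by (metis act_in less_imp_le)
  have "line f"
  proof (rule lineI [OF inV])
    fix i
    obtain k r where r: "i = k * int l + int r" "r < l" using split by blast
    have e1: "f i = act (pw k) (c r)" using f_eq [of r k] r by simp
    have e2: "f (i + 1) = act (pw k) (c (r + 1))" using f_eq [of "r + 1" k] r by (simp add: add_ac)
    show "d (f i) (f (i + 1)) = 1"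
      unfolding e1 e2 using cc [of r "r + 1"] r c pw by simp
    show "d (f i) (f (i + 2)) = 2"
    proof (cases "r + 2 \<le> l")
      case True
      then have "f (i + 2) = act (pw k) (c (r + 2))" using f_eq [of "r + 2" k] r by (simp add: add_ac)
      with True show ?thesis unfolding e1 using cc [of r "r + 2"] c pw by simp
    next
      case False
      with r have r': "r = l - 1" by simp
      have "i + 2 = (k + 1) * int l + int 1" using r r' l by (simp add: algebra_simps of_nat_diff)
      then have "f (i + 2) = act (pw (k + 1)) (c 1)" using f_eq [of 1 "k + 1"] l by (simp only:)
      also have "\<dots> = act (pw k) (act g (c 1))" unfolding pw1(2) using c l by (simp add: act_mult pw g)
      finally show ?thesis unfolding e1 using turn c [of r] c [of 1] r r' l pw g by simp
    qed
  qed
  moreover have "shifts g f (int l)"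
    unfolding shifts_def
  proof
    fix i
    obtain k r where r: "i = k * int l + int r" "r < l" using split by blast
    have "i + int l = (k + 1) * int l + int r" using r by (simp add: algebra_simps)
    then have "f (i + int l) = act (pw (k + 1)) (c r)" using f_eq [of r "k + 1"] r(2) by (simp only:)
    also have "\<dots> = act g (act (pw k) (c r))" unfolding pw1(1) using c r by (simp add: act_mult pw g)
    also have "\<dots> = act g (f i)" using f_eq [of r k] r by simp
    finally show "act g (f i) = f (i + int l)" by simp
  qed
  moreover have "f 0 = v" using f_eq [of 0 0] c0 v by (simp add: pw_def)
  ultimately show ?thesis using that unfolding l_def by blast
qed

text \<open>A vertex \<open>v\<close> with minimal displacement lies on an axis.  If the path from \<open>v\<close> through \<open>g v\<close> to \<open>g\<^sup>2 v\<close>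
  backtracked at \<open>g v\<close>, then the neighbor of \<open>v\<close> on the way to \<open>g v\<close> would be displaced less, or else
  \<open>g\<close> would invert an edge.\<close>

lemma axis_exists:
  assumes g: "g \<in> G" and nofix: "\<And>x. x \<in> V \<Longrightarrow> act g x \<noteq> x" and V: "V \<noteq> {}"
  obtains f n where "line f" "shifts g f n" "n > 0"
proof -
  obtain x0 where "x0 \<in> V" using V by blast
  then obtain v where v: "v \<in> V" and min: "\<And>x. x \<in> V \<Longrightarrow> d v (act g v) \<le> d x (act g x)"
    using arg_min_nat_lemma [of "\<lambda>x. x \<in> V" x0 "\<lambda>x. d x (act g x)"] by metis
  define l where "l = d v (act g v)"
  have gv: "act g v \<in> V" "act g (act g v) \<in> V" and l: "0 < l"
    using v g nofix [OF v] dist_zero [of v "act g v"] by (auto simp: l_def)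
  have l': "d (act g v) (act g (act g v)) = l" using g v gv by (simp add: l_def)
  obtain y' where y': "y' \<in> V" "d v y' = 1" "d y' (act g v) = l - 1"
    using between [OF v gv(1), of 1] l unfolding l_def by auto
  obtain y where y: "y \<in> V" "d v y = l - 1" "d y (act g v) = 1"
    using between [OF v gv(1), of "l - 1"] l unfolding l_def by auto
  have gy': "act g y' \<in> V" "d (act g v) (act g y') = 1" "d (act g y') (act g (act g v)) = l - 1"
    using g v gv y' by simp_all
  have "d v (act g (act g v)) = 2 * l"
  proof (rule ccontr)
    assume n: "d v (act g (act g v)) \<noteq> 2 * l"
    have "d y (act g y') \<noteq> 2"
    proof
      assume 2: "d y (act g y') = 2"
      have "y \<noteq> act g v" "act g v \<noteq> act g y'" using y gy' gv by auto
      with local_to_global [of v y "act g v" "act g y'"] 2 y gy' v gv l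
      have "d v (act g y') = l + 1" by (simp add: l_def)
      with local_to_global [of v "act g v" "act g y'" "act g (act g v)"] gy' v gv l l' n \<open>act g v \<noteq> act g y'\<close>
      show False by (simp add: l_def)
    qed
    moreover have "even (d y (act g v) + d (act g v) (act g y') + d y (act g y'))"
      using dist_even y gy' gv by blast
    then have "even (d y (act g y'))" using y gy' by simp
    moreover have "d y (act g y') \<le> 2" using triangle [of y "act g y'" "act g v"] y gy' gv by simp
    ultimately have "d y (act g y') = 0" by (auto elim!: evenE)
    then have yy: "y = act g y'" using dist_zero y gy' by simp
    show False
    proof (cases "l = 1")
      case True
      then have "y = v" "y' = act g v" using y y' dist_zero v gv by auto
      with yy no_inversion [OF g v] True show False by (simp add: l_def)
    next
      case False
      have "d y' y = l - 2"
        using between_dist [of v "act g v" y' y] y y' v gv l False by (simp add: l_def)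
      with min [OF y'(1)] yy False l show False by (simp add: l_def)
    qed
  qed
  with axis_through [OF g v] nofix v l show ?thesis
    by (metis l_def of_nat_0_less_iff that)
qed

lemma power_fixed_point:
  assumes "g \<in> G" "x \<in> V" "act (g ^ n) x = x" "n > 0"
  obtains y where "y \<in> V" "act g y = y"
  using axis_exists [OF assms(1)] shift_no_fixed_point [OF _ assms(1) _ assms(2,3)] assms(2,4)
  by (metis empty_iff less_numeral_extra(3) mult_eq_0_iff of_nat_eq_0_iff)

text \<open>Elements commuting with a translation preserve its axis and its two ends: they move the axis
  by a bounded amount, and lines at bounded distance coincide.\<close>

lemma commuting_shift:
  assumes f: "line f" and b: "b \<in> G" "shifts b f m" "m \<noteq> 0" and h: "h \<in> G" "h * b = b * h"
  obtains n where "shifts h f n"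
proof -
  note fV = lineD(1)[OF f] and fd = lineD(2)[OF f]
  define D where "D = d (f 0) (act h (f 0))"
  have hb: "act h (act b x) = act b (act h x)" if "x \<in> V" for x
    using h b that by (simp flip: act_mult)
  have hf: "act h (f (i + m)) = act b (act h (f i))" for i
    using hb [OF fV, of i] shiftsD [OF b(2), of i] by simp
  have pos: "d (f (int n * m)) (act h (f (int n * m))) = D" for n
  proof (induction n)
    case (Suc n)
    have "f (int (Suc n) * m) = act b (f (int n * m))" using shiftsD [OF b(2)] by (simp add: algebra_simps)
    with Suc hb [OF fV] show ?case using fV b h by simp
  qed (simp add: D_def)
  have neg: "d (f (- (int n * m))) (act h (f (- (int n * m)))) = D" for n
  proof (induction n)
    case (Suc n)
    have "f (- (int n * m)) = act b (f (- (int (Suc n) * m)))" using shiftsD [OF b(2)] by (simp add: algebra_simps)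
    with Suc hb [OF fV] show ?case using fV b h by simp
  qed (simp add: D_def)
  have ex: "\<exists>j. act h (f i) = f j" for i
  proof -
    define n where "n = D + nat \<bar>i\<bar> + 1"
    have "1 \<le> \<bar>m\<bar>" using b(3) by linarith
    then have "int n * 1 \<le> int n * \<bar>m\<bar>" by (intro mult_left_mono) auto
    then have "int n \<le> \<bar>int n * m\<bar>" by (simp add: abs_mult)
    then obtain N where N: "N = \<bar>int n * m\<bar>" "N > int D + \<bar>i\<bar>" unfolding n_def by (auto simp: abs_mult)
    have dN: "d (f N) (act h (f N)) = D" "d (f (- N)) (act h (f (- N))) = D"
      using pos [of n] neg [of n] unfolding N(1) abs_if by (auto split: if_splits)
    let ?P = "f (- N)" and ?Q = "f N" and ?P' = "act h (f (- N))" and ?Q' = "act h (f N)" and ?y = "act h (f i)"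
    have V: "?P \<in> V" "?Q \<in> V" "?P' \<in> V" "?Q' \<in> V" "?y \<in> V" using fV h by simp_all
    have e: "int (d ?y ?P') = i + N" "int (d ?y ?Q') = N - i" "int (d ?P' ?Q') = 2 * N" "int (d ?P ?Q) = 2 * N"
      using fV h fd N(2) by simp_all
    have 1: "d ?y ?P + d ?P' ?Q' \<le> max (d ?y ?P' + d ?P ?Q') (d ?y ?Q' + D)"
      using four_point [of ?y ?P ?P' ?Q'] V dN dist_sym [of ?P ?P'] by simp
    have 2: "d ?y ?Q + d ?P ?Q' \<le> max (d ?y ?P + D) (d ?y ?Q' + d ?P ?Q)"
      using four_point [of ?y ?Q ?P ?Q'] V dN dist_sym [of ?P ?Q] by simp
    have 3: "d ?P ?Q \<le> d ?P ?y + d ?y ?Q" using triangle V by blast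
    have 4: "d ?P ?y + d ?y ?Q = d ?P ?Q"
      using 1 2 3 e N(2) dist_sym [of ?y ?P] V by linarith
    have "?y = f (- N + int (d ?P ?y))"
    proof (rule between_unique [of ?P ?Q])
      have le: "int (d ?P ?y) \<le> 2 * N" using 4 e(4) by linarith
      have "int (d ?P (f (- N + int (d ?P ?y)))) = int (d ?P ?y)"
        "int (d (f (- N + int (d ?P ?y))) ?Q) = 2 * N - int (d ?P ?y)"
        using fd le by simp_all
      then show "d ?P (f (- N + int (d ?P ?y))) + d (f (- N + int (d ?P ?y))) ?Q = d ?P ?Q"
        "d ?P ?y = d ?P (f (- N + int (d ?P ?y)))"
        using e(4) by linarith+
    qed (use V fV 4 in simp_all)
    then show ?thesis by blast
  qed
  then obtain s where s: "act h (f i) = f (s i)" for i by metis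
  have abs: "\<bar>s i - s j\<bar> = \<bar>i - j\<bar>" for i j
    using fd [of "s i" "s j"] fd [of i j] act_isom [OF h(1) fV fV, of i j] s by simp
  have per: "s (i + m) = s i + m" for i
    using hf [of i] s shiftsD [OF b(2)] line_inj [OF f] by simp
  have "s i = i + s 0" for i
    using abs [of i 0] abs [of "i + m" 0] per [of i] b(3) by linarith
  then have "shifts h f (s 0)" unfolding shifts_def using s by metis
  then show ?thesis by (rule that)
qed

text \<open>Translation lengths are invariant under conjugation.  The displacements of \<open>f 0\<close> under \<open>(g k g\<^sup>-\<^sup>1)\<^sup>N\<close>
  and under \<open>k\<^sup>N\<close> are \<open>N \<bar>n\<bar>\<close> and \<open>N \<bar>m\<bar>\<close>, and they differ at most by \<open>2 D\<close>, where \<open>D\<close> does not depend on \<open>N\<close>.\<close>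

lemma conjugate_shift:
  assumes f: "line f" and k: "k \<in> G" "shifts k f m" and g: "g \<in> G"
    and k': "shifts (g * k * inverse g) f n"
  shows "\<bar>m\<bar> = \<bar>n\<bar>"
proof -
  note fV = lineD(1)[OF f] and fd = lineD(2)[OF f]
  define y D N where "y = act (inverse g) (f 0)" and "D = d (f 0) y" and "N = 2 * D + 1"
  have y: "y \<in> V" using g fV by (simp add: y_def)
  have "shifts (g * k ^ N * inverse g) f (int N * n)"
    using shifts_power [OF f _ k', of N] g k by (simp add: conj_power)
  then have "act (g * k ^ N * inverse g) (f 0) = f (int N * n)" by (simp add: shifts_def)
  then have 1: "act g (act (k ^ N) y) = f (int N * n)" using g k fV by (simp add: act_mult y_def)
  have "d (f 0) (f (int N * n)) = d (act g y) (act g (act (k ^ N) y))"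
    using 1 g fV by (simp add: y_def)
  also have "\<dots> = d y (act (k ^ N) y)" using g k y by simp
  finally have 2: "int (d y (act (k ^ N) y)) = int N * \<bar>n\<bar>" using fd [of 0 "int N * n"] by (simp add: abs_mult)
  have "act (k ^ N) (f 0) = f (int N * m)" using shifts_power [OF f k, of N] by (simp add: shifts_def)
  then have 3: "int (d (f 0) (act (k ^ N) (f 0))) = int N * \<bar>m\<bar>" using fd [of 0 "int N * m"] by (simp add: abs_mult)
  have 4: "d (act (k ^ N) (f 0)) (act (k ^ N) y) = D" using k fV y by (simp add: D_def)
  have V: "act (k ^ N) (f 0) \<in> V" "act (k ^ N) y \<in> V" using k fV y by simp_all
  have 5: "d (f 0) (act (k ^ N) (f 0)) \<le> 2 * D + d y (act (k ^ N) y)"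
    "d y (act (k ^ N) y) \<le> 2 * D + d (f 0) (act (k ^ N) (f 0))"
    using triangle [of "f 0" "act (k ^ N) (f 0)" y] triangle [of y "act (k ^ N) (f 0)" "act (k ^ N) y"]
      triangle [of y "act (k ^ N) y" "f 0"] triangle [of "f 0" "act (k ^ N) y" "act (k ^ N) (f 0)"]
      4 V fV [of 0] y dist_sym [of y "f 0"] dist_sym [of "act (k ^ N) y" "act (k ^ N) (f 0)"]
    by (simp_all add: D_def)
  then have "int N * \<bar>m\<bar> < int N + int N * \<bar>n\<bar>" "int N * \<bar>n\<bar> < int N + int N * \<bar>m\<bar>"
    using 2 3 N_def by linarith+
  then have "int N * \<bar>m\<bar> < int N * (1 + \<bar>n\<bar>)" "int N * \<bar>n\<bar> < int N * (1 + \<bar>m\<bar>)"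
    by (simp_all add: distrib_left)
  then show ?thesis by (simp add: mult_less_cancel_left N_def)
qed

end


section \<open>Residually torsion-free nilpotent groups\<close>

text \<open>A descending central filtration with torsion-free quotients and trivial intersection.\<close>

definition res_tfn :: "'g::grp set \<Rightarrow> bool"
  where "res_tfn S \<longleftrightarrow> (\<exists>\<Gamma> :: nat \<Rightarrow> 'g set.
    \<Gamma> 0 = S \<and> (\<forall>n. subgrp (\<Gamma> n)) \<and> (\<forall>n. \<Gamma> (Suc n) \<subseteq> \<Gamma> n) \<and> (\<Inter>n. \<Gamma> n) = {1} \<and>
    (\<forall>n. \<forall>s\<in>S. \<forall>g\<in>\<Gamma> n. s * g * inverse s * inverse g \<in> \<Gamma> (Suc n)) \<and>
    (\<forall>n. \<forall>g\<in>\<Gamma> n. \<forall>k>0. g ^ k \<in> \<Gamma> (Suc n) \<longrightarrow> g \<in> \<Gamma> (Suc n)))"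

lemma res_tfnE:
  assumes "res_tfn S"
  obtains \<Gamma> :: "nat \<Rightarrow> 'g::grp set" where "\<Gamma> 0 = S" "\<And>n. subgrp (\<Gamma> n)" "\<And>n. \<Gamma> (Suc n) \<subseteq> \<Gamma> n"
    "\<And>n. \<Gamma> n \<subseteq> S" "\<And>g. (\<And>n. g \<in> \<Gamma> n) \<Longrightarrow> g = 1"
    "\<And>n s g. s \<in> S \<Longrightarrow> g \<in> \<Gamma> n \<Longrightarrow> s * g * inverse s * inverse g \<in> \<Gamma> (Suc n)"
    "\<And>n s g. s \<in> S \<Longrightarrow> g \<in> \<Gamma> n \<Longrightarrow> s * g * inverse s \<in> \<Gamma> n"
    "\<And>n g k. g \<in> \<Gamma> n \<Longrightarrow> k > 0 \<Longrightarrow> g ^ k \<in> \<Gamma> (Suc n) \<Longrightarrow> g \<in> \<Gamma> (Suc n)"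
proof -
  obtain \<Gamma> where \<Gamma>: "\<Gamma> 0 = S" "\<And>n. subgrp (\<Gamma> n)" "\<And>n. \<Gamma> (Suc n) \<subseteq> \<Gamma> n" "(\<Inter>n. \<Gamma> n) = {1}"
    "\<And>n s g. s \<in> S \<Longrightarrow> g \<in> \<Gamma> n \<Longrightarrow> s * g * inverse s * inverse g \<in> \<Gamma> (Suc n)"
    "\<And>n g k. g \<in> \<Gamma> n \<Longrightarrow> k > 0 \<Longrightarrow> g ^ k \<in> \<Gamma> (Suc n) \<Longrightarrow> g \<in> \<Gamma> (Suc n)"
    using assms unfolding res_tfn_def by metis
  have "\<Gamma> n \<subseteq> S" for n by (induction n) (use \<Gamma> in auto)
  moreover have "s * g * inverse s \<in> \<Gamma> n" if "s \<in> S" "g \<in> \<Gamma> n" for n s g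
  proof -
    have "s * g * inverse s * inverse g * g \<in> \<Gamma> n"
      using \<Gamma>(5) [OF that] \<Gamma>(3) that(2) subgrpD(2) [OF \<Gamma>(2)] by blast
    then show ?thesis by (simp add: mult.assoc)
  qed
  moreover have "g = 1" if "\<And>n. g \<in> \<Gamma> n" for g using \<Gamma>(4) that by blast
  ultimately show ?thesis using that [of \<Gamma>] \<Gamma> by simp
qed

lemma res_tfn_inj:
  fixes \<theta> :: "'g::grp \<Rightarrow> 'h::grp"
  assumes S: "subgrp S" and \<theta>: "hom_on S \<theta>" and inj: "\<And>g. g \<in> S \<Longrightarrow> \<theta> g = 1 \<Longrightarrow> g = 1"
    and T: "res_tfn T" and im: "\<theta> ` S \<subseteq> T"
  shows "res_tfn S"
proof -
  obtain \<Gamma> :: "nat \<Rightarrow> 'h set" where \<Gamma>: "\<Gamma> 0 = T" "\<And>n. subgrp (\<Gamma> n)" "\<And>n. \<Gamma> (Suc n) \<subseteq> \<Gamma> n"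
    "\<And>g. (\<And>n. g \<in> \<Gamma> n) \<Longrightarrow> g = 1"
    "\<And>n s g. s \<in> T \<Longrightarrow> g \<in> \<Gamma> n \<Longrightarrow> s * g * inverse s * inverse g \<in> \<Gamma> (Suc n)"
    "\<And>n g k. g \<in> \<Gamma> n \<Longrightarrow> k > 0 \<Longrightarrow> g ^ k \<in> \<Gamma> (Suc n) \<Longrightarrow> g \<in> \<Gamma> (Suc n)"
    by (rule res_tfnE [OF T]) blast
  note h = hom_onD [OF \<theta> S] and s = subgrpD [OF S]
  define \<Delta> where "\<Delta> n = {g \<in> S. \<theta> g \<in> \<Gamma> n}" for n
  have "\<Delta> 0 = S" using im by (auto simp: \<Delta>_def \<Gamma>(1))
  moreover have "subgrp (\<Delta> n)" for n
    by (rule subgrpI) (auto simp: \<Delta>_def h s subgrpD [OF \<Gamma>(2)])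
  moreover have "\<Delta> (Suc n) \<subseteq> \<Delta> n" for n using \<Gamma>(3) by (auto simp: \<Delta>_def)
  moreover have "(\<Inter>n. \<Delta> n) = {1}"
  proof -
    have "g = 1" if "\<forall>n. g \<in> \<Delta> n" for g
      using that \<Gamma>(4) [of "\<theta> g"] inj [of g] by (auto simp: \<Delta>_def)
    moreover have "1 \<in> \<Delta> n" for n by (simp add: \<Delta>_def h s subgrpD [OF \<Gamma>(2)])
    ultimately show ?thesis by auto
  qed
  moreover have "s' * g * inverse s' * inverse g \<in> \<Delta> (Suc n)" if "s' \<in> S" "g \<in> \<Delta> n" for s' g n
    using that \<Gamma>(5) [of "\<theta> s'" "\<theta> g"] im by (auto simp: \<Delta>_def h s)
  moreover have "g \<in> \<Delta> (Suc n)" if "g \<in> \<Delta> n" "k > 0" "g ^ k \<in> \<Delta> (Suc n)" for n g k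
    using that \<Gamma>(6) [of "\<theta> g" n k] by (auto simp: \<Delta>_def h s)
  ultimately show ?thesis
    unfolding res_tfn_def by (intro exI [of _ \<Delta>] conjI allI ballI impI) simp_all
qed

lemma commutator_eq_one: "a * b * inverse a * inverse b = 1 \<longleftrightarrow> a * b = b * a" for a b :: "'g::grp"
proof
  assume "a * b * inverse a * inverse b = 1"
  then have "a * b * inverse a * inverse b * (b * a) = b * a" by simp
  then show "a * b = b * a" by (simp add: mult.assoc)
next
  assume "a * b = b * a"
  then have "a * b * inverse a * inverse b = b * a * inverse a * inverse b" by (simp only:)
  then show "a * b * inverse a * inverse b = 1" by (simp add: mult.assoc)
qed

lemma commutator_power:
  fixes x u c :: "'g::grp"
  assumes "x * u = c * u * x" "c * x = x * c"
  shows "x ^ n * u = c ^ n * u * x ^ n"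
proof (induction n)
  case (Suc n)
  have "x ^ Suc n * u = x * c ^ n * u * x ^ n" using Suc by (simp add: mult.assoc)
  also have "x * c ^ n = c ^ n * x" by (rule commute_power [OF assms(2), symmetric])
  also have "c ^ n * x * u * x ^ n = c ^ n * (x * u) * x ^ n" by (simp only: mult.assoc)
  also have "\<dots> = c ^ n * (c * u * x) * x ^ n" by (simp only: assms(1))
  also have "\<dots> = c ^ Suc n * u * x ^ Suc n"
    unfolding power_Suc2 [of c n] power_Suc [of x n] by (simp only: mult.assoc)
  finally show ?case .
qed simp

text \<open>Any relation between \<open>x\<close> and \<open>u\<close> that has exponent sum zero in \<open>u\<close> and nonzero in \<open>x\<close> makes a
  power of \<open>x\<close> trivial in the quotients where \<open>x\<close> and \<open>u\<close> commute, which is the form in which the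
  relation is assumed.  If the commutator of \<open>x\<close> and \<open>u\<close> has
  depth \<open>n\<close> in the central filtration, then it is central one step deeper, so there the power of \<open>x\<close> is
  central, the power of the commutator is trivial, and the commutator is in fact one step deeper.\<close>

lemma commute_if_exponent_sum:
  fixes x u :: "'g::grp"
  assumes S: "subgrp S" and tfn: "res_tfn S" and x: "x \<in> S" and u: "u \<in> S" and k: "k > 0"
    and rel: "\<And>\<theta> :: 'g \<Rightarrow> 'g set sym. hom_on S \<theta> \<Longrightarrow> \<theta> x * \<theta> u = \<theta> u * \<theta> x \<Longrightarrow> \<theta> x ^ k = 1"
  shows "x * u = u * x"
proof -
  obtain \<Gamma> :: "nat \<Rightarrow> 'g set" where \<Gamma>: "\<Gamma> 0 = S" "\<And>n. subgrp (\<Gamma> n)" "\<And>n. \<Gamma> (Suc n) \<subseteq> \<Gamma> n"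
    "\<And>n. \<Gamma> n \<subseteq> S" "\<And>g. (\<And>n. g \<in> \<Gamma> n) \<Longrightarrow> g = 1"
    "\<And>n s g. s \<in> S \<Longrightarrow> g \<in> \<Gamma> n \<Longrightarrow> s * g * inverse s * inverse g \<in> \<Gamma> (Suc n)"
    "\<And>n s g. s \<in> S \<Longrightarrow> g \<in> \<Gamma> n \<Longrightarrow> s * g * inverse s \<in> \<Gamma> n"
    "\<And>n g k. g \<in> \<Gamma> n \<Longrightarrow> k > 0 \<Longrightarrow> g ^ k \<in> \<Gamma> (Suc n) \<Longrightarrow> g \<in> \<Gamma> (Suc n)"
    by (rule res_tfnE [OF tfn]) blast
  define \<kappa> where "\<kappa> = x * u * inverse x * inverse u"
  have \<kappa>S: "\<kappa> \<in> S" unfolding \<kappa>_def by (intro subgrpD [OF S] x u)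
  have "\<kappa> \<in> \<Gamma> n" for n
  proof (induction n)
    case 0 show ?case using \<kappa>S \<Gamma>(1) by simp
  next
    case (Suc n)
    obtain \<theta> :: "'g \<Rightarrow> 'g set sym" where \<theta>: "hom_on S \<theta>" "\<And>g. g \<in> S \<Longrightarrow> \<theta> g = 1 \<longleftrightarrow> g \<in> \<Gamma> (Suc n)"
      by (rule quotient_hom [OF S \<Gamma>(2) \<Gamma>(4) \<Gamma>(7), of "Suc n"]) (assumption | rule that)+
    note h = hom_onD [OF \<theta>(1) S] subgrpD [OF S]
    \<comment> \<open>the preimage of the center of \<open>S / \<Gamma> (Suc n)\<close>\<close>
    define D where "D = {g \<in> S. \<forall>s\<in>S. \<theta> g * \<theta> s = \<theta> s * \<theta> g}"
    have DS: "D \<subseteq> S" by (auto simp: D_def)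
    have D: "subgrp D"
    proof (rule subgrpI)
      show "1 \<in> D" by (simp add: D_def h)
      fix a b assume a: "a \<in> D"
      show "inverse a \<in> D" using a by (auto simp: D_def h intro: commute_inverse [symmetric])
      assume b: "b \<in> D"
      show "a * b \<in> D"
        unfolding D_def
      proof (intro CollectI conjI ballI)
        have aS: "a \<in> S" and bS: "b \<in> S" using a b DS by blast+
        fix s assume s: "s \<in> S"
        have "\<theta> a * \<theta> b * \<theta> s = \<theta> a * (\<theta> s * \<theta> b)" using b s by (simp add: D_def mult.assoc)
        also have "\<dots> = \<theta> s * \<theta> a * \<theta> b" using a s by (simp add: D_def flip: mult.assoc)
        finally show "\<theta> (a * b) * \<theta> s = \<theta> s * \<theta> (a * b)"
          using aS bS s by (simp add: h mult.assoc)
      qed (use a b in \<open>simp add: D_def h\<close>)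
    qed
    have nD: "g * a * inverse g \<in> D" if g: "g \<in> S" and a: "a \<in> D" for g a
    proof -
      have aS: "a \<in> S" and "\<theta> g * \<theta> a = \<theta> a * \<theta> g" using g a by (simp_all add: D_def)
      then have "\<theta> (g * a * inverse g) = \<theta> a * \<theta> g * inverse (\<theta> g)" using g by (simp add: h)
      then have "\<theta> (g * a * inverse g) = \<theta> a" by (simp add: mult.assoc)
      then show ?thesis using a g by (auto simp: D_def h)
    qed
    obtain \<psi> :: "'g \<Rightarrow> 'g set sym" where \<psi>: "hom_on S \<psi>" "\<And>g. g \<in> S \<Longrightarrow> \<psi> g = 1 \<longleftrightarrow> g \<in> D"
      by (rule quotient_hom [OF S D DS nD]) (assumption | rule that)+
    note p = hom_onD [OF \<psi>(1) S]
    have "\<kappa> \<in> D"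
      unfolding D_def
    proof (intro CollectI conjI ballI)
      fix s assume s: "s \<in> S"
      have "\<theta> (s * \<kappa> * inverse s * inverse \<kappa>) = 1"
        using \<theta>(2) \<Gamma>(6) [OF s Suc] \<Gamma>(4) by blast
      then have "\<theta> s * \<theta> \<kappa> * inverse (\<theta> s) * inverse (\<theta> \<kappa>) = 1" using s \<kappa>S by (simp add: h)
      then show "\<theta> \<kappa> * \<theta> s = \<theta> s * \<theta> \<kappa>" by (simp add: commutator_eq_one)
    qed (rule \<kappa>S)
    then have "\<psi> \<kappa> = 1" using \<psi>(2) \<kappa>S by simp
    then have "\<psi> x * \<psi> u * inverse (\<psi> x) * inverse (\<psi> u) = 1" using x u by (simp add: \<kappa>_def p h)
    then have "\<psi> x * \<psi> u = \<psi> u * \<psi> x" by (simp add: commutator_eq_one)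
    then have "\<psi> (x ^ k) = 1" using rel [OF \<psi>(1)] x by (simp add: p)
    then have "x ^ k \<in> D" using \<psi>(2) x by (simp add: h)
    then have *: "\<theta> x ^ k * \<theta> u = \<theta> u * \<theta> x ^ k" using u x by (auto simp: D_def h)
    have "\<theta> x ^ k * \<theta> u = \<theta> \<kappa> ^ k * \<theta> u * \<theta> x ^ k"
    proof (rule commutator_power)
      show "\<theta> x * \<theta> u = \<theta> \<kappa> * \<theta> u * \<theta> x" using x u by (simp add: \<kappa>_def h mult.assoc)
      show "\<theta> \<kappa> * \<theta> x = \<theta> x * \<theta> \<kappa>" using \<open>\<kappa> \<in> D\<close> x by (simp add: D_def)
    qed
    with * have "\<theta> \<kappa> ^ k * (\<theta> u * \<theta> x ^ k) = 1 * (\<theta> u * \<theta> x ^ k)" by (simp add: mult.assoc)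
    then have "\<theta> \<kappa> ^ k = 1" by (simp only: mult_right_cancel)
    then have "\<theta> (\<kappa> ^ k) = 1" using \<kappa>S by (simp add: h)
    then have "\<kappa> ^ k \<in> \<Gamma> (Suc n)" using \<theta>(2) [of "\<kappa> ^ k"] subgrpD(4) [OF S \<kappa>S, of k] by simp
    then show ?case using \<Gamma>(8) [OF Suc k] by blast
  qed
  then have "\<kappa> = 1" by (rule \<Gamma>(5))
  then show ?thesis by (simp add: \<kappa>_def commutator_eq_one)
qed


section \<open>Identities in groups with the Artin relations\<close>

text \<open>The subgroup \<open>\<langle>b, c\<rangle>\<close> is a quotient of the braid group on three strands, whose center is generated by
  the full twist \<open>(b c)\<^sup>3\<close>.\<close>

lemma braid_center:
  fixes b c :: "'g::grp"
  assumes "b * c * b = c * b * c"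
  shows "(b * c) ^ 3 = (b * c * b) ^ 2" "(c * b) ^ 3 = (b * c) ^ 3"
    "(b * c) ^ 3 * b = b * (b * c) ^ 3" "(b * c) ^ 3 * c = c * (b * c) ^ 3"
proof -
  have n: "x ^ 3 = x * x * x" "x ^ 2 = x * x" for x :: 'g
    by (simp_all add: eval_nat_numeral mult.assoc)
  define e where "e = b * c * b"
  have e: "e = b * c * b" "e = c * b * c" using assms by (simp_all add: e_def)
  have "(b * c) ^ 3 = b * c * b * (c * b * c)" "(c * b) ^ 3 = c * b * c * (b * c * b)"
    by (simp_all add: n mult.assoc)
  then have ee: "(b * c) ^ 3 = e * e" "(c * b) ^ 3 = e * e" by (simp_all flip: e)
  then show "(b * c) ^ 3 = (b * c * b) ^ 2" "(c * b) ^ 3 = (b * c) ^ 3" by (simp_all add: n flip: e(1))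
  have eb: "e * b = c * e" and ec: "e * c = b * e"
    using e by (metis mult.assoc)+
  then have "e * e * b = b * (e * e)" "e * e * c = c * (e * e)" by (metis mult.assoc)+
  then show "(b * c) ^ 3 * b = b * (b * c) ^ 3" "(b * c) ^ 3 * c = c * (b * c) ^ 3"
    unfolding ee .
qed

lemma alternating_power: "a * (c * a) ^ k = (a * c) ^ k * a" for a c :: "'g::grp"
  by (induction k) (simp_all add: mult.assoc)

text \<open>The analogue for the odd dihedral Artin group: the square of the Garside element \<open>e\<close> is a power of \<open>a c\<close>,
  and it is central because conjugation by \<open>e\<close> exchanges \<open>a\<close> and \<open>c\<close>.\<close>

lemma odd_artin_center:
  fixes a c :: "'g::grp"
  assumes "(c * a) ^ k * c = (a * c) ^ k * a"
  defines "e \<equiv> (a * c) ^ k * a"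
  shows "e * e = (a * c) ^ (2 * k + 1)" "e * a = c * e" "e * c = a * e"
    "a * (a * c) ^ (2 * k + 1) = (a * c) ^ (2 * k + 1) * a"
    "c * (a * c) ^ (2 * k + 1) = (a * c) ^ (2 * k + 1) * c"
proof -
  have e: "e = (c * a) ^ k * c" using assms by simp
  have "e * e = (a * c) ^ k * a * ((c * a) ^ k * c)" using e e_def by metis
  also have "\<dots> = (a * c) ^ k * (a * (c * a) ^ k) * c" by (simp only: mult.assoc)
  also have "\<dots> = (a * c) ^ k * (a * c) ^ k * (a * c)" by (simp only: alternating_power mult.assoc)
  also have "\<dots> = (a * c) ^ (k + k + 1)" by (simp only: power_add power_one_right)
  finally show 1: "e * e = (a * c) ^ (2 * k + 1)" by (simp only: mult_2)
  have "e * a = (c * a) ^ k * (c * a)" unfolding e by (simp only: mult.assoc)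
  also have "\<dots> = c * (a * (c * a) ^ k)" unfolding power_commutes by (simp only: mult.assoc)
  finally show 2: "e * a = c * e" by (simp only: e_def alternating_power)
  have "e * c = (a * c) ^ k * (a * c)" unfolding e_def by (simp only: mult.assoc)
  also have "\<dots> = a * (c * (a * c) ^ k)" unfolding power_commutes by (simp only: mult.assoc)
  finally show 3: "e * c = a * e" by (simp only: e alternating_power)
  show "a * (a * c) ^ (2 * k + 1) = (a * c) ^ (2 * k + 1) * a"
    "c * (a * c) ^ (2 * k + 1) = (a * c) ^ (2 * k + 1) * c"
    unfolding 1 [symmetric] using 2 3 by (metis mult.assoc)+
qed

lemma braid_commute_eq:
  fixes b c :: "'g::grp"
  assumes "b * c * b = c * b * c" "b * c = c * b"
  shows "b = c"
proof -
  have "b * c * b = b * c * c" using assms by simp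
  then show ?thesis by (simp only: mult_left_cancel)
qed

text \<open>Let \<open>x = a b\<^sup>-\<^sup>1\<close>, which is central in the group generated by \<open>a\<close>, \<open>b\<close>, \<open>c\<close>.  Substituting \<open>a = x b\<close> in
  the third relation and dividing by the central full twists gives \<open>x = 1\<close> or \<open>c = x b\<close>, depending on
  \<open>k\<close> modulo \<open>3\<close>.  In the second case \<open>b\<close> commutes with \<open>c\<close>, so that all generators coincide.\<close>

lemma artin_central_discrepancy:
  fixes a b c :: "'g::grp"
  assumes ab: "a * b = b * a" and bc: "b * c * b = c * b * c"
    and ca: "(c * a) ^ k * c = (a * c) ^ k * a" and central: "a * inverse b * c = c * (a * inverse b)"
  shows "a = b"
proof -
  define x where "x = a * inverse b"
  have a: "a = x * b" by (simp add: x_def mult.assoc)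
  have "b * x = b * a * inverse b" by (simp add: x_def mult.assoc)
  also have "\<dots> = x * b" unfolding ab [symmetric] by (simp add: x_def mult.assoc)
  finally have xb: "x * b = b * x" ..
  have xc: "x * c = c * x" using central by (simp add: x_def)
  have "c * a = x * (c * b)" "a * c = x * (b * c)"
    by (simp_all add: a mult.assoc commute_assoc [OF xc [symmetric]])
  then have "(c * a) ^ k = x ^ k * (c * b) ^ k" "(a * c) ^ k = x ^ k * (b * c) ^ k"
    using power_mult_commute [OF commute_mult [OF xc xb]] power_mult_commute [OF commute_mult [OF xb xc]]
    by simp_all
  with ca have "x ^ k * ((c * b) ^ k * c) = x ^ k * ((b * c) ^ k * (x * b))" by (simp add: a mult.assoc)
  then have 1: "(c * b) ^ k * c = (b * c) ^ k * (x * b)" by (simp only: mult_left_cancel)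
  define z where "z = (b * c) ^ 3"
  have k: "k = 3 * (k div 3) + k mod 3" by simp
  have "(c * b) ^ k = z ^ (k div 3) * (c * b) ^ (k mod 3)" "(b * c) ^ k = z ^ (k div 3) * (b * c) ^ (k mod 3)"
    using k braid_center(2) [OF bc] by (metis power_add power_mult z_def)+
  with 1 have 2: "(c * b) ^ (k mod 3) * c = (b * c) ^ (k mod 3) * (x * b)" by (simp add: mult.assoc)
  have eq: "a = b" if "b * c = c * b"
  proof -
    have "b = c" by (rule braid_commute_eq [OF bc that])
    then have "a * c = c * a" using ab by simp
    then have "(c * a) ^ k * c = (c * a) ^ k * a" using ca by simp
    then show ?thesis using \<open>b = c\<close> by simp
  qed
  have "k mod 3 = 0 \<or> k mod 3 = 1 \<or> k mod 3 = 2" by linarith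
  then show ?thesis
  proof (elim disjE)
    assume "k mod 3 = 0"
    with 2 have "c = x * b" by simp
    then show ?thesis using eq xb by (metis mult.assoc)
  next
    assume "k mod 3 = 1"
    with 2 have "c * b * c = b * c * (b * x)" using xb by simp
    with bc have "b * c * b * 1 = b * c * b * x" by (simp add: mult.assoc)
    then have "x = 1" by (simp only: mult_left_cancel)
    then show ?thesis by (simp add: a)
  next
    assume "k mod 3 = 2"
    with 2 have "c * b * (c * b) * c = b * c * (b * c) * (b * x)" using xb by (simp add: power2_eq_square)
    then have "c * b * (c * b) * c * b = b * c * (b * c) * (b * x) * b" by simp
    moreover have "c * b * (c * b) * c * b = b * c * (b * c) * b * c"
      using braid_center(2) [OF bc] by (simp add: eval_nat_numeral mult.assoc)
    ultimately have "b * c * (b * c) * b * c = b * c * (b * c) * b * (x * b)" by (simp add: mult.assoc)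
    then have "c = x * b" by (simp only: mult_left_cancel)
    then show ?thesis using eq xb by (metis mult.assoc)
  qed
qed


text \<open>Conjugation, written as a function so that identities can be computed with iterates.\<close>

definition cj :: "'g::grp \<Rightarrow> 'g \<Rightarrow> 'g"
  where "cj g h = g * h * inverse g"

lemma cj_simps:
  "cj g (h * h') = cj g h * cj g h'" "cj g (h ^ n) = cj g h ^ n" "cj (g * g') h = cj g (cj g' h)"
  by (simp add: cj_def mult.assoc, simp add: cj_def conj_power, simp add: cj_def mult.assoc)

text \<open>A relation between \<open>x = a b\<^sup>-\<^sup>1\<close> and \<open>u = b c\<close> in the Artin group for \<open>M = 6 j + 3\<close>.  With \<open>\<delta> = b c b\<close>, the
  defining relations amount to the three hypotheses.  By the second, the last one contains \<open>\<delta>\<close> only through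
  \<open>\<alpha> = \<delta> (u\<^sup>2 (x u)\<^sup>3 u\<^sup>-\<^sup>2) \<delta>\<^sup>-\<^sup>1\<close>, and says that \<open>\<alpha>\<^sup>j = \<rho>\<close>.  Conjugating it by \<open>\<delta>\<close>, where \<open>\<delta>\<^sup>2 = u\<^sup>3\<close>,
  expresses \<open>\<alpha>\<close> itself through \<open>x\<close> and \<open>u\<close>, so that \<open>\<delta>\<close> can be eliminated.\<close>

lemma two_generator_relation:
  fixes x u \<delta> :: "'g::grp"
  assumes z: "u ^ 3 = \<delta> * \<delta>" and x1: "cj \<delta> x = cj u x"
    and rel: "cj \<delta> ((x * u) ^ (3 * j + 2) * inverse (u * u)) = u * u * (x * u) ^ (3 * j + 1) * inverse (u ^ 3)"
  defines "U \<equiv> cj u" and "Z \<equiv> cj (u ^ 3)"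
  defines "W \<equiv> U (U ((x * u) ^ 3)) ^ j"
  defines "\<rho> \<equiv> inverse (U x * Z x) * W * U (U x)"
  shows "(Z x * Z (U x) * Z W * Z (U x) * Z (Z x) * u ^ 3 * inverse \<rho>) ^ j = \<rho>"
proof -
  define D where "D = cj \<delta>"
  define v where "v = x * u"
  have mlt: "U (g * h) = U g * U h" "D (g * h) = D g * D h" "Z (g * h) = Z g * Z h"
    "U (g ^ n) = U g ^ n" "D (g ^ n) = D g ^ n" "Z (g ^ n) = Z g ^ n" for g h n
    by (simp_all add: U_def D_def Z_def cj_simps)
  have Z: "Z g = U (U (U g))" "D (D g) = Z g" for g
    unfolding U_def D_def Z_def by (simp_all add: z flip: cj_simps(3)) (simp add: eval_nat_numeral flip: z)
  have DZ: "D (Z g) = Z (D g)" for g by (simp flip: Z(2))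
  have Dx: "D x = U x" by (simp add: D_def U_def x1)
  have DUx: "D (U x) = Z x" by (simp add: Z(2) flip: Dx)
  define \<alpha> where "\<alpha> = D (U (U (v ^ 3)))"
  have vv: "v * v * inverse (u * u) = x * U x" by (simp add: v_def U_def cj_def mult.assoc)
  have UUc: "U (U g) * (u * u) = u * u * g" for g by (simp add: U_def cj_def mult.assoc)
  have W: "W * (u * u) = u * u * v ^ (3 * j)"
    using UUc [of "v ^ (3 * j)"] by (simp add: W_def v_def mlt power_mult)
  have "v ^ (3 * j + 2) * inverse (u * u) = v * v * v ^ (3 * j) * inverse (u * u)"
    by (simp add: power_add mult.assoc)
  also have "\<dots> = v * v * inverse (u * u) * (W * (u * u)) * inverse (u * u)"
    unfolding W by (simp add: mult.assoc)
  also have "\<dots> = x * U x * W" unfolding vv by (simp add: mult.assoc)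
  finally have L: "v ^ (3 * j + 2) * inverse (u * u) = x * U x * W" .
  have "u * u * v ^ (3 * j + 1) * inverse (u ^ 3) = u * u * v ^ (3 * j) * v * inverse (u ^ 3)"
    by (simp add: mult.assoc flip: power_Suc2)
  also have "\<dots> = W * (u * u) * v * inverse (u ^ 3)" unfolding W ..
  also have "\<dots> = W * U (U x)" by (simp add: U_def v_def cj_def mult.assoc eval_nat_numeral)
  finally have R: "u * u * v ^ (3 * j + 1) * inverse (u ^ 3) = W * U (U x)" .
  have DW: "D W = \<alpha> ^ j" by (simp add: W_def \<alpha>_def mlt v_def)
  have "D (x * U x * W) = W * U (U x)"
    using rel L R by (simp add: D_def v_def)
  then have 1: "U x * Z x * \<alpha> ^ j = W * U (U x)" by (simp add: mlt Dx DUx DW)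
  then have \<rho>: "\<alpha> ^ j = \<rho>" by (simp add: \<rho>_def mult.assoc flip: 1)
  define t where "t = D (U (U x))"
  have "D (U x * Z x * \<alpha> ^ j) = D (W * U (U x))" by (simp only: 1)
  then have 2: "Z x * Z (U x) * Z W = \<alpha> ^ j * t"
    by (simp add: mlt DUx DZ Dx DW t_def) (simp add: Z(2) \<alpha>_def W_def v_def mlt)
  have v3: "U (U (v ^ 3)) = U (U x) * Z x * Z (U x) * u ^ 3"
    by (simp add: v_def U_def Z_def cj_def mult.assoc eval_nat_numeral)
  have "D (u ^ 3) = u ^ 3" by (simp add: D_def cj_def z mult.assoc)
  then have \<alpha>: "\<alpha> = t * Z (U x) * Z (Z x) * u ^ 3"
    unfolding \<alpha>_def v3 t_def by (simp only: mlt(2) DZ Dx DUx)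
  have "\<alpha> * \<alpha> ^ j = \<alpha> ^ j * t * Z (U x) * Z (Z x) * u ^ 3"
    unfolding power_commutes [symmetric] by (subst (2) \<alpha>) (simp only: mult.assoc)
  then have "\<alpha> * \<rho> * inverse \<rho> = Z x * Z (U x) * Z W * Z (U x) * Z (Z x) * u ^ 3 * inverse \<rho>"
    by (simp only: 2 \<rho>)
  then have "\<alpha> = Z x * Z (U x) * Z W * Z (U x) * Z (Z x) * u ^ 3 * inverse \<rho>"
    by (simp add: mult.assoc)
  with \<rho> show ?thesis by simp
qed

text \<open>If \<open>x\<close> and \<open>u\<close> commute, then the two sides of the relation are \<open>(x\<^sup>5 u\<^sup>3)\<^sup>j\<close> and \<open>x\<^sup>-\<^sup>1 (x\<^sup>3 u\<^sup>3)\<^sup>j\<close>.\<close>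

lemma two_generator_exponent_sum:
  fixes x u :: "'g::grp" and j :: nat
  assumes comm: "x * u = u * x"
  defines "U \<equiv> cj u" and "Z \<equiv> cj (u ^ 3)"
  defines "W \<equiv> U (U ((x * u) ^ 3)) ^ j"
  defines "\<rho> \<equiv> inverse (U x * Z x) * W * U (U x)"
  assumes "(Z x * Z (U x) * Z W * Z (U x) * Z (Z x) * u ^ 3 * inverse \<rho>) ^ j = \<rho>"
  shows "x ^ (2 * j + 1) = 1"
proof -
  have cjg: "cj g h = h" if "g * h = h * g" for g h :: 'g
    using that by (simp add: cj_def mult.assoc)
  define z where "z = u ^ 3"
  have xz: "z * x = x * z" unfolding z_def by (rule commute_power [OF comm [symmetric]])
  have ux3: "(x * u) ^ 3 = x ^ 3 * z" unfolding z_def by (rule power_mult_commute [OF comm])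
  define w where "w = (x ^ 3 * z) ^ j"
  have c1: "u * (x ^ 3 * z) = x ^ 3 * z * u"
    using comm by (intro commute_mult) (simp_all add: z_def commute_power power_commutes)
  have c2: "z * (x ^ 3 * z) = x ^ 3 * z * z"
    using xz by (intro commute_mult) (simp_all add: commute_power)
  have c3: "x * (x ^ 3 * z) = x ^ 3 * z * x"
    using xz by (intro commute_mult) (simp_all add: power_commutes)
  have U: "U x = x" "Z x = x" "U (x ^ 3 * z) = x ^ 3 * z"
    using comm xz c1 by (simp_all add: U_def Z_def cjg flip: z_def)
  then have W: "W = w" by (simp add: W_def w_def ux3)
  have wz: "w * z = z * w" and wx: "w * x = x * w"
    unfolding w_def using commute_power [OF c2 [symmetric]] commute_power [OF c3 [symmetric]] by simp_all
  have ZW: "Z W = w" using wz by (simp add: Z_def W cjg flip: z_def)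
  have "\<rho> = inverse (x * x) * (w * x)" by (simp add: \<rho>_def U W mult.assoc)
  also have "\<dots> = inverse x * w" by (simp add: wx mult.assoc)
  finally have \<rho>: "\<rho> = inverse x * w" .
  have w: "w = x ^ (3 * j) * z ^ j"
    unfolding w_def power_mult_commute [OF commute_power [OF xz [symmetric]]] power_mult ..
  have r: "w * (x * y) = x * (w * y)" "z * (x * y) = x * (z * y)" "w * (z * y) = z * (w * y)" for y
    by (rule commute_assoc [OF wx] commute_assoc [OF xz] commute_assoc [OF wz])+
  have "Z x * Z (U x) * Z W * Z (U x) * Z (Z x) * u ^ 3 * inverse \<rho> = x * x * w * x * x * z * (inverse w * x)"
    by (simp add: U ZW \<rho> flip: z_def)
  also have "\<dots> = x ^ 5 * z"
  proof -
    have "x * x * w * x * x * z * (inverse w * x) * w = x * x * w * x * x * z * x"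
      by (simp add: mult.assoc flip: wx)
    also have "\<dots> = x * x * x * x * x * z * w" by (simp add: mult.assoc r wx xz wz)
    finally have "x * x * w * x * x * z * (inverse w * x) = x * x * x * x * x * z"
      by (simp only: mult_right_cancel)
    also have "\<dots> = x ^ 5 * z" by (simp add: eval_nat_numeral mult.assoc)
    finally show ?thesis .
  qed
  finally have "(x ^ 5 * z) ^ j = inverse x * w" using assms(6) \<rho> by simp
  then have "x ^ (5 * j) * z ^ j = inverse x * (x ^ (3 * j) * z ^ j)"
    unfolding power_mult_commute [OF commute_power [OF xz [symmetric]]] power_mult [symmetric] w .
  then have "x ^ (5 * j) = inverse x * x ^ (3 * j)" by (simp flip: mult.assoc)
  then have "x * x ^ (2 * j) * x ^ (3 * j) = x ^ (3 * j)" by (simp add: mult.assoc flip: power_add)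
  then have "x * x ^ (2 * j) * x ^ (3 * j) = 1 * x ^ (3 * j)" by simp
  then have "x * x ^ (2 * j) = 1" by (simp only: mult_right_cancel)
  then show ?thesis by simp
qed


section \<open>Actions of odd triangle Artin groups on trees\<close>

context tree_action
begin

text \<open>If the generators translate a common line, then the discrepancy \<open>x = a b\<^sup>-\<^sup>1\<close> lies in the group \<open>K\<close>
  that fixes this line, and \<open>b\<close> commutes with \<open>x\<close> and generates together with \<open>K\<close>.  So as soon as all
  conjugates of \<open>x\<close> have depth \<open>n\<close> in the filtration of a vertex stabilizer, \<open>x\<close> is central one step
  deeper, hence trivial there.\<close>

lemma common_axis:
  assumes tfn: "\<And>x. x \<in> V \<Longrightarrow> res_tfn (stab x)"
    and abc: "a \<in> G" "b \<in> G" "c \<in> G"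
    and ab: "a * b = b * a" and bc: "b * c * b = c * b * c" and ca: "(c * a) ^ k * c = (a * c) ^ k * a"
    and f: "line f" and shifts: "shifts a f m" "shifts b f m" "shifts c f m"
  shows "a = b"
proof -
  note fV = lineD(1) [OF f]
  obtain \<Gamma> :: "nat \<Rightarrow> 'g set" where \<Gamma>: "\<Gamma> 0 = stab (f 0)" "\<And>n. subgrp (\<Gamma> n)"
    "\<And>n. \<Gamma> n \<subseteq> stab (f 0)" "\<And>g. (\<And>n. g \<in> \<Gamma> n) \<Longrightarrow> g = 1"
    "\<And>n s g. s \<in> stab (f 0) \<Longrightarrow> g \<in> \<Gamma> n \<Longrightarrow> s * g * inverse s * inverse g \<in> \<Gamma> (Suc n)"
    by (rule res_tfnE [OF tfn [OF fV [of 0]]]) blast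
  define H where "H = {g \<in> G. \<exists>i. shifts g f i}"
  have H: "subgrp H"
    by (rule subgrpI)
       (auto simp: H_def intro: shifts_one [OF f] shifts_mult [OF f] shifts_inverse [OF f] exI)
  have HG: "g \<in> H \<Longrightarrow> g \<in> G" for g by (simp add: H_def)
  have K: "g * s * inverse g \<in> stab (f 0)" if "g \<in> H" "s \<in> H" "shifts s f 0" for g s
  proof -
    obtain i where i: "shifts g f i" using \<open>g \<in> H\<close> by (auto simp: H_def)
    have "shifts (g * s * inverse g) f (i + 0 + - i)"
      using that i by (intro shifts_mult [OF f] shifts_inverse [OF f]) (simp_all add: HG)
    then show ?thesis using that by (simp add: stab_def shifts_def HG)
  qed
  \<comment> \<open>the largest normal subgroup of \<open>H\<close> inside \<open>\<Gamma> n\<close>\<close>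
  define N where "N n = {s \<in> H. \<forall>g\<in>H. g * s * inverse g \<in> \<Gamma> n}" for n
  have N: "subgrp (N n)" for n
  proof (rule subgrpI)
    show "1 \<in> N n" by (simp add: N_def subgrpD [OF H] subgrpD [OF \<Gamma>(2)])
    fix s assume s: "s \<in> N n"
    have "inverse (g * s * inverse g) \<in> \<Gamma> n" if "g \<in> H" for g
      using s that by (intro subgrpD(3) [OF \<Gamma>(2)]) (simp add: N_def)
    then show "inverse s \<in> N n" using s by (simp add: N_def subgrpD [OF H] mult.assoc)
    fix t assume t: "t \<in> N n"
    have "(g * s * inverse g) * (g * t * inverse g) \<in> \<Gamma> n" if "g \<in> H" for g
      using s t that unfolding N_def by (intro subgrpD(2) [OF \<Gamma>(2), where a = "g * s * inverse g"]) blast+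
    then show "s * t \<in> N n" using s t by (simp add: N_def subgrpD [OF H] mult.assoc)
  qed
  have NH: "N n \<subseteq> H" for n by (auto simp: N_def)
  have normal: "g * s * inverse g \<in> N n" if "g \<in> H" "s \<in> N n" for g s n
  proof -
    have "h * g * s * inverse (h * g) \<in> \<Gamma> n" if "h \<in> H" for h
    proof -
      have "g' \<in> H \<Longrightarrow> g' * s * inverse g' \<in> \<Gamma> n" for g' using \<open>s \<in> N n\<close> by (simp add: N_def)
      then show ?thesis using that \<open>g \<in> H\<close> subgrpD(2) [OF H] by blast
    qed
    then show ?thesis using that by (simp add: N_def subgrpD [OF H] mult.assoc)
  qed
  have inH: "a \<in> H" "b \<in> H" "c \<in> H" using abc shifts by (auto simp: H_def)
  define x s where "x = a * inverse b" and "s = c * inverse b"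
  have xs: "x \<in> H" "s \<in> H" unfolding x_def s_def using inH by (simp_all add: subgrpD [OF H])
  have sh0: "shifts x f 0" "shifts s f 0"
    using shifts_mult [OF f _ _ _ shifts_inverse [OF f], of a b m m]
      shifts_mult [OF f _ _ _ shifts_inverse [OF f], of c b m m] abc shifts by (simp_all add: x_def s_def)
  have "x \<in> N n" for n
  proof (induction n)
    case 0 show ?case using K xs sh0 by (simp add: N_def \<Gamma>(1))
  next
    case (Suc n)
    obtain \<theta> :: "'g \<Rightarrow> 'g set sym" where \<theta>: "hom_on H \<theta>" "\<And>g. g \<in> H \<Longrightarrow> \<theta> g = 1 \<longleftrightarrow> g \<in> N (Suc n)"
      by (rule quotient_hom [OF H N NH normal, of "Suc n"]) (assumption | rule that)+
    note h = hom_onD [OF \<theta>(1) H]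
    have "s * x * inverse s * inverse x \<in> N (Suc n)"
    proof -
      have "g * (s * x * inverse s * inverse x) * inverse g \<in> \<Gamma> (Suc n)" if g: "g \<in> H" for g
      proof -
        have "g * x * inverse g \<in> \<Gamma> n" using Suc g by (simp add: N_def)
        from \<Gamma>(5) [OF K [OF g xs(2) sh0(2)] this] show ?thesis by (simp add: mult.assoc)
      qed
      then show ?thesis using xs by (simp add: N_def subgrpD [OF H])
    qed
    then have "\<theta> (s * x * inverse s * inverse x) = 1" using \<theta>(2) NH by blast
    then have sx: "\<theta> s * \<theta> x = \<theta> x * \<theta> s" using xs by (simp add: h subgrpD [OF H] commutator_eq_one)
    have "\<theta> a * \<theta> b = \<theta> (a * b)" using inH by (simp add: h)
    also have "\<dots> = \<theta> b * \<theta> a" unfolding ab using inH by (simp add: h)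
    finally have ab': "\<theta> a * \<theta> b = \<theta> b * \<theta> a" .
    have "\<theta> b * \<theta> c * \<theta> b = \<theta> (b * c * b)" using inH by (simp add: h subgrpD [OF H])
    also have "\<dots> = \<theta> c * \<theta> b * \<theta> c" unfolding bc using inH by (simp add: h subgrpD [OF H])
    finally have bc': "\<theta> b * \<theta> c * \<theta> b = \<theta> c * \<theta> b * \<theta> c" .
    have "(\<theta> c * \<theta> a) ^ k * \<theta> c = \<theta> ((c * a) ^ k * c)" using inH by (simp add: h subgrpD [OF H])
    also have "\<dots> = (\<theta> a * \<theta> c) ^ k * \<theta> a" unfolding ca using inH by (simp add: h subgrpD [OF H])
    finally have ca': "(\<theta> c * \<theta> a) ^ k * \<theta> c = (\<theta> a * \<theta> c) ^ k * \<theta> a" .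
    have x: "\<theta> x = \<theta> a * inverse (\<theta> b)" using inH by (simp add: x_def h subgrpD [OF H])
    have c: "\<theta> c = \<theta> s * \<theta> b"
      using inH by (simp add: s_def h subgrpD [OF H] mult.assoc)
    have xb: "\<theta> x * \<theta> b = \<theta> b * \<theta> x"
    proof -
      have "\<theta> b * \<theta> x = \<theta> b * \<theta> a * inverse (\<theta> b)" by (simp add: x mult.assoc)
      also have "\<dots> = \<theta> x * \<theta> b" unfolding ab' [symmetric] by (simp add: x mult.assoc)
      finally show ?thesis ..
    qed
    have "\<theta> a * inverse (\<theta> b) * \<theta> c = \<theta> c * (\<theta> a * inverse (\<theta> b))"
      unfolding x [symmetric] c using sx xb by (metis mult.assoc)
    from artin_central_discrepancy [OF ab' bc' ca' this] have "\<theta> x = 1" by (simp add: x)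
    then show ?case using \<theta>(2) xs by simp
  qed
  then have "1 * x * inverse 1 \<in> \<Gamma> n" for n using subgrpD(1) [OF H] unfolding N_def by blast
  then have "x = 1" using \<Gamma>(4) [of x] by simp
  then have "x * b = b" by simp
  then show ?thesis by (simp add: x_def mult.assoc)
qed

text \<open>An element that is central in \<open>\<langle>b, c\<rangle>\<close> and has no fixed point has an axis, which is translated by \<open>b\<close>
  and \<open>c\<close>.  By the braid relation the two translation lengths agree, so \<open>b\<close> moves the axis, and then
  \<open>a\<close>, which commutes with \<open>b\<close>, translates it as well.  The same argument applies to \<open>\<langle>a, c\<rangle>\<close>.\<close>

lemma common_axis_if_hyperbolic:
  assumes V: "V \<noteq> {}"
    and abc: "a \<in> G" "b \<in> G" "c \<in> G"
    and ab: "a * b = b * a" and bc: "b * c * b = c * b * c" and ca: "(c * a) ^ k * c = (a * c) ^ k * a"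
    and nofix: "(\<forall>x\<in>V. act ((b * c) ^ 3) x \<noteq> x) \<or> (\<forall>x\<in>V. act ((a * c) ^ (2 * k + 1)) x \<noteq> x)"
  obtains f m where "line f" "shifts a f m" "shifts b f m" "shifts c f m"
proof -
  have bc_eq: "m = n" if f: "line f" and s: "shifts b f m" "shifts c f n" for f m n
  proof -
    have "shifts (b * c * b) f (m + n + m)" "shifts (c * b * c) f (n + m + n)"
      using abc s by (intro shifts_mult [OF f]; simp)+
    then have "m + n + m = n + m + n" using shifts_unique [OF f] bc by metis
    then show ?thesis by simp
  qed
  have ca_eq: "m = n" if f: "line f" and s: "shifts a f m" "shifts c f n" for f m n
  proof -
    have "shifts ((c * a) ^ k * c) f (int k * (n + m) + n)" "shifts ((a * c) ^ k * a) f (int k * (m + n) + m)"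
      using abc s by (intro shifts_mult [OF f] shifts_power [OF f]; simp)+
    then have "int k * (n + m) + n = int k * (m + n) + m" using shifts_unique [OF f] ca by metis
    then show ?thesis by (simp add: add.commute)
  qed
  from nofix show ?thesis
  proof
    assume "\<forall>x\<in>V. act ((b * c) ^ 3) x \<noteq> x"
    then obtain f n where f: "line f" and z: "shifts ((b * c) ^ 3) f n" "n > 0"
      using axis_exists [of "(b * c) ^ 3"] V abc by (metis G_closed(2) G_closed(4))
    obtain m where b: "shifts b f m"
      using commuting_shift [OF f _ z(1) _ abc(2)] z(2) braid_center(3) [OF bc] abc by (metis G_closed(2) G_closed(4) less_irrefl)
    obtain m' where c: "shifts c f m'"
      using commuting_shift [OF f _ z(1) _ abc(3)] z(2) braid_center(4) [OF bc] abc by (metis G_closed(2) G_closed(4) less_irrefl)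
    have m': "m' = m" using bc_eq [OF f b c] by simp
    have "shifts ((b * c) ^ 3) f (int 3 * (m + m'))"
      using abc b c by (intro shifts_power [OF f] shifts_mult [OF f]) simp_all
    then have "m \<noteq> 0" using shifts_unique [OF f z(1)] z(2) m' by fastforce
    then obtain l where a: "shifts a f l" using commuting_shift [OF f abc(2) b _ abc(1) ab] by blast
    show ?thesis using that [OF f, of m] a b c m' ca_eq [OF f a c] by simp
  next
    assume "\<forall>x\<in>V. act ((a * c) ^ (2 * k + 1)) x \<noteq> x"
    then obtain f n where f: "line f" and w: "shifts ((a * c) ^ (2 * k + 1)) f n" "n > 0"
      using axis_exists [of "(a * c) ^ (2 * k + 1)"] V abc by (metis G_closed(2) G_closed(4))
    note center = odd_artin_center [OF ca]
    obtain m m' where a: "shifts a f m" and c: "shifts c f m'"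
      using commuting_shift [OF f _ w(1) _ abc(1) center(4)] commuting_shift [OF f _ w(1) _ abc(3) center(5)] w(2) abc
      by (metis G_closed(2) G_closed(4) less_irrefl)
    have m': "m' = m" using ca_eq [OF f a c] by simp
    have "shifts ((a * c) ^ (2 * k + 1)) f (int (2 * k + 1) * (m + m'))"
      using abc a c by (intro shifts_power [OF f] shifts_mult [OF f]) simp_all
    then have "n = int (2 * k + 1) * (m + m')" using shifts_unique [OF f w(1)] by blast
    then have "m \<noteq> 0" using w(2) m' by auto
    then obtain l where b: "shifts b f l" using commuting_shift [OF f abc(1) a _ abc(2)] ab by metis
    show ?thesis using that [OF f, of m] a b c m' bc_eq [OF f b c] by simp
  qed
qed

end


text \<open>In terms of \<open>s\<close> and \<open>t\<close> one has \<open>u = t s\<^sup>2\<close> and \<open>\<delta> = s t s\<^sup>2\<close>, so the relation \<open>u\<^sup>3 = \<delta>\<^sup>2\<close> has exponent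
  sum zero in \<open>s\<close> and one in \<open>t\<close>.\<close>

lemma braid_roots_commute:
  fixes u \<delta> :: "'g::grp"
  defines "s \<equiv> \<delta> * inverse u"
  defines "t \<equiv> u * inverse (s * s)"
  shows "t * s = s * t \<Longrightarrow> u * \<delta> = \<delta> * u" and "u * \<delta> = \<delta> * u \<Longrightarrow> u ^ 3 = \<delta> * \<delta> \<Longrightarrow> t = 1"
proof -
  have d: "\<delta> = s * u" by (simp add: s_def mult.assoc)
  have u: "u = t * (s * s)" by (simp add: t_def mult.assoc)
  show "u * \<delta> = \<delta> * u" if "t * s = s * t"
  proof -
    have "u * s = t * (s * s) * s" by (simp only: u [symmetric])
    also have "\<dots> = t * s * (s * s)" by (simp only: mult.assoc)
    also have "\<dots> = s * (t * (s * s))" unfolding that by (simp only: mult.assoc)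
    finally have "u * s = s * u" by (simp only: u [symmetric])
    then show ?thesis unfolding d by (metis mult.assoc)
  qed
  show "t = 1" if c: "u * \<delta> = \<delta> * u" and z: "u ^ 3 = \<delta> * \<delta>"
  proof -
    have "inverse u * \<delta> = \<delta> * inverse u" using commute_inverse [OF c [symmetric]] by simp
    moreover have "s * s = \<delta> * (inverse u * \<delta>) * inverse u" by (simp add: s_def mult.assoc)
    ultimately have "s * s = \<delta> * (\<delta> * inverse u) * inverse u" by (simp only:)
    also have "\<dots> = u ^ 3 * inverse u * inverse u" by (simp add: z mult.assoc)
    also have "\<dots> = u" by (simp add: eval_nat_numeral mult.assoc)
    finally show ?thesis by (simp add: t_def)
  qed
qed

lemma artin_commuting_generators:
  fixes a b c :: "'g::grp"
  assumes ab: "a * b = b * a" and bc: "b * c * b = c * b * c" and ca: "(c * a) ^ k * c = (a * c) ^ k * a"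
    and comm: "b * c = c * b"
  shows "a = b"
proof -
  have "b = c" by (rule braid_commute_eq [OF bc comm])
  with ab have "c * a = a * c" by simp
  with ca have "(a * c) ^ k * c = (a * c) ^ k * a" by simp
  with \<open>b = c\<close> show ?thesis by simp
qed

lemma hom_on_cj:
  assumes "hom_on S \<theta>" "subgrp S"
  shows "g \<in> S \<Longrightarrow> h \<in> S \<Longrightarrow> cj g h \<in> S" "g \<in> S \<Longrightarrow> h \<in> S \<Longrightarrow> \<theta> (cj g h) = cj (\<theta> g) (\<theta> h)"
  by (simp_all add: cj_def hom_onD [OF assms] subgrpD [OF assms(2)])

context tree_action
begin

text \<open>Unless the generators translate a common line, the roots \<open>u = b c\<close> and \<open>\<delta> = b c b\<close> of the central element
  of \<open>\<langle>b, c\<rangle>\<close> and the root \<open>v = a c\<close> of that of \<open>\<langle>a, c\<rangle>\<close> have fixed points.  If \<open>u\<close> and \<open>\<delta>\<close> have a common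
  fixed point, they commute, by \<open>braid_roots_commute\<close>.  Otherwise let \<open>q\<close> and \<open>m\<close> be the ends of the
  bridge between the fixed trees of \<open>u\<close> and \<open>\<delta>\<close>.  The axis of \<open>b = u\<^sup>-\<^sup>1 \<delta>\<close> is composed of translates of this
  bridge.  Since \<open>a\<close> commutes with \<open>b\<close> and is conjugate to it, \<open>a\<close> translates the axis by the same
  distance, in the same direction as it turns out, so \<open>x = a b\<^sup>-\<^sup>1\<close> fixes the axis.  The orbit of \<open>m\<close>
  under \<open>v\<close> then forces \<open>3\<close> to divide \<open>M = 2 k + 1\<close>, and in that case \<open>x\<close> and \<open>u\<close> satisfy a relation in the
  stabilizer of \<open>q\<close> that makes them commute.\<close>

theorem odd_artin_tree_action:
  assumes V: "V \<noteq> {}" and tfn: "\<And>x. x \<in> V \<Longrightarrow> res_tfn (stab x)"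
    and abc: "a \<in> G" "b \<in> G" "c \<in> G" and k: "k \<ge> 1"
    and ab: "a * b = b * a" and bc: "b * c * b = c * b * c" and ca: "(c * a) ^ k * c = (a * c) ^ k * a"
  shows "a = b"
proof (cases "(\<forall>x\<in>V. act ((b * c) ^ 3) x \<noteq> x) \<or> (\<forall>x\<in>V. act ((a * c) ^ (2 * k + 1)) x \<noteq> x)")
  case True
  show ?thesis
    by (rule common_axis_if_hyperbolic [OF V abc ab bc ca True]) (rule common_axis [OF tfn abc ab bc ca])
next
  case False
  define u \<delta> v \<eta> x where "u = b * c" and "\<delta> = b * c * b" and "v = a * c" and "\<eta> = (a * c) ^ k * a"
    and "x = a * inverse b"
  have inG: "u \<in> G" "\<delta> \<in> G" "v \<in> G" "\<eta> \<in> G" "x \<in> G"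
    using abc by (simp_all add: u_def \<delta>_def v_def \<eta>_def x_def)
  note center = odd_artin_center [OF ca, folded \<eta>_def, folded v_def]
  have z: "u ^ 3 = \<delta> * \<delta>" using braid_center(1) [OF bc] by (simp add: u_def \<delta>_def power2_eq_square)
  have words: "\<delta> = u * b" "\<delta> = c * u" "\<delta> * b = c * \<delta>" "v = x * u" "a = x * b" "u = b * c"
    using bc by (simp_all add: u_def \<delta>_def v_def x_def mult.assoc)
  obtain q0 where q0: "q0 \<in> V" "act u q0 = q0"
    using False power_fixed_point [OF inG(1), of _ 3] by (auto simp: u_def)
  obtain m0 where m0: "m0 \<in> V" "act \<delta> m0 = m0"
    using False power_fixed_point [OF inG(2), of _ 2] z by (auto simp: u_def power2_eq_square)
  obtain v0 where v0: "v0 \<in> V" "act v v0 = v0"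
    using False power_fixed_point [OF inG(3), of _ "2 * k + 1"] by (auto simp: v_def)
  obtain q m where q: "q \<in> V" "act u q = q" and m: "m \<in> V" "act \<delta> m = m"
    and min: "\<And>q' m'. q' \<in> V \<Longrightarrow> act u q' = q' \<Longrightarrow> m' \<in> V \<Longrightarrow> act \<delta> m' = m' \<Longrightarrow> d q m \<le> d q' m'"
  proof -
    let ?P = "\<lambda>(q, m). q \<in> V \<and> act u q = q \<and> m \<in> V \<and> act \<delta> m = m"
    have "?P (q0, m0)" using q0 m0 by simp
    from arg_min_nat_lemma [of ?P, OF this, of "\<lambda>(q, m). d q m"] that show ?thesis
      by (auto split: prod.splits)
  qed
  define r where "r = d q m"
  show ?thesis
  proof (cases "r = 0")
    case True
    then have qm: "q = m" using q m dist_zero by (simp add: r_def)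
    note S = subgrp_stab [OF q(1)]
    have ud: "u \<in> stab q" "\<delta> \<in> stab q" using inG q m qm by (simp_all add: stab_def)
    \<comment> \<open>\<open>u\<close> and \<open>\<delta>\<close> have a common fixed point\<close>
    define s t where "s = \<delta> * inverse u" and "t = u * inverse (s * s)"
    have st: "s \<in> stab q" "t \<in> stab q" using ud by (simp_all add: s_def t_def subgrpD [OF S] del: inverse_of_mult)
    have "t * s = s * t"
    proof (rule commute_if_exponent_sum [OF S tfn [OF q(1)] st(2,1), of 1])
      fix \<theta> :: "'g \<Rightarrow> 'g set sym" assume \<theta>: "hom_on (stab q) \<theta>" and c: "\<theta> t * \<theta> s = \<theta> s * \<theta> t"
      note h = hom_onD [OF \<theta> S] subgrpD [OF S]
      have e: "\<theta> s = \<theta> \<delta> * inverse (\<theta> u)" "\<theta> t = \<theta> u * inverse (\<theta> s * \<theta> s)"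
        using ud st(1) unfolding s_def [symmetric] by (simp add: s_def h, simp add: t_def h del: inverse_of_mult)
      have "\<theta> (u ^ 3) = \<theta> (\<delta> * \<delta>)" by (simp only: z)
      then have "\<theta> u ^ 3 = \<theta> \<delta> * \<theta> \<delta>" using ud by (simp add: h)
      then have "\<theta> t = 1"
        using braid_roots_commute(2) [OF braid_roots_commute(1) [OF c [unfolded e]]] unfolding e by blast
      then show "\<theta> t ^ 1 = 1" by simp
    qed simp
    then have ud: "u * \<delta> = \<delta> * u" using braid_roots_commute(1) unfolding s_def t_def by blast
    then have "u * b = b * u" unfolding words(1) by (simp add: mult.assoc)
    then have "b * c = c * b" unfolding words(6) by (simp add: mult.assoc)
    then show ?thesis by (rule artin_commuting_generators [OF ab bc ca])
  next
    case False
    then have r: "r > 0" by simp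
    have mq: "d m q = r" "d q m = r" "m \<noteq> q" using q m r by (auto simp: r_def dist_sym)
    have um: "d m (act u m) = 2 * r"
      by (rule midpoint_fixed [OF inG(1) q m(1)]) (use min m q mq dist_sym in fastforce)
    have dq: "d q (act \<delta> q) = 2 * r"
      by (rule midpoint_fixed [OF inG(2) m q(1)]) (use min m q mq dist_sym in fastforce)
    define p where "p = act (inverse b) q"
    have p: "p \<in> V" "act b p = q" using q abc by (simp_all add: p_def)
    have dp: "act \<delta> p = q" using inG abc p q by (simp add: words(1) act_mult)
    have ubm: "act u (act b m) = m" using inG abc m by (simp add: words(1) flip: act_mult)
    have bq: "act b q \<in> V" "act b m \<in> V" using abc q m by simp_all
    have dists: "d p q = 2 * r" "d p m = r" "d m (act b m) = 2 * r" "d q (act b m) = r"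
      "d q (act b q) = 2 * r" "d (act b m) (act b q) = r"
    proof -
      show 1: "d p q = 2 * r" using act_isom [OF inG(2) p(1) q(1)] dp dq by simp
      show "d p m = r" using act_isom [OF inG(2) p(1) m(1)] dp mq m by simp
      show "d m (act b m) = 2 * r"
        using act_isom [OF inG(1) m(1) bq(2)] ubm um dist_sym m inG by simp
      show "d q (act b m) = r" using act_isom [OF inG(1) q(1) bq(2)] ubm mq q by simp
      show "d q (act b q) = 2 * r" using act_isom [OF abc(2) p(1) q(1)] p 1 by simp
      show "d (act b m) (act b q) = r" using act_isom [OF abc(2) m(1) q(1)] mq by simp
    qed
    have "d p (act b m) = 3 * r"
      using local_to_global [OF p(1) m(1) q(1) bq(2)] dists mq by simp
    then have "d p (act b q) = 4 * r"
      using local_to_global [OF p(1) q(1) bq(2,1)] dists r dist_refl [OF q(1)] by fastforce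
    moreover have "q \<noteq> p" using dists(1) r p by auto
    ultimately obtain f where f: "line f" and bf: "shifts b f (int (2 * r))" and f0: "f 0 = p"
      using axis_through [OF abc(2) p(1)] p dists(1) by auto
    note fV = lineD(1) [OF f] and fd = lineD(2) [OF f]
    have fq: "f (2 * int r) = q" using shiftsD [OF bf, of 0] f0 p by simp
    have fm: "f (int r) = m"
      using between_unique [OF p(1) q(1) fV m(1), of "int r"] fd [of 0 "int r"] fd [of "int r" "2 * int r"]
        f0 fq dists mq by simp
    have cq: "act c q = p"
    proof -
      have "c = inverse b * u" by (simp add: words(6))
      then show ?thesis using abc inG q by (simp add: act_mult p_def)
    qed
    obtain \<tau> where \<tau>: "shifts a f \<tau>"
      using commuting_shift [OF f abc(2) bf _ abc(1) ab] r by auto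
    have "a = (inverse \<eta> * \<delta>) * b * inverse (inverse \<eta> * \<delta>)"
    proof -
      have "inverse \<eta> * (\<delta> * b) * inverse \<delta> * \<eta> = inverse \<eta> * (c * \<eta>)"
        unfolding words(3) by (simp add: mult.assoc)
      also have "\<dots> = a" unfolding center(2) [symmetric] by simp
      finally show ?thesis by (simp add: mult.assoc)
    qed
    then have "\<bar>\<tau>\<bar> = 2 * int r"
      using conjugate_shift [OF f abc(2) bf, of "inverse \<eta> * \<delta>" \<tau>] \<tau> inG by simp
    then consider "\<tau> = - 2 * int r" | "\<tau> = 2 * int r" by linarith
    then show ?thesis
    proof cases
      case 1
      \<comment> \<open>here \<open>a\<close> and \<open>b\<close> would translate in opposite directions\<close>
      have ap: "act a p = f (- 2 * int r)" using shiftsD [OF \<tau>, of 0] f0 1 by simp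
      then have vq: "act v q = f (- 2 * int r)" using abc q cq by (simp add: v_def act_mult)
      obtain y where y: "y \<in> V" "act v y = y" "2 * d q y = d q (act v q)" "d y (act v q) = d q y"
        by (rule midpoint_fixed [OF inG(3) v0 q(1)])
      have "int (d q (act v q)) = 4 * int r" using fd [of "2 * int r" "- 2 * int r"] fq vq by simp
      then have "y = p"
        using between_unique [of q "act v q" y p] y q p inG fd [of 0 "- 2 * int r"] f0 vq dists(1)
          dist_sym [of p q] fV by simp
      then have "act a (act c p) = p" using y abc p by (simp add: v_def act_mult)
      then have "act c p = act (inverse a) (f 0)" using act_fix_inverse [OF abc(1), of "act c p" p] abc p f0 by simp
      also have "\<dots> = q" using shiftsD [OF shifts_inverse [OF f abc(1) \<tau>], of 0] 1 fq by simp
      finally have cp: "act c p = q" .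
      have "act \<delta> (act b y) = act c (act \<delta> y)" if "y \<in> V" for y
        using words(3) abc inG that by (simp flip: act_mult)
      from this [OF q(1)] this [OF p(1)] have "act \<delta> q = p" "act \<delta> (act b q) = q" using dp p cp cq by simp_all
      then have "act b q = p" using dp act_eq_iff [OF inG(2) bq(1) p(1)] by simp
      then show ?thesis using \<open>d p (act b q) = 4 * r\<close> r p by simp
    next
      case 2
      have xf: "shifts x f 0"
        using shifts_mult [OF f abc(1) _ \<tau> shifts_inverse [OF f abc(2) bf]] 2 abc by (simp add: x_def)
      then have xq: "act x q = q" and xm: "act x m = m"
        using fq fm shiftsD [OF xf, of "2 * int r"] shiftsD [OF xf, of "int r"] by simp_all
      have ap: "act a p = q" using shiftsD [OF \<tau>, of 0] f0 fq 2 by simp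
      have am: "act a m = act b m" using shiftsD [OF \<tau>, of "int r"] shiftsD [OF bf, of "int r"] fm 2 by simp
      have vq: "act v q = q" using abc q cq ap by (simp add: v_def act_mult)
      have ep: "act \<eta> p = q"
        using act_fix_power [OF inG(3) q(1) vq, of k] abc inG p ap
        by (simp add: \<eta>_def act_mult flip: v_def)
      have "act a (act (v ^ (2 * k + 1)) p) = act (v ^ (2 * k + 1)) (act a p)"
        using center(4) abc inG p by (simp flip: act_mult)
      then have "act (v ^ (2 * k + 1)) p = p"
        using ap act_fix_power [OF inG(3) q(1) vq, of "2 * k + 1"] act_eq_iff [OF abc(1) _ p(1)] inG p by simp
      then have "act (\<eta> * \<eta>) p = p" unfolding center(1) .
      then have eq: "act \<eta> q = p" using ep inG p by (simp add: act_mult)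
      have em: "act \<eta> m = m"
        using between_unique [of p q "act \<eta> m" m] act_isom [OF inG(4) q(1) m(1)] act_isom [OF inG(4) m(1) p(1)]
          p q m inG eq ep dists mq dist_sym [of p m] by simp
      have vbm: "act v (act b m) = m"
        using inG bq ubm xm by (simp add: words(4) act_mult)
      have vkbm: "act (v ^ k) (act b m) = m"
        using em am abc inG m by (simp add: \<eta>_def act_mult flip: v_def)
      have k1: "act (v ^ (k - 1)) m = m"
      proof -
        have "v ^ k = v ^ (k - 1) * v" using k by (simp flip: power_Suc2)
        then show ?thesis using vkbm vbm inG bq by (simp add: act_mult)
      qed
      have "act (\<eta> * \<eta>) m = m" using em inG m by (simp add: act_mult)
      then have wm: "act (v ^ (2 * k + 1)) m = m" unfolding center(1) .
      \<comment> \<open>The powers \<open>v\<^bsup>k - 1\<^esup>\<close> and \<open>v\<^bsup>2 k + 1\<^esup>\<close> fix \<open>m\<close>, and \<open>v\<close> does not, so \<open>v\<close> permutes its orbit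
        cyclically with order \<open>gcd (k - 1) (2 k + 1) = 3\<close>.\<close>
      have v3: "act (v ^ 3) m = m"
      proof -
        have "2 * k + 1 = 3 + ((k - 1) + (k - 1))" using k by simp
        then have "v ^ (2 * k + 1) = v ^ 3 * (v ^ (k - 1) * v ^ (k - 1))" by (simp only: power_add)
        then show ?thesis using wm k1 inG m by (simp add: act_mult)
      qed
      have vm: "act v m \<noteq> m"
      proof
        assume "act v m = m"
        with vbm have "act b m = m" using act_eq_iff [OF inG(3) bq(2) m(1)] by simp
        then show False using dists(3) r m by simp
      qed
      have "(k - 1) mod 3 = 0"
      proof (rule ccontr)
        assume n: "(k - 1) mod 3 \<noteq> 0"
        have "v ^ (k - 1) = (v ^ 3) ^ ((k - 1) div 3) * v ^ ((k - 1) mod 3)"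
          by (simp flip: power_mult power_add)
        then have "act ((v ^ 3) ^ ((k - 1) div 3)) (act (v ^ ((k - 1) mod 3)) m)
            = act ((v ^ 3) ^ ((k - 1) div 3)) m"
          using k1 act_fix_power [OF _ m(1) v3] inG m by (simp add: act_mult)
        then have mod: "act (v ^ ((k - 1) mod 3)) m = m" using inG m by simp
        have "(k - 1) mod 3 = 1 \<or> (k - 1) mod 3 = 2" using n by linarith
        then show False
        proof
          assume "(k - 1) mod 3 = 1"
          with mod vm show False by simp
        next
          assume "(k - 1) mod 3 = 2"
          then have "act (v ^ 2) m = m" using mod by simp
          moreover have "act (v ^ 3) m = act v (act (v ^ 2) m)"
            using inG m by (simp add: eval_nat_numeral flip: act_mult)
          ultimately show False using v3 vm by simp
        qed
      qed
      then obtain j where j: "k = 3 * j + 1" using k by (metis Suc_pred' add.commute mod_0_imp_dvd dvdE One_nat_def Suc_eq_plus1 less_le_trans zero_less_one)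
      have xb: "x * b = b * x"
      proof -
        have "b * x = b * a * inverse b" by (simp add: x_def mult.assoc)
        also have "\<dots> = x * b" unfolding ab [symmetric] by (simp add: x_def mult.assoc)
        finally show ?thesis ..
      qed
      note S = subgrp_stab [OF q(1)]
      have ux: "u \<in> stab q" "x \<in> stab q" using inG q xq by (simp_all add: stab_def)
      have "x * u = u * x"
      proof (rule commute_if_exponent_sum [OF S tfn [OF q(1)] ux(2,1), of "2 * j + 1"])
        fix \<theta> :: "'g \<Rightarrow> 'g set sym" assume \<theta>: "hom_on (stab q) \<theta>" and comm: "\<theta> x * \<theta> u = \<theta> u * \<theta> x"
        note h = hom_onD [OF \<theta> S] subgrpD [OF S] hom_on_cj [OF \<theta> S]
        have x1: "cj \<delta> x = cj u x"
        proof -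
          have "b * x * inverse b = x" unfolding xb [symmetric] by (simp add: mult.assoc)
          moreover have "cj \<delta> x = u * (b * x * inverse b) * inverse u"
            unfolding words(1) by (simp add: cj_def mult.assoc)
          ultimately show ?thesis by (simp only: cj_def)
        qed
        \<comment> \<open>\<open>rel\<close> states that \<open>\<eta>\<^sup>2 = v\<^bsup>2 k + 1\<^esup>\<close>, for \<open>\<eta> = v\<^sup>k a = v\<^bsup>k + 1\<^esup> u\<^sup>-\<^sup>2 \<delta>\<close>\<close>
        have y: "\<eta> * inverse \<delta> = v ^ (k + 1) * inverse (u * u)"
        proof -
          have "\<eta> * inverse \<delta> = v ^ k * (x * u) * inverse u * inverse u"
            unfolding words(1) by (simp add: \<eta>_def x_def mult.assoc flip: v_def)
          also have "\<dots> = v ^ k * v * inverse (u * u)" by (simp add: mult.assoc flip: words(4))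
          finally show ?thesis by (simp only: power_Suc2 flip: Suc_eq_plus1)
        qed
        have "cj \<delta> (\<eta> * inverse \<delta>) = inverse (\<eta> * inverse \<delta>) * (\<eta> * \<eta>) * inverse (u ^ 3)"
          unfolding z by (simp add: cj_def mult.assoc)
        also have "\<dots> = u * u * inverse (v ^ (k + 1)) * v ^ ((k + 1) + k) * inverse (u ^ 3)"
          unfolding y center(1) by (simp add: mult.assoc mult_2)
        also have "\<dots> = u * u * v ^ k * inverse (u ^ 3)"
          unfolding power_add [of v "k + 1" k] by (simp only: mult.assoc inverse_mult_assoc)
        finally have rel: "cj \<delta> ((x * u) ^ (3 * j + 2) * inverse (u * u)) = u * u * (x * u) ^ (3 * j + 1) * inverse (u ^ 3)"
          unfolding y by (simp add: j words(4))
        note R = arg_cong [OF two_generator_relation [OF z x1 rel], of \<theta>]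
        show "\<theta> x ^ (2 * j + 1) = 1"
          by (rule two_generator_exponent_sum [OF comm]) (use R ux in \<open>simp add: h\<close>)
      qed simp
      then have "x * (inverse b * u) = inverse b * u * x" by (rule commute_mult [OF commute_inverse [OF xb]])
      then have "x * c = c * x" by (simp add: words(6))
      then have "a * inverse b * c = c * (a * inverse b)" by (simp add: x_def)
      then show ?thesis by (rule artin_central_discrepancy [OF ab bc ca])
    qed
  qed
qed

end


section \<open>Free groups and their Magnus filtration\<close>

quotient_type 'x fgrp = "'x word" / "\<lambda>u v. (u, v) \<in> word_eq UNIV {}"
proof (rule equivpI)
  show "reflp (\<lambda>u v. (u, v) \<in> word_eq (UNIV :: 'x set) {})" by (rule reflpI) (auto intro: word_eq.refl simp: words_on_def)
  show "symp (\<lambda>u v. (u, v) \<in> word_eq (UNIV :: 'x set) {})" by (rule sympI) (rule word_eq.sym)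
  show "transp (\<lambda>u v. (u, v) \<in> word_eq (UNIV :: 'x set) {})" by (rule transpI) (rule word_eq.trans)
qed

lemma words_on_UNIV [simp]: "w \<in> words_on UNIV"
  by (simp add: words_on_def)

lemma satisfies_empty [simp]: "satisfies S {} f"
  by (simp add: satisfies_def)

instantiation fgrp :: (type) grp
begin

lift_definition one_fgrp :: "'x fgrp" is "[]" .
lift_definition times_fgrp :: "'x fgrp \<Rightarrow> 'x fgrp \<Rightarrow> 'x fgrp" is "(@)" by (rule word_eq_append)
lift_definition inverse_fgrp :: "'x fgrp \<Rightarrow> 'x fgrp" is inv_word
proof (rule word_eq_if_weval_eq)
  fix u v :: "'x word" and f :: "'x \<Rightarrow> 'x word set sym"
  assume "(u, v) \<in> word_eq UNIV {}" "satisfies UNIV {} f"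
  then have "weval f u = weval f v" by (rule weval_cong_word_eq)
  then show "weval f (inv_word u) = weval f (inv_word v)" by simp
qed simp_all

instance
proof
  fix a b c :: "'x fgrp"
  show "a * b * c = a * (b * c)" by transfer (simp add: word_eq.refl)
  show "1 * a = a" by transfer (simp add: word_eq.refl)
  show "a * 1 = a" by transfer (simp add: word_eq.refl)
  show "inverse a * a = 1" by transfer (rule cancel_word, simp)
qed

end

lift_definition fg :: "'x \<Rightarrow> 'x fgrp" is "\<lambda>x. [(x, True)]" .

lift_definition fg_eval :: "('x \<Rightarrow> 'k::grp) \<Rightarrow> 'x fgrp \<Rightarrow> 'k" is weval
  by (erule weval_cong_word_eq) simp

lemma fg_eval_simps [simp]:
  "fg_eval f 1 = 1" "fg_eval f (g * h) = fg_eval f g * fg_eval f h" "fg_eval f (fg x) = f x"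
  by (transfer, simp)+

lemma fg_eval_inverse [simp]: "fg_eval f (inverse g) = inverse (fg_eval f g)"
  by (metis fg_eval_simps(1,2) inverse_mult inverse_unique mult_inverse)

lemma fg_eval_weval: "fg_eval f (weval p w) = weval (\<lambda>x. fg_eval f (p x)) w"
proof (induction w)
  case (Cons l w) then show ?case by (cases l; cases "snd l") auto
qed simp

lemma weval_fg: "weval fg w = abs_fgrp w"
proof (induction w)
  case (Cons l w)
  obtain s p where l: "l = (s, p)" by fastforce
  have "letter_val fg l = abs_fgrp [l]"
    by (cases p) (simp_all add: l fg.abs_eq inverse_fgrp.abs_eq inv_word_def)
  with Cons show ?case by (simp add: weval_Cons times_fgrp.abs_eq)
qed (simp add: one_fgrp.abs_eq)

lemma fgrp_induct [case_names one mult inv]: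
  assumes "P 1" "\<And>x g. P g \<Longrightarrow> P (fg x * g)" "\<And>x g. P g \<Longrightarrow> P (inverse (fg x) * g)"
  shows "P g"
proof -
  have "\<exists>w. g = weval fg w" unfolding weval_fg by (induct g rule: fgrp.abs_induct) blast
  then obtain w where "g = weval fg w" ..
  moreover have "P (weval fg w)" for w
  proof (induction w)
    case (Cons l w) then show ?case using assms by (cases l; cases "snd l") auto
  qed (simp add: assms)
  ultimately show ?thesis by simp
qed

text \<open>The Magnus representation: the generator \<open>x\<close> acts on formal power series in noncommuting
  variables, given by their coefficients, as left multiplication by \<open>1 + x\<close>.\<close>

definition magnus_gen :: "'x \<Rightarrow> ('x list \<Rightarrow> int) \<Rightarrow> 'x list \<Rightarrow> int"
  where "magnus_gen x \<phi> w = \<phi> w + (case w of [] \<Rightarrow> 0 | y # w' \<Rightarrow> if y = x then \<phi> w' else 0)"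

fun magnus_gen_inv :: "'x \<Rightarrow> ('x list \<Rightarrow> int) \<Rightarrow> 'x list \<Rightarrow> int"
  where
    "magnus_gen_inv x \<phi> [] = \<phi> []"
  | "magnus_gen_inv x \<phi> (y # w) = \<phi> (y # w) - (if y = x then magnus_gen_inv x \<phi> w else 0)"

lemma magnus_gen_simps [simp]:
  "magnus_gen x \<phi> [] = \<phi> []" "magnus_gen x \<phi> (y # w) = \<phi> (y # w) + (if y = x then \<phi> w else 0)"
  by (simp_all add: magnus_gen_def)

lemma bij_magnus_gen: "bij (magnus_gen x)"
proof (rule o_bij [of "magnus_gen_inv x"])
  show "magnus_gen_inv x \<circ> magnus_gen x = id"
  proof (intro ext)
    fix \<phi> w show "(magnus_gen_inv x \<circ> magnus_gen x) \<phi> w = id \<phi> w" by (induction w) auto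
  qed
  show "magnus_gen x \<circ> magnus_gen_inv x = id"
  proof (intro ext)
    fix \<phi> w show "(magnus_gen x \<circ> magnus_gen_inv x) \<phi> w = id \<phi> w" by (cases w) auto
  qed
qed

definition magnus :: "'x fgrp \<Rightarrow> ('x list \<Rightarrow> int) \<Rightarrow> 'x list \<Rightarrow> int"
  where "magnus g = app (fg_eval (\<lambda>x. Sym (magnus_gen x)) g)"

lemma magnus_one [simp]: "magnus 1 \<phi> = \<phi>"
  and magnus_mult [simp]: "magnus (g * h) \<phi> = magnus g (magnus h \<phi>)"
  and magnus_fg [simp]: "magnus (fg x) \<phi> = magnus_gen x \<phi>"
  and magnus_inv [simp]: "magnus (inverse g) (magnus g \<phi>) = \<phi>" "magnus g (magnus (inverse g) \<phi>) = \<phi>"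
  by (simp_all add: magnus_def app_Sym bij_magnus_gen flip: app_mult)

lemma magnus_fg_inv: "magnus (inverse (fg x)) \<phi> = magnus_gen_inv x \<phi>"
proof -
  have "magnus (fg x) (magnus_gen_inv x \<phi>) = \<phi>"
  proof
    fix w show "magnus (fg x) (magnus_gen_inv x \<phi>) w = \<phi> w" by (cases w) auto
  qed
  then show ?thesis by (metis magnus_inv(1))
qed

lemma magnus_diff: "magnus g (\<lambda>w. \<phi> w - \<psi> w) = (\<lambda>w. magnus g \<phi> w - magnus g \<psi> w)"
proof (induction g rule: fgrp_induct)
  case (mult x g)
  show ?case unfolding magnus_mult mult
  proof
    fix w show "magnus (fg x) (\<lambda>w. magnus g \<phi> w - magnus g \<psi> w) w = magnus (fg x) (magnus g \<phi>) w - magnus (fg x) (magnus g \<psi>) w"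
      by (cases w) auto
  qed
next
  case (inv x g)
  show ?case unfolding magnus_mult inv magnus_fg_inv
  proof
    fix w show "magnus_gen_inv x (\<lambda>w. magnus g \<phi> w - magnus g \<psi> w) w
        = magnus_gen_inv x (magnus g \<phi>) w - magnus_gen_inv x (magnus g \<psi>) w"
      by (induction w) auto
  qed
qed simp

definition order_ge :: "nat \<Rightarrow> ('x list \<Rightarrow> int) \<Rightarrow> bool"
  where "order_ge k \<phi> \<longleftrightarrow> (\<forall>w. length w < k \<longrightarrow> \<phi> w = 0)"

text \<open>The elements whose power series is \<open>1\<close> plus terms of degree at least \<open>n + 1\<close>, expressed through the action: \<open>g - 1\<close>
  raises the order of every series by at least \<open>n + 1\<close>.\<close>

definition magnus_filtration :: "nat \<Rightarrow> 'x fgrp set"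
  where "magnus_filtration n =
    {g. \<forall>k \<phi>. order_ge k \<phi> \<longrightarrow> order_ge (k + n + 1) (\<lambda>w. magnus g \<phi> w - \<phi> w)}"

lemma magnus_filtrationD:
  "g \<in> magnus_filtration n \<Longrightarrow> order_ge k \<phi> \<Longrightarrow> order_ge (k + n + 1) (\<lambda>w. magnus g \<phi> w - \<phi> w)"
  by (auto simp: magnus_filtration_def)

lemma order_ge_magnus: "order_ge k \<phi> \<Longrightarrow> order_ge k (magnus g \<phi>)"
proof (induction g rule: fgrp_induct)
  case (mult x g)
  have "magnus_gen x (magnus g \<phi>) w = 0" if "length w < k" for w
    using mult that by (cases w) (auto simp: order_ge_def)
  then show ?case by (simp add: order_ge_def)
next
  case (inv x g)
  have "magnus_gen_inv x (magnus g \<phi>) w = 0" if "length w < k" for w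
    using that inv by (induction w) (auto simp: order_ge_def)
  then show ?case by (simp add: order_ge_def magnus_fg_inv)
qed simp

lemma magnus_filtration_mult:
  assumes "g \<in> magnus_filtration n" "h \<in> magnus_filtration n"
  shows "g * h \<in> magnus_filtration n"
  unfolding magnus_filtration_def
proof (intro CollectI allI impI)
  fix k \<phi> assume k: "order_ge k (\<phi> :: 'a list \<Rightarrow> int)"
  show "order_ge (k + n + 1) (\<lambda>w. magnus (g * h) \<phi> w - \<phi> w)"
    using magnus_filtrationD [OF assms(1) order_ge_magnus [OF k, of h]] magnus_filtrationD [OF assms(2) k]
    by (auto simp: order_ge_def)
qed

lemma magnus_filtration_inverse:
  assumes "g \<in> magnus_filtration n"
  shows "inverse g \<in> magnus_filtration n"
  unfolding magnus_filtration_def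
proof (intro CollectI allI impI)
  fix k \<phi> assume k: "order_ge k (\<phi> :: 'a list \<Rightarrow> int)"
  show "order_ge (k + n + 1) (\<lambda>w. magnus (inverse g) \<phi> w - \<phi> w)"
    using magnus_filtrationD [OF assms order_ge_magnus [OF k, of "inverse g"]]
    by (auto simp: order_ge_def)
qed

lemma magnus_filtration_0: "magnus_filtration 0 = (UNIV :: 'x fgrp set)"
proof -
  have gen: "fg x \<in> magnus_filtration 0" for x :: 'x
    unfolding magnus_filtration_def
  proof (intro CollectI allI impI)
    fix k \<phi> assume k: "order_ge k (\<phi> :: 'x list \<Rightarrow> int)"
    have "magnus (fg x) \<phi> w - \<phi> w = 0" if "length w < k + 1" for w
      using k that by (cases w) (auto simp: order_ge_def)
    then show "order_ge (k + 0 + 1) (\<lambda>w. magnus (fg x) \<phi> w - \<phi> w)" by (simp add: order_ge_def)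
  qed
  have "g \<in> magnus_filtration 0" for g :: "'x fgrp"
  proof (induction g rule: fgrp_induct)
    case one show ?case by (simp add: magnus_filtration_def order_ge_def)
  qed (simp_all add: magnus_filtration_mult magnus_filtration_inverse gen)
  then show ?thesis by blast
qed

text \<open>The commutator acts as \<open>1\<close> plus \<open>(s g - g s) s\<^sup>-\<^sup>1 g\<^sup>-\<^sup>1\<close>, and \<open>s g - g s = (s - 1) (g - 1) - (g - 1) (s - 1)\<close>
  raises the order by \<open>1 + (n + 1)\<close>.\<close>

lemma magnus_filtration_commutator:
  assumes g: "g \<in> magnus_filtration n"
  shows "s * g * inverse s * inverse g \<in> magnus_filtration (Suc n)"
  unfolding magnus_filtration_def
proof (intro CollectI allI impI)
  fix k \<phi> assume k: "order_ge k (\<phi> :: 'a list \<Rightarrow> int)"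
  define \<psi> where "\<psi> = magnus (inverse s) (magnus (inverse g) \<phi>)"
  have \<phi>: "\<phi> = magnus g (magnus s \<psi>)" by (simp add: \<psi>_def)
  have \<psi>: "order_ge k \<psi>" unfolding \<psi>_def by (intro order_ge_magnus k)
  have s: "s \<in> magnus_filtration 0" by (simp add: magnus_filtration_0)
  have 1: "order_ge (k + n + 1 + 0 + 1) (\<lambda>w. magnus s (\<lambda>w. magnus g \<psi> w - \<psi> w) w - (magnus g \<psi> w - \<psi> w))"
    by (rule magnus_filtrationD [OF s magnus_filtrationD [OF g \<psi>]])
  have 2: "order_ge (k + 0 + 1 + n + 1) (\<lambda>w. magnus g (\<lambda>w. magnus s \<psi> w - \<psi> w) w - (magnus s \<psi> w - \<psi> w))"
    by (rule magnus_filtrationD [OF g magnus_filtrationD [OF s \<psi>]])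
  have "magnus (s * g * inverse s * inverse g) \<phi> = magnus s (magnus g \<psi>)" by (simp add: \<psi>_def)
  then have "magnus (s * g * inverse s * inverse g) \<phi> w - \<phi> w = 0" if "length w < k + Suc n + 1" for w
    using 1 [unfolded order_ge_def, rule_format, of w] 2 [unfolded order_ge_def, rule_format, of w] that
    by (simp add: magnus_diff \<phi>)
  then show "order_ge (k + Suc n + 1) (\<lambda>w. magnus (s * g * inverse s * inverse g) \<phi> w - \<phi> w)"
    unfolding order_ge_def by blast
qed

text \<open>Modulo \<open>(g - 1)\<^sup>2\<close>, which raises the order by \<open>2 (n + 1)\<close>, the operator \<open>g\<^sup>i - 1\<close> is \<open>i (g - 1)\<close>.\<close>

lemma magnus_filtration_root:
  assumes g: "g \<in> magnus_filtration n" and m: "m > 0" and gm: "g ^ m \<in> magnus_filtration (Suc n)"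
  shows "g \<in> magnus_filtration (Suc n)"
  unfolding magnus_filtration_def
proof (intro CollectI allI impI)
  fix k \<phi> assume k: "order_ge k (\<phi> :: 'a list \<Rightarrow> int)"
  have pow: "g ^ i \<in> magnus_filtration n" for i
    by (induction i) (simp_all add: magnus_filtration_mult g, simp add: magnus_filtration_def order_ge_def)
  have "order_ge (k + Suc n + 1) (\<lambda>w. magnus (g ^ i) \<phi> w - \<phi> w - int i * (magnus g \<phi> w - \<phi> w))" for i
  proof (induction i)
    case 0 show ?case by (simp add: order_ge_def)
  next
    case (Suc i)
    have "order_ge (k + n + 1 + n + 1) (\<lambda>w. magnus g (\<lambda>w. magnus (g ^ i) \<phi> w - \<phi> w) w - (magnus (g ^ i) \<phi> w - \<phi> w))"
      by (rule magnus_filtrationD [OF g magnus_filtrationD [OF pow k]])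
    then have "magnus (g ^ Suc i) \<phi> w - \<phi> w - int (Suc i) * (magnus g \<phi> w - \<phi> w) = 0"
      if "length w < k + Suc n + 1" for w
      using Suc [unfolded order_ge_def, rule_format, of w] that
      unfolding order_ge_def by (auto simp: magnus_diff algebra_simps dest!: spec [of _ w])
    then show ?case unfolding order_ge_def by blast
  qed
  from this [of m] magnus_filtrationD [OF gm k]
  show "order_ge (k + Suc n + 1) (\<lambda>w. magnus g \<phi> w - \<phi> w)"
    using m by (auto simp: order_ge_def)
qed

text \<open>Every element is a product of nontrivial powers of generators, with consecutive generators distinct.\<close>

fun syllables :: "('x \<times> int) list \<Rightarrow> 'x fgrp"
  where
    "syllables [] = 1"
  | "syllables ((x, e) # L) = (if e \<ge> 0 then fg x ^ nat e else inverse (fg x) ^ nat (- e)) * syllables L"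

lemma syllables_step:
  "syllables ((x, e + 1) # L) = fg x * syllables ((x, e) # L)"
  "syllables ((x, e - 1) # L) = inverse (fg x) * syllables ((x, e) # L)"
proof -
  have *: "syllables ((x, e + 1) # L) = fg x * syllables ((x, e) # L)" for e
  proof (cases "e \<ge> 0")
    case True
    then have "nat (e + 1) = Suc (nat e)" by simp
    with True show ?thesis by (simp add: mult.assoc)
  next
    case False
    then have "nat (- e) = Suc (nat (- (e + 1)))" by simp
    with False show ?thesis by (cases "e = -1") (simp_all add: mult.assoc)
  qed
  then show "syllables ((x, e + 1) # L) = fg x * syllables ((x, e) # L)" .
  show "syllables ((x, e - 1) # L) = inverse (fg x) * syllables ((x, e) # L)"
    using * [of "e - 1"] by (simp del: syllables.simps)
qed

lemma syllables_exist:
  "\<exists>L. g = syllables L \<and> distinct_adj (map fst L) \<and> (\<forall>(x, e) \<in> set L. e \<noteq> 0)"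
proof (induction g rule: fgrp_induct)
  case one show ?case by (rule exI [of _ "[]"]) simp
next
  have step: "\<exists>L'. syllables ((x, e) # L) = syllables L' \<and> distinct_adj (map fst L') \<and> (\<forall>(x, e) \<in> set L'. e \<noteq> 0)"
    if "distinct_adj (x # map fst L)" "\<forall>(x, e) \<in> set L. e \<noteq> 0" for x e and L :: "('x \<times> int) list"
  proof (cases "e = 0")
    case True with that show ?thesis by (intro exI [of _ L]) (auto simp: distinct_adj_Cons)
  next
    case False with that show ?thesis by (intro exI [of _ "(x, e) # L"]) auto
  qed
  {
    case (mult x g)
    then obtain L where L: "g = syllables L" "distinct_adj (map fst L)" "\<forall>(x, e) \<in> set L. e \<noteq> 0" by blast
    show ?case
    proof (cases "distinct_adj (x # map fst L)")
      case True
      with step [OF this L(3), of 1] syllables_step(1) [of x 0 L] L show ?thesis by simp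
    next
      case False
      then obtain e L' where L': "L = (x, e) # L'" using L(2) by (cases L) (auto simp: distinct_adj_Cons)
      with step [of x L' "e + 1"] syllables_step(1) [of x e L'] L show ?thesis by simp
    qed
  next
    case (inv x g)
    then obtain L where L: "g = syllables L" "distinct_adj (map fst L)" "\<forall>(x, e) \<in> set L. e \<noteq> 0" by blast
    show ?case
    proof (cases "distinct_adj (x # map fst L)")
      case True
      with step [OF this L(3), of "-1"] syllables_step(2) [of x 0 L] L show ?thesis by simp
    next
      case False
      then obtain e L' where L': "L = (x, e) # L'" using L(2) by (cases L) (auto simp: distinct_adj_Cons)
      with step [of x L' "e - 1"] syllables_step(2) [of x e L'] L show ?thesis by simp
    qed
  }
qed

lemma magnus_syllable:
  fixes x :: 'x
  assumes "w = [] \<or> hd w \<noteq> x"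
  shows "magnus (syllables ((x, e) # L)) \<phi> w = magnus (syllables L) \<phi> w"
    and "magnus (syllables ((x, e) # L)) \<phi> (x # w)
      = magnus (syllables L) \<phi> (x # w) + e * magnus (syllables L) \<phi> w"
proof -
  define \<psi> where "\<psi> e = magnus (syllables ((x, e) # L)) \<phi>" for e
  have 0: "\<psi> 0 = magnus (syllables L) \<phi>" by (simp add: \<psi>_def)
  have s: "\<psi> (e + 1) = magnus_gen x (\<psi> e)" for e unfolding \<psi>_def syllables_step by simp
  have "\<psi> e w = \<psi> 0 w \<and> \<psi> e (x # w) = \<psi> 0 (x # w) + e * \<psi> 0 w"
  proof (induction e rule: int_induct [of _ 0])
    case (step1 i) then show ?case using assms by (cases w) (auto simp: s distrib_right)
  next
    case (step2 i)
    have "\<psi> i = magnus_gen x (\<psi> (i - 1))" using s [of "i - 1"] by simp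
    with step2 show ?case using assms by (cases w) (auto simp: left_diff_distrib)
  qed simp
  then show "magnus (syllables ((x, e) # L)) \<phi> w = magnus (syllables L) \<phi> w"
    and "magnus (syllables ((x, e) # L)) \<phi> (x # w)
      = magnus (syllables L) \<phi> (x # w) + e * magnus (syllables L) \<phi> w"
    unfolding 0 unfolding \<psi>_def by blast+
qed

text \<open>In the product of the \<open>(1 + x\<^sub>i)\<^bsup>e\<^sub>i\<^esup>\<close>, the coefficient of \<open>x\<^sub>1 \<dots> x\<^sub>n\<close> is \<open>e\<^sub>1 \<cdots> e\<^sub>n\<close>.\<close>

lemma magnus_faithful:
  assumes "\<And>\<phi>. magnus g \<phi> = \<phi>"
  shows "g = 1"
proof -
  define \<delta> :: "'a list \<Rightarrow> int" where "\<delta> w = (if w = [] then 1 else 0)" for w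
  obtain L where L: "g = syllables L" "distinct_adj (map fst L)" "\<forall>(x, e) \<in> set L. e \<noteq> 0"
    using syllables_exist [of g] by (elim exE conjE) (rule that)
  have vanish: "magnus (syllables L) \<delta> w = 0" if "distinct_adj w" "length w > length L" for L w
    using that
  proof (induction L arbitrary: w)
    case Nil then show ?case by (simp add: \<delta>_def)
  next
    case (Cons s L)
    obtain x e where s: "s = (x, e)" by fastforce
    obtain y w' where w: "w = y # w'" using Cons.prems by (cases w) auto
    have w': "distinct_adj w'" "w' = [] \<or> hd w' \<noteq> y" using Cons.prems by (auto simp: w distinct_adj_Cons)
    show ?case
    proof (cases "y = x")
      case True
      then show ?thesis using magnus_syllable(2) [of w' x e L \<delta>] Cons.IH [of w] Cons.IH [of w'] Cons.prems w w' s
        by (simp del: syllables.simps)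
    next
      case False
      then show ?thesis using magnus_syllable(1) [of w x e L \<delta>] Cons.IH [of w] Cons.prems w s
        by (simp del: syllables.simps)
    qed
  qed
  have coeff: "magnus (syllables L) \<delta> (map fst L) = prod_list (map snd L)" if "distinct_adj (map fst L)" for L
    using that
  proof (induction L)
    case Nil then show ?case by (simp add: \<delta>_def)
  next
    case (Cons s L)
    obtain x e where s: "s = (x, e)" by fastforce
    have "map fst L = [] \<or> hd (map fst L) \<noteq> x" "distinct_adj (map fst L)" using Cons.prems by (auto simp: s distinct_adj_Cons)
    then show ?case
      using magnus_syllable(2) [of "map fst L" x e L \<delta>] vanish [of "x # map fst L" L] Cons s
      by (simp del: syllables.simps)
  qed
  have "prod_list (map snd L) \<noteq> 0" using L(3) by (induction L) auto
  then have "\<delta> (map fst L) \<noteq> 0" using coeff [OF L(2)] assms [of \<delta>] L(1) by simp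
  then have "L = []" by (simp add: \<delta>_def split: if_splits)
  then show ?thesis using L(1) by simp
qed

theorem res_tfn_free: "res_tfn (UNIV :: 'x fgrp set)"
proof -
  have sub: "subgrp (magnus_filtration n :: 'x fgrp set)" for n
    by (rule subgrpI) (auto simp: magnus_filtration_mult magnus_filtration_inverse, simp add: magnus_filtration_def order_ge_def)
  have "g = 1" if "\<And>n. g \<in> magnus_filtration n" for g :: "'x fgrp"
  proof (rule magnus_faithful, rule ext)
    fix \<phi> :: "'x list \<Rightarrow> int" and w
    have "order_ge 0 \<phi>" by (simp add: order_ge_def)
    from magnus_filtrationD [OF that [of "length w"] this] show "magnus g \<phi> w = \<phi> w"
      by (auto simp: order_ge_def)
  qed
  then have "(\<Inter>n. magnus_filtration n) = {1 :: 'x fgrp}"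
    by (intro equalityI subsetI) (simp_all add: subgrpD(1) [OF sub])
  moreover have "magnus_filtration (Suc n) \<subseteq> (magnus_filtration n :: 'x fgrp set)" for n
    unfolding magnus_filtration_def by (auto simp: order_ge_def)
  ultimately show ?thesis
    unfolding res_tfn_def
    by (intro exI [of _ magnus_filtration] conjI allI ballI impI)
       (simp_all add: magnus_filtration_0 sub magnus_filtration_commutator, rule magnus_filtration_root)
qed


section \<open>The tree of reduced sequences\<close>

fun lcp :: "'a list \<Rightarrow> 'a list \<Rightarrow> nat"
  where
    "lcp (x # xs) (y # ys) = (if x = y then Suc (lcp xs ys) else 0)"
  | "lcp _ _ = 0"

lemma lcp_Nil [simp]: "lcp [] ys = 0" "lcp xs [] = 0"
  by (cases xs; simp)+

lemma lcp_hd_neq: "hd xs \<noteq> y \<Longrightarrow> lcp xs (y # ys) = 0" "hd xs \<noteq> y \<Longrightarrow> lcp (y # ys) xs = 0"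
  by (cases xs; simp)+

lemma lcp_sym: "lcp xs ys = lcp ys xs"
  by (induction xs ys rule: lcp.induct) auto

lemma lcp_le: "lcp xs ys \<le> length xs" "lcp xs ys \<le> length ys"
  by (induction xs ys rule: lcp.induct) auto

lemma lcp_refl [simp]: "lcp xs xs = length xs"
  by (induction xs) auto

lemma lcp_eq_length: "lcp xs ys = length xs \<Longrightarrow> length xs = length ys \<Longrightarrow> xs = ys"
  by (induction xs ys rule: lcp.induct) (auto split: if_splits)

lemma lcp_ultrametric: "min (lcp xs ys) (lcp ys zs) \<le> lcp xs zs"
proof (induction xs ys arbitrary: zs rule: lcp.induct)
  case (1 x xs y ys) then show ?case by (cases zs) auto
qed auto

lemma lcp_four_point: "min (lcp x z + lcp y w) (lcp x w + lcp y z) \<le> lcp x y + lcp z w"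
  using lcp_ultrametric [of x z y] lcp_ultrametric [of x w y] lcp_ultrametric [of z x w] lcp_ultrametric [of z y w]
    lcp_sym [of z x] lcp_sym [of z y] lcp_sym [of w y]
  by linarith

lemma lcp_take: "lcp (take n xs) ys = min n (lcp xs ys)"
proof (induction xs ys arbitrary: n rule: lcp.induct)
  case (1 x xs y ys) then show ?case by (cases n) auto
qed (auto simp: lcp_sym)

definition list_dist :: "'a list \<Rightarrow> 'a list \<Rightarrow> nat"
  where "list_dist xs ys = length xs + length ys - 2 * lcp xs ys"

lemma list_dist_int: "int (list_dist xs ys) = int (length xs) + int (length ys) - 2 * int (lcp xs ys)"
  using lcp_le [of xs ys] by (simp add: list_dist_def of_nat_diff)

text \<open>Sequences, ordered by the prefix relation, form a rooted tree.\<close>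

lemma int_tree_prefix_closed:
  assumes V: "\<And>xs n. xs \<in> V \<Longrightarrow> take n xs \<in> V"
  shows "int_tree V list_dist"
proof
  fix x y z w :: "'a list"
  show "list_dist x y = 0 \<longleftrightarrow> x = y"
    using list_dist_int [of x y] lcp_le [of x y] lcp_eq_length [of x y] by fastforce
  show "list_dist x y = list_dist y x" by (simp add: list_dist_def lcp_sym)
  show "list_dist x y + list_dist z w \<le> max (list_dist x z + list_dist y w) (list_dist x w + list_dist y z)"
    using lcp_four_point [of x z y w] list_dist_int [of x y] list_dist_int [of z w] list_dist_int [of x z]
      list_dist_int [of y w] list_dist_int [of x w] list_dist_int [of y z]
    by linarith
  have "int (list_dist x y + list_dist y z + list_dist x z)
      = 2 * (int (length x) + int (length y) + int (length z) - int (lcp x y) - int (lcp y z) - int (lcp x z))"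
    by (simp add: list_dist_int)
  then show "even (list_dist x y + list_dist y z + list_dist x z)" by presburger
next
  fix x y i assume x: "x \<in> V" and y: "y \<in> V" and i: "i \<le> list_dist x y"
  note l = lcp_le [of x y]
  show "\<exists>z\<in>V. list_dist x z = i \<and> list_dist z y = list_dist x y - i"
  proof (cases "i \<le> length x - lcp x y")
    case True
    define z where "z = take (length x - i) x"
    have "length z = length x - i" "lcp z x = length x - i" "lcp z y = lcp x y" "i \<le> length x"
      using True l by (auto simp: z_def lcp_take)
    then have "list_dist x z = i \<and> list_dist z y = list_dist x y - i"
      using True l i list_dist_int [of x z] list_dist_int [of z y] list_dist_int [of x y] lcp_sym [of x z]
      by linarith
    then show ?thesis using V [OF x] unfolding z_def by blast
  next
    case False
    define n z where "n = i + 2 * lcp x y - length x" and "z = take n y"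
    have n: "int n = int i + 2 * int (lcp x y) - int (length x)" "n \<le> length y" "lcp x y \<le> n"
      using False l i list_dist_int [of x y] by (simp_all add: n_def)
    then have "length z = n" "lcp z y = n" "lcp z x = lcp x y"
      by (simp_all add: z_def lcp_take lcp_sym [of y x])
    then have "list_dist x z = i \<and> list_dist z y = list_dist x y - i"
      using n l i list_dist_int [of x z] list_dist_int [of z y] list_dist_int [of x y] lcp_sym [of x z]
      by linarith
    then show ?thesis using V [OF y] unfolding z_def by blast
  qed
qed


section \<open>Multiple HNN extensions\<close>

text \<open>The stable letters \<open>e \<in> E\<close> come in pairs of mutually inverse letters \<open>e\<close> and \<open>opp e\<close>, and
  conjugation by \<open>e\<close> is \<open>\<theta> e : A (opp e) \<rightarrow> A e\<close>.\<close>

locale hnn =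
  fixes E :: "'e set" and opp :: "'e \<Rightarrow> 'e" and A :: "'e \<Rightarrow> 'h::grp set" and \<theta> :: "'e \<Rightarrow> 'h \<Rightarrow> 'h"
  assumes opp_in [simp]: "e \<in> E \<Longrightarrow> opp e \<in> E"
    and opp_opp [simp]: "e \<in> E \<Longrightarrow> opp (opp e) = e"
    and opp_neq: "e \<in> E \<Longrightarrow> opp e \<noteq> e"
    and A: "e \<in> E \<Longrightarrow> subgrp (A e)"
    and \<theta>_in [simp]: "e \<in> E \<Longrightarrow> y \<in> A (opp e) \<Longrightarrow> \<theta> e y \<in> A e"
    and \<theta>_mult: "e \<in> E \<Longrightarrow> y \<in> A (opp e) \<Longrightarrow> y' \<in> A (opp e) \<Longrightarrow> \<theta> e (y * y') = \<theta> e y * \<theta> e y'"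
    and \<theta>_inv [simp]: "e \<in> E \<Longrightarrow> y \<in> A (opp e) \<Longrightarrow> \<theta> (opp e) (\<theta> e y) = y"
begin

lemma \<theta>_opp_in [simp]: "e \<in> E \<Longrightarrow> y \<in> A e \<Longrightarrow> \<theta> (opp e) y \<in> A (opp e)"
  using \<theta>_in [of "opp e" y] by simp

lemma \<theta>_one [simp]: "e \<in> E \<Longrightarrow> \<theta> e 1 = 1"
proof -
  assume e: "e \<in> E"
  then have "\<theta> e 1 * \<theta> e 1 = \<theta> e 1 * 1" using \<theta>_mult [of e 1 1] subgrpD(1) [OF A] by simp
  then show ?thesis by (simp only: mult_left_cancel)
qed

text \<open>Representatives of the left cosets of \<open>A e\<close>, with the coset \<open>A e\<close> represented by \<open>1\<close>.\<close>

definition rep :: "'e \<Rightarrow> 'h \<Rightarrow> 'h"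
  where "rep e h = (if h \<in> A e then 1 else SOME r. inverse h * r \<in> A e)"

lemma A_iff:
  assumes "e \<in> E" "a \<in> A e"
  shows "h * a \<in> A e \<longleftrightarrow> h \<in> A e" "a * h \<in> A e \<longleftrightarrow> h \<in> A e"
proof -
  note s = subgrpD [OF A [OF assms(1)]]
  have "h * a * inverse a \<in> A e" if "h * a \<in> A e" by (rule s(2) [OF that s(3) [OF assms(2)]])
  then show "h * a \<in> A e \<longleftrightarrow> h \<in> A e" using s(2) [OF _ assms(2)] by (auto simp: mult.assoc)
  have "inverse a * (a * h) \<in> A e" if "a * h \<in> A e" by (rule s(2) [OF s(3) [OF assms(2)] that])
  then show "a * h \<in> A e \<longleftrightarrow> h \<in> A e" using s(2) [OF assms(2)] by auto
qed

lemma rep_coset: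
  assumes e: "e \<in> E"
  shows "inverse (rep e h) * h \<in> A e"
proof (cases "h \<in> A e")
  case False
  note s = subgrpD [OF A [OF e]]
  have "inverse h * h \<in> A e" using s by simp
  then have "inverse h * (SOME r. inverse h * r \<in> A e) \<in> A e" by (rule someI)
  then have "inverse h * rep e h \<in> A e" using False by (simp add: rep_def)
  from s(3) [OF this] show ?thesis by simp
qed (simp add: rep_def)

lemma rep_mult [simp]:
  assumes e: "e \<in> E" and a: "a \<in> A e"
  shows "rep e (h * a) = rep e h"
proof -
  have "inverse (h * a) * r \<in> A e \<longleftrightarrow> inverse h * r \<in> A e" for r
    using A_iff(2) [OF e subgrpD(3) [OF A [OF e] a], of "inverse h * r"] by (simp add: mult.assoc)
  then show ?thesis using A_iff(1) [OF e a] by (simp add: rep_def)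
qed

lemma rep_rep [simp]: "e \<in> E \<Longrightarrow> rep e (rep e h) = rep e h"
  using rep_mult [OF _ rep_coset, of e "rep e h" h] by simp

lemma rep_eq_1_iff: "e \<in> E \<Longrightarrow> rep e h = 1 \<longleftrightarrow> h \<in> A e"
  using rep_coset [of e h] by (auto simp: rep_def)

text \<open>The relation \<open>h s e = rep e (h s) e (carry e h s)\<close> in the HNN extension: the part of \<open>h s\<close> that lies in
  \<open>A e\<close> is moved through the stable letter \<open>e\<close>.\<close>

definition carry :: "'e \<Rightarrow> 'h \<Rightarrow> 'h \<Rightarrow> 'h"
  where "carry e h s = \<theta> (opp e) (inverse (rep e (h * s)) * (h * s))"

lemma carry_in: "e \<in> E \<Longrightarrow> carry e h s \<in> A (opp e)"
  by (simp add: carry_def rep_coset)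

lemma carry_mult:
  assumes e: "e \<in> E"
  shows "rep e (h * h' * s) = rep e (h * rep e (h' * s))"
    and "carry e (h * h') s = carry e h (rep e (h' * s)) * carry e h' s"
proof -
  define s' a where "s' = rep e (h' * s)" and "a = inverse s' * (h' * s)"
  have a: "a \<in> A e" unfolding a_def s'_def by (rule rep_coset [OF e])
  have hs: "h * h' * s = h * s' * a" by (simp add: a_def mult.assoc)
  show 1: "rep e (h * h' * s) = rep e (h * rep e (h' * s))"
    unfolding hs using e a by (simp add: s'_def)
  have "inverse (rep e (h * h' * s)) * (h * h' * s) = inverse (rep e (h * s')) * (h * s') * a"
    unfolding 1 unfolding hs s'_def by (simp only: mult.assoc)
  then show "carry e (h * h') s = carry e h (rep e (h' * s)) * carry e h' s"
    unfolding carry_def using e a by (simp add: \<theta>_mult rep_coset flip: s'_def a_def)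
qed

text \<open>A reduced sequence \<open>(s\<^sub>1, e\<^sub>1), \<dots>, (s\<^sub>n, e\<^sub>n)\<close> stands for the coset of the base group represented by
  the product \<open>s\<^sub>1 e\<^sub>1 \<dots> s\<^sub>n e\<^sub>n\<close>, and a pair of a reduced sequence and an element of the base group for
  an element of the extension in normal form.  Left multiplication by \<open>h\<close> turns the coset \<open>L\<close> into
  \<open>hv h L\<close> and multiplies the base part by \<open>hc h L\<close>; left multiplication by \<open>e\<close> turns \<open>L\<close> into
  \<open>ev e L\<close>.\<close>

fun red :: "('h \<times> 'e) list \<Rightarrow> bool"
  where
    "red [] = True"
  | "red ((s, e) # L) = (e \<in> E \<and> rep e s = s \<and> red L \<and> (L = [] \<or> hd L \<noteq> (1, opp e)))"

fun hv :: "'h \<Rightarrow> ('h \<times> 'e) list \<Rightarrow> ('h \<times> 'e) list"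
  where
    "hv h [] = []"
  | "hv h ((s, e) # L) = (rep e (h * s), e) # hv (carry e h s) L"

fun hc :: "'h \<Rightarrow> ('h \<times> 'e) list \<Rightarrow> 'h"
  where
    "hc h [] = h"
  | "hc h ((s, e) # L) = hc (carry e h s) L"

definition ev :: "'e \<Rightarrow> ('h \<times> 'e) list \<Rightarrow> ('h \<times> 'e) list"
  where "ev e L = (if L \<noteq> [] \<and> hd L = (1, opp e) then tl L else (1, e) # L)"

lemma hv_head:
  assumes "red L" "e \<in> E" "y \<in> A (opp e)"
  shows "hv y L \<noteq> [] \<and> hd (hv y L) = (1, opp e) \<longleftrightarrow> L \<noteq> [] \<and> hd L = (1, opp e)"
proof (cases L)
  case (Cons l L')
  obtain s f where l: "l = (s, f)" by fastforce
  have "f = opp e \<Longrightarrow> rep f (y * s) = 1 \<longleftrightarrow> s = 1"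
    using assms Cons l A_iff(2) [of "opp e" y s] rep_eq_1_iff [of "opp e"] by (metis opp_in red.simps(2))
  then show ?thesis by (auto simp: Cons l)
qed simp

lemma red_hv: "red L \<Longrightarrow> red (hv h L)"
proof (induction L arbitrary: h rule: red.induct)
  case (2 s e L)
  then show ?case using hv_head [of L e "carry e h s"] carry_in [of e h s] by auto
qed simp

lemma hv_mult: "red L \<Longrightarrow> hv (h * h') L = hv h (hv h' L)"
  and hc_mult: "red L \<Longrightarrow> hc (h * h') L = hc h (hv h' L) * hc h' L"
  by (induction L arbitrary: h h' rule: red.induct) (simp_all add: carry_mult)

lemma hv_one [simp]: "red L \<Longrightarrow> hv 1 L = L"
  and hc_one [simp]: "red L \<Longrightarrow> hc 1 L = 1"
proof -
  have c: "carry e 1 s = 1" if "e \<in> E" "rep e s = s" for e s using that by (simp add: carry_def)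
  show "red L \<Longrightarrow> hv 1 L = L" "red L \<Longrightarrow> hc 1 L = 1"
    by (induction L rule: red.induct) (simp_all add: c)
qed

lemma red_ev: "red L \<Longrightarrow> e \<in> E \<Longrightarrow> red (ev e L)"
  by (cases L) (auto simp: ev_def rep_eq_1_iff subgrpD(1) [OF A])

lemma ev_opp: "red L \<Longrightarrow> e \<in> E \<Longrightarrow> ev (opp e) (ev e L) = L"
  by (cases L) (auto simp: ev_def)

lemma ev_hv:
  assumes L: "red L" and e: "e \<in> E" and y: "y \<in> A (opp e)"
  shows "ev e (hv y L) = hv (\<theta> e y) (ev e L)" and "hc (\<theta> e y) (ev e L) = hc y L"
proof -
  have "ev e (hv y L) = hv (\<theta> e y) (ev e L) \<and> hc (\<theta> e y) (ev e L) = hc y L"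
  proof (cases "L \<noteq> [] \<and> hd L = (1, opp e)")
    case True
    then obtain L' where L': "L = (1, opp e) # L'" by (cases L) auto
    have "rep (opp e) y = 1" using e y by (simp add: rep_eq_1_iff)
    then show ?thesis using e y by (simp add: L' ev_def carry_def)
  next
    case False
    have "rep e (\<theta> e y) = 1" using e y by (simp add: rep_eq_1_iff)
    then show ?thesis using False hv_head [OF L e y] e y by (auto simp: ev_def carry_def)
  qed
  then show "ev e (hv y L) = hv (\<theta> e y) (ev e L)" "hc (\<theta> e y) (ev e L) = hc y L" by blast+
qed

definition \<Omega> :: "(('h \<times> 'e) list \<times> 'h) set"
  where "\<Omega> = {(L, h). red L}"

definition hsym :: "'h \<Rightarrow> (('h \<times> 'e) list \<times> 'h) sym"
  where "hsym h = perm_on \<Omega> (\<lambda>(L, k). (hv h L, hc h L * k))"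

definition esym :: "'e \<Rightarrow> (('h \<times> 'e) list \<times> 'h) sym"
  where "esym e = perm_on \<Omega> (\<lambda>(L, k). (ev e L, k))"

lemma app_hsym: "app (hsym h) (L, k) = (if red L then (hv h L, hc h L * k) else (L, k))"
proof -
  have inv: "hv (inverse g) (hv g L) = L" "hc (inverse g) (hv g L) * (hc g L * k) = k" if "red L" for g L k
    using that by (simp_all flip: hv_mult hc_mult mult.assoc)
  have "app (hsym h) (L, k) = (if (L, k) \<in> \<Omega> then (\<lambda>(L, k). (hv h L, hc h L * k)) (L, k) else (L, k))"
    unfolding hsym_def
    by (rule app_perm_on [of _ _ "\<lambda>(L, k). (hv (inverse h) L, hc (inverse h) L * k)"])
       (use inv [where g = h] inv [where g = "inverse h"] in \<open>auto simp: \<Omega>_def red_hv\<close>)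
  then show ?thesis by (simp add: \<Omega>_def)
qed

lemma app_esym:
  assumes e: "e \<in> E"
  shows "app (esym e) (L, k) = (if red L then (ev e L, k) else (L, k))"
proof -
  have "app (esym e) (L, k) = (if (L, k) \<in> \<Omega> then (\<lambda>(L, k). (ev e L, k)) (L, k) else (L, k))"
    unfolding esym_def
    by (rule app_perm_on [of _ _ "\<lambda>(L, k). (ev (opp e) L, k)"])
       (use e ev_opp [of _ e] ev_opp [of _ "opp e"] in \<open>auto simp: \<Omega>_def red_ev\<close>)
  then show ?thesis by (simp add: \<Omega>_def)
qed

lemma hsym_mult: "hsym (h * h') = hsym h * hsym h'"
  by (rule sym_eqI) (auto simp: app_hsym hv_mult hc_mult red_hv mult.assoc)

lemma hsym_one [simp]: "hsym 1 = 1"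
  by (rule sym_eqI) (auto simp: app_hsym)

lemma esym_opp: "e \<in> E \<Longrightarrow> esym e * esym (opp e) = 1"
  using ev_opp [of _ "opp e"] by (intro sym_eqI) (auto simp: app_esym red_ev)

lemma esym_hsym: "e \<in> E \<Longrightarrow> y \<in> A (opp e) \<Longrightarrow> esym e * hsym y = hsym (\<theta> e y) * esym e"
  by (rule sym_eqI) (auto simp: app_hsym app_esym red_ev red_hv ev_hv)

text \<open>Reading a normal form as a product in any group that satisfies the relations of the HNN
  extension.\<close>

fun nf_val :: "('h \<Rightarrow> 'k::grp) \<Rightarrow> ('e \<Rightarrow> 'k) \<Rightarrow> ('h \<times> 'e) list \<Rightarrow> 'h \<Rightarrow> 'k"
  where
    "nf_val H T [] k = H k"
  | "nf_val H T ((s, e) # L) k = H s * T e * nf_val H T L k"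

context
  fixes H :: "'h \<Rightarrow> 'k::grp" and T :: "'e \<Rightarrow> 'k"
  assumes H_mult: "\<And>h h'. H (h * h') = H h * H h'"
    and T_opp: "\<And>e. e \<in> E \<Longrightarrow> T e * T (opp e) = 1"
    and T_H: "\<And>e y. e \<in> E \<Longrightarrow> y \<in> A (opp e) \<Longrightarrow> T e * H y = H (\<theta> e y) * T e"
begin

lemma nf_val_hv: "red L \<Longrightarrow> nf_val H T (hv h L) (hc h L * k) = H h * nf_val H T L k"
proof (induction L arbitrary: h rule: red.induct)
  case (2 s e L)
  then have e: "e \<in> E" by simp
  have c: "inverse (rep e (h * s)) * (h * s) \<in> A e" by (rule rep_coset [OF e])
  have "\<theta> e (carry e h s) = inverse (rep e (h * s)) * (h * s)"
    using e c \<theta>_inv [of "opp e"] by (simp add: carry_def)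
  then have "T e * H (carry e h s) = H (inverse (rep e (h * s)) * (h * s)) * T e"
    using T_H [OF e carry_in [OF e]] by simp
  moreover have "H (rep e (h * s)) * H (inverse (rep e (h * s)) * (h * s)) = H h * H s"
    by (simp flip: H_mult)
  ultimately have "H (rep e (h * s)) * T e * H (carry e h s) = H h * H s * T e"
    by (metis mult.assoc)
  with 2 show ?case by (simp flip: mult.assoc)
qed (simp add: H_mult)

lemma nf_val_ev: "e \<in> E \<Longrightarrow> nf_val H T (ev e L) k = T e * nf_val H T L k"
proof (cases "L \<noteq> [] \<and> hd L = (1, opp e)")
  case True
  assume e: "e \<in> E"
  have "H 1 * H 1 = H 1 * 1" by (simp flip: H_mult)
  then have "H 1 = 1" by (simp only: mult_left_cancel)
  moreover obtain L' where "L = (1, opp e) # L'" using True by (cases L) auto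
  ultimately show ?thesis using T_opp [OF e] by (simp add: ev_def flip: mult.assoc)
next
  case False
  have "H 1 * H 1 = H 1 * 1" by (simp flip: H_mult)
  then have "H 1 = 1" by (simp only: mult_left_cancel)
  with False show ?thesis by (auto simp: ev_def)
qed

end

text \<open>The HNN extension itself, as a group of permutations of the normal forms.\<close>

inductive_set ext :: "(('h \<times> 'e) list \<times> 'h) sym set"
  where
    ext_one: "1 \<in> ext"
  | ext_h: "f \<in> ext \<Longrightarrow> hsym h * f \<in> ext"
  | ext_e: "f \<in> ext \<Longrightarrow> e \<in> E \<Longrightarrow> esym e * f \<in> ext"

lemma hsym_ext [simp]: "hsym h \<in> ext" and esym_ext [simp]: "e \<in> E \<Longrightarrow> esym e \<in> ext"
  using ext_h [OF ext_one] ext_e [OF ext_one] by simp_all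

lemma subgrp_ext: "subgrp ext"
proof -
  have mult: "f \<in> ext \<Longrightarrow> g \<in> ext \<Longrightarrow> f * g \<in> ext" for f g
    by (induction rule: ext.induct) (simp_all add: mult.assoc ext.intros)
  have "f \<in> ext \<Longrightarrow> inverse f \<in> ext" for f
  proof (induction rule: ext.induct)
    case (ext_h f h)
    have "inverse (hsym h) = hsym (inverse h)" by (rule inverse_unique) (simp flip: hsym_mult)
    with ext_h show ?case by (simp add: mult)
  next
    case (ext_e f e)
    have "inverse (esym e) = esym (opp e)" using ext_e by (intro inverse_unique esym_opp)
    with ext_e show ?case by (simp add: mult)
  qed (simp add: ext.intros)
  then show ?thesis by (intro subgrpI mult ext.intros)
qed

definition vact :: "(('h \<times> 'e) list \<times> 'h) sym \<Rightarrow> ('h \<times> 'e) list \<Rightarrow> ('h \<times> 'e) list"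
  where "vact f L = fst (app f (L, 1))"

lemma app_ext: "f \<in> ext \<Longrightarrow> red L \<Longrightarrow> red (vact f L) \<and> (\<exists>c. \<forall>k. app f (L, k) = (vact f L, c * k))"
proof (induction rule: ext.induct)
  case ext_one then show ?case by (auto simp: vact_def intro: exI [of _ 1])
next
  case (ext_h f h)
  then obtain c where c: "\<And>k. app f (L, k) = (vact f L, c * k)" and r: "red (vact f L)" by blast
  have v: "vact (hsym h * f) L = hv h (vact f L)"
    unfolding vact_def [of "hsym h * f"] app_mult c using r by (simp add: app_hsym)
  show ?case
    unfolding v using r c by (auto simp: red_hv app_hsym mult.assoc intro!: exI [of _ "hc h (vact f L) * c"])
next
  case (ext_e f e)
  then obtain c where c: "\<And>k. app f (L, k) = (vact f L, c * k)" and r: "red (vact f L)" by blast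
  have v: "vact (esym e * f) L = ev e (vact f L)"
    unfolding vact_def [of "esym e * f"] app_mult c using r ext_e by (simp add: app_esym)
  show ?case
    unfolding v using r c ext_e by (auto simp: red_ev app_esym intro!: exI [of _ c])
qed

lemma vact_mult: "f \<in> ext \<Longrightarrow> g \<in> ext \<Longrightarrow> red L \<Longrightarrow> vact (f * g) L = vact f (vact g L)"
proof -
  assume f: "f \<in> ext" and g: "g \<in> ext" and L: "red L"
  obtain c where c: "red (vact g L)" "\<And>k. app g (L, k) = (vact g L, c * k)" using app_ext [OF g L] by blast
  obtain c' where c': "\<And>k. app f (vact g L, k) = (vact f (vact g L), c' * k)" using app_ext [OF f c(1)] by blast
  show ?thesis unfolding vact_def [of "f * g"] app_mult c c' by simp
qed

lemma vact_hsym: "red L \<Longrightarrow> vact (hsym h) L = hv h L"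
  and vact_esym: "red L \<Longrightarrow> e \<in> E \<Longrightarrow> vact (esym e) L = ev e L"
  by (simp_all add: vact_def app_hsym app_esym)

lemma ext_induct [consumes 1, case_names one hsym esym]:
  assumes "f \<in> ext" "P 1" "\<And>f h. f \<in> ext \<Longrightarrow> P f \<Longrightarrow> P (hsym h * f)"
    "\<And>f e. f \<in> ext \<Longrightarrow> e \<in> E \<Longrightarrow> P f \<Longrightarrow> P (esym e * f)"
  shows "P f"
  using assms(1) by (induction rule: ext.induct) (use assms(2-) in auto)

lemma length_hv [simp]: "length (hv h L) = length L"
  by (induction L arbitrary: h rule: red.induct) auto

text \<open>Left multiplication by an element of the base group maps branches of the tree to branches: it maps
  distinct cosets of \<open>A e\<close> to distinct cosets.\<close>

lemma lcp_hv: "red L \<Longrightarrow> red L' \<Longrightarrow> lcp (hv h L) (hv h L') = lcp L L'"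
proof (induction L L' arbitrary: h rule: lcp.induct)
  case (1 x L y L')
  obtain s e t f where x: "x = (s, e)" and y: "y = (t, f)" by fastforce
  have "s = t" if "e = f" "rep e (h * s) = rep e (h * t)"
  proof -
    have e: "e \<in> E" "rep e s = s" "rep e t = t" using 1 x y that by auto
    define a b where "a = inverse (rep e (h * s)) * (h * s)" and "b = inverse (rep e (h * s)) * (h * t)"
    have "a \<in> A e" "b \<in> A e" using rep_coset [OF e(1), of "h * s"] rep_coset [OF e(1), of "h * t"] that
      by (simp_all add: a_def b_def)
    then have "inverse a * b \<in> A e" using subgrpD [OF A [OF e(1)]] by blast
    moreover have "inverse a * b = inverse s * t" by (simp add: a_def b_def mult.assoc)
    ultimately have "rep e (s * (inverse s * t)) = rep e s" using rep_mult [OF e(1)] by metis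
    then show ?thesis using e by simp
  qed
  then show ?case using 1 by (auto simp: x y)
qed auto

lemma dist_vact: "f \<in> ext \<Longrightarrow> red L \<Longrightarrow> red L' \<Longrightarrow> list_dist (vact f L) (vact f L') = list_dist L L'"
proof (induction f rule: ext_induct)
  case one then show ?case by (simp add: vact_def)
next
  case (hsym f h)
  then have r: "red (vact f L)" "red (vact f L')" using app_ext by blast+
  have "list_dist (hv h K) (hv h K') = list_dist K K'" if "red K" "red K'" for K K'
    using that by (simp add: list_dist_def lcp_hv)
  with hsym r show ?case by (simp add: vact_mult vact_hsym)
next
  case (esym f e)
  then have r: "red (vact f L)" "red (vact f L')" using app_ext by blast+
  have "list_dist (ev e K) (ev e K') = list_dist K K'" if "red K" "red K'" for K K'
    using that esym(2) by (cases K; cases K') (auto simp: list_dist_def ev_def lcp_hd_neq)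
  with esym r show ?case by (simp add: vact_mult vact_esym)
qed

text \<open>The oriented edges of the tree are labelled by \<open>E\<close>, and the action preserves the labels.  As
  \<open>opp e \<noteq> e\<close>, no edge is inverted.\<close>

definition adj :: "'e \<Rightarrow> ('h \<times> 'e) list \<Rightarrow> ('h \<times> 'e) list \<Rightarrow> bool"
  where "adj e L L' \<longleftrightarrow> (\<exists>s. L' = L @ [(s, e)]) \<or> (\<exists>s. L = L' @ [(s, opp e)])"

lemma hv_append: "\<exists>t. hv h (L @ [(s, e)]) = hv h L @ [(t, e)]"
  by (induction L arbitrary: h rule: red.induct) auto

lemma ev_append: "L \<noteq> [] \<Longrightarrow> ev f (L @ [x]) = ev f L @ [x]"
  by (cases L) (auto simp: ev_def)

lemma adj_ev_append:
  assumes "f \<in> E" "e \<in> E"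
  shows "adj e (ev f L) (ev f (L @ [(s, e)]))" "adj (opp e) (ev f (L @ [(s, e)])) (ev f L)"
  using assms ev_append [of L f "(s, e)"] by (cases "L = []"; auto simp: adj_def ev_def)+

lemma adj_vact: "f \<in> ext \<Longrightarrow> e \<in> E \<Longrightarrow> red L \<Longrightarrow> red L' \<Longrightarrow> adj e L L' \<Longrightarrow> adj e (vact f L) (vact f L')"
proof (induction f rule: ext_induct)
  case one then show ?case by (simp add: vact_def)
next
  case (hsym f h)
  then have r: "red (vact f L)" "red (vact f L')" using app_ext by blast+
  have "adj e (hv h K) (hv h K')" if "adj e K K'" for K K'
    using that hv_append [of h] unfolding adj_def by metis
  with hsym r show ?case by (simp add: vact_mult vact_hsym)
next
  case (esym f g)
  then have r: "red (vact f L)" "red (vact f L')" using app_ext by blast+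
  have "adj e (ev g K) (ev g K')" if "adj e K K'" for K K'
    using that adj_ev_append [of g e K] adj_ev_append [of g "opp e" K'] esym unfolding adj_def [of e K]
    by auto
  with esym r show ?case by (simp add: vact_mult vact_esym)
qed

lemma red_append: "red (L @ K) \<Longrightarrow> red L"
proof (induction L rule: red.induct)
  case (2 s e L) then show ?case by (cases L) auto
qed simp

lemma red_take: "red L \<Longrightarrow> red (take n L)"
  using red_append [of "take n L" "drop n L"] by simp

lemma red_append_in: "red (L @ [(s, e)]) \<Longrightarrow> e \<in> E"
  by (induction L rule: red.induct) auto

lemma adj_if_dist_1:
  assumes "red L" "red L'" "list_dist L L' = 1"
  obtains e where "e \<in> E" "adj e L L'"
proof -
  have *: "\<exists>x. K' = K @ [x]" if "list_dist K K' = 1" "length K < length K'" for K K' :: "('h \<times> 'e) list"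
  proof -
    have "lcp K K' = length K" "length K' = Suc (length K)"
      using that(2) list_dist_int [of K K'] lcp_le(1) [of K K'] unfolding that(1) by linarith+
    then have "take (length K) K' = K" "length (drop (length K) K') = 1"
      using lcp_take [of "length K" K' K] lcp_eq_length [of "take (length K) K'" K] by (simp_all add: lcp_sym)
    then show ?thesis by (metis append_take_drop_id length_0_conv length_Suc_conv One_nat_def)
  qed
  have "length L \<noteq> length L'" using assms(3) list_dist_int [of L L'] by presburger
  then consider "length L < length L'" | "length L' < length L" by linarith
  then show ?thesis
  proof cases
    case 1
    then obtain s e where "L' = L @ [(s, e)]" using * [OF assms(3)] by (metis surj_pair)
    then show ?thesis using that [of e] red_append_in assms by (auto simp: adj_def)
  next
    case 2
    then obtain s e where L: "L = L' @ [(s, e)]"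
      using * [of L' L] assms(3) by (metis surj_pair list_dist_def lcp_sym add.commute)
    then have "e \<in> E" using red_append_in assms by blast
    then show ?thesis using that [of "opp e"] L by (auto simp: adj_def)
  qed
qed

sublocale tree_action "{L. red L}" list_dist ext vact
proof (intro tree_action.intro tree_action_axioms.intro)
  show "int_tree {L. red L} list_dist"
    by (rule int_tree_prefix_closed) (simp add: red_take)
  show "subgrp ext" by (rule subgrp_ext)
  fix g x assume g: "g \<in> ext" and "x \<in> {L. red L}"
  then have x: "red x" by simp
  show "vact g x \<in> {L. red L}" using app_ext [OF g x] by simp
  show "vact (g * h) x = vact g (vact h x)" if "h \<in> ext" for h by (rule vact_mult [OF g that x])
  show "list_dist (vact g x) (vact g y) = list_dist x y" if "y \<in> {L. red L}" for y
    using dist_vact [OF g x] that by simp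
  show "vact g (vact g x) \<noteq> x" if 1: "list_dist x (vact g x) = 1"
  proof
    assume fl: "vact g (vact g x) = x"
    have gx: "red (vact g x)" using app_ext [OF g x] by blast
    obtain e where e: "e \<in> E" "adj e x (vact g x)" by (rule adj_if_dist_1 [OF x gx 1])
    with adj_vact [OF g e(1) x gx] fl have "adj e (vact g x) x" by simp
    with e opp_neq [OF e(1)] show False
      by (auto simp: adj_def) (metis append1_eq_conv prod.inject)
  qed
next
  fix x show "vact 1 x = x" by (simp add: vact_def)
qed

text \<open>The action is the left regular one, so an element is determined by the normal form to which it maps
  the trivial normal form.\<close>

lemma nf_val_app:
  assumes "f \<in> ext" "red L"
  shows "(\<lambda>(L, k). nf_val hsym esym L k) (app f (L, k)) = f * nf_val hsym esym L k"
  using assms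
proof (induction f rule: ext_induct)
  case (hsym f h)
  then obtain c where "app f (L, k) = (vact f L, c * k)" "red (vact f L)" using app_ext by blast
  with hsym show ?case by (simp add: app_hsym nf_val_hv hsym_mult esym_opp esym_hsym mult.assoc)
next
  case (esym f e)
  then obtain c where "app f (L, k) = (vact f L, c * k)" "red (vact f L)" using app_ext by blast
  with esym show ?case by (simp add: app_esym nf_val_ev hsym_mult esym_opp esym_hsym mult.assoc)
qed simp

lemma nf_val_ext: "red L \<Longrightarrow> nf_val hsym esym L k \<in> ext"
  by (induction L rule: red.induct) (auto simp: mult.assoc intro: ext.intros)

lemma app_nf_val: "red L \<Longrightarrow> app (nf_val hsym esym L k) ([], 1) = (L, k)"
proof (induction L rule: red.induct)
  case (2 s e L)
  then have "ev e L = (1, e) # L" by (auto simp: ev_def)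
  moreover have "carry e s 1 = 1" using 2 by (simp add: carry_def)
  moreover have "red ((1, e) # L)" using 2 subgrpD(1) [OF A] by (simp add: rep_eq_1_iff)
  ultimately show ?case using 2 by (simp add: app_hsym app_esym)
qed (simp add: app_hsym)

text \<open>If \<open>g\<close> maps the root to \<open>L\<close>, then \<open>f \<mapsto> g\<^sup>-\<^sup>1 f g\<close> maps the stabilizer of \<open>L\<close> to that of the root, whose
  elements multiply the base part of \<open>([], k)\<close> by a constant.\<close>

lemma res_tfn_stab:
  assumes tfn: "res_tfn (UNIV :: 'h set)" and L: "red L"
  shows "res_tfn (stab L)"
proof -
  define g where "g = nf_val hsym esym L 1"
  have g: "g \<in> ext" "app g ([], 1) = (L, 1)" unfolding g_def using L by (simp_all add: nf_val_ext app_nf_val)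
  define \<kappa> where "\<kappa> f = snd (app (inverse g * f * g) ([], 1))" for f
  note cl = subgrpD [OF subgrp_ext]
  have vg: "vact g [] = L" "vact (inverse g) L = []"
    by (simp_all add: vact_def g(2) app_inverse_eq [OF g(2)])
  have root: "app (inverse g * f * g) ([], k) = ([], \<kappa> f * k)" if "f \<in> stab L" for f k
  proof -
    have f: "f \<in> ext" "vact f L = L" using that by (simp_all add: stab_def)
    have "vact (inverse g * f * g) [] = []"
      using f g(1) vg L by (simp add: vact_mult cl)
    moreover obtain c where "\<And>k. app (inverse g * f * g) ([], k) = (vact (inverse g * f * g) [], c * k)"
      using app_ext [of "inverse g * f * g" "[]"] f g cl by auto
    ultimately show ?thesis unfolding \<kappa>_def by simp
  qed
  have L': "L \<in> {L. red L}" using L by simp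
  show ?thesis
  proof (rule res_tfn_inj [OF subgrp_stab [OF L'] _ _ tfn])
    show "hom_on (stab L) \<kappa>"
      unfolding hom_on_def
    proof (intro ballI)
      fix f f' assume f: "f \<in> stab L" "f' \<in> stab L"
      have "inverse g * (f * f') * g = (inverse g * f * g) * (inverse g * f' * g)" by (simp add: mult.assoc)
      then have "app (inverse g * (f * f') * g) ([], 1) = ([], \<kappa> f * \<kappa> f')"
        using root [OF f(1)] root [OF f(2), of 1] by (simp only: app_mult) simp
      then show "\<kappa> (f * f') = \<kappa> f * \<kappa> f'" by (simp add: \<kappa>_def)
    qed
    fix f assume f: "f \<in> stab L" "\<kappa> f = 1"
    have "inverse g * f * g \<in> ext" using f g cl by (simp add: stab_def)
    from nf_val_app [OF this, of "[]" 1] root [OF f(1), of 1] f(2)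
    have "inverse g * f * g = 1" by simp
    then have "f * g = g" by (metis mult.assoc mult_1_right mult_inverse_assoc)
    then show "f = 1" by (metis mult_1_left mult_right_cancel)
  qed simp
qed

end


section \<open>Presented groups\<close>

lemma word_class_eq_iff:
  "u \<in> words_on S \<Longrightarrow> v \<in> words_on S \<Longrightarrow> word_class S R u = word_class S R v \<longleftrightarrow> (u, v) \<in> word_eq S R"
  unfolding word_class_def by (rule eq_equiv_class_iff [OF equiv_word_eq])

lemma word_class_refl: "u \<in> words_on S \<Longrightarrow> u \<in> word_class S R u"
  by (simp add: word_class_def word_eq.refl)

lemma in_word_class: "v \<in> word_class S R u \<longleftrightarrow> (u, v) \<in> word_eq S R"
  by (simp add: word_class_def)

lemma presented_group_carrier: "carrier (presented_group S R) = word_class S R ` words_on S"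
  by (auto simp: presented_group_def quotient_def word_class_def)

lemma presented_group_one: "\<one>\<^bsub>presented_group S R\<^esub> = word_class S R []"
  by (simp add: presented_group_def)

lemma word_class_cong: "(u, v) \<in> word_eq S R \<Longrightarrow> word_class S R u = word_class S R v"
  by (meson word_class_eq_iff word_eq_words_on)

lemma presented_group_mult:
  assumes u: "u \<in> words_on S" and v: "v \<in> words_on S"
  shows "word_class S R u \<otimes>\<^bsub>presented_group S R\<^esub> word_class S R v = word_class S R (u @ v)"
proof -
  have eq: "word_class S R (u' @ v') = word_class S R (u @ v)"
    if "u' \<in> word_class S R u" "v' \<in> word_class S R v" for u' v'
    using that by (intro word_class_cong [symmetric] word_eq_append) (simp_all add: in_word_class)
  have "(\<Union>u'\<in>word_class S R u. \<Union>v'\<in>word_class S R v. word_class S R (u' @ v')) = word_class S R (u @ v)"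
  proof (intro equalityI UN_least)
    fix u' v' assume "u' \<in> word_class S R u" "v' \<in> word_class S R v"
    then show "word_class S R (u' @ v') \<subseteq> word_class S R (u @ v)" by (simp add: eq)
  qed (use word_class_refl u v in blast)
  then show ?thesis by (simp add: presented_group_def)
qed

lemma word_class_inverse:
  assumes "w \<in> words_on S"
  shows "word_class S R (inv_word w @ w) = word_class S R []" "word_class S R (w @ inv_word w) = word_class S R []"
  using assms by (simp_all add: word_class_eq_iff cancel_word)

lemma group_presented_group: "group (presented_group S R)"
proof (rule groupI)
  fix x assume "x \<in> carrier (presented_group S R)"
  then obtain w where "x = word_class S R w" "w \<in> words_on S" by (auto simp: presented_group_carrier)
  then show "\<exists>y\<in>carrier (presented_group S R). y \<otimes>\<^bsub>presented_group S R\<^esub> x = \<one>\<^bsub>presented_group S R\<^esub>"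
    by (intro bexI [of _ "word_class S R (inv_word w)"])
       (simp_all add: presented_group_carrier presented_group_mult presented_group_one word_class_inverse)
qed (auto simp: presented_group_carrier presented_group_mult presented_group_one)

text \<open>The value of an element of a presented group, under an assignment of values to the generators
  that satisfies the relations.\<close>

definition class_val :: "('a \<Rightarrow> 'g::grp) \<Rightarrow> 'a word set \<Rightarrow> 'g"
  where "class_val f K = weval f (SOME w. w \<in> K)"

lemma class_val:
  assumes "satisfies S R f" "w \<in> words_on S"
  shows "class_val f (word_class S R w) = weval f w"
proof -
  have "(SOME w'. w' \<in> word_class S R w) \<in> word_class S R w"
    by (rule someI, rule word_class_refl [OF assms(2)])
  then show ?thesis
    unfolding class_val_def using weval_cong_word_eq [OF _ assms(1)] by (simp add: in_word_class)
qed

lemma class_val_mult: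
  assumes f: "satisfies S R f" and K: "K \<in> carrier (presented_group S R)" "K' \<in> carrier (presented_group S R)"
  shows "class_val f (K \<otimes>\<^bsub>presented_group S R\<^esub> K') = class_val f K * class_val f K'"
  using K by (auto simp: presented_group_carrier presented_group_mult class_val [OF f])


lemma multiplicative_class:
  fixes \<phi> :: "'a word set \<Rightarrow> 'g::grp"
  assumes mult: "\<And>K K'. K \<in> carrier (presented_group S R) \<Longrightarrow> K' \<in> carrier (presented_group S R) \<Longrightarrow>
      \<phi> (K \<otimes>\<^bsub>presented_group S R\<^esub> K') = \<phi> K * \<phi> K'"
    and w: "w \<in> words_on S"
  shows "\<phi> (word_class S R w) = weval (\<lambda>s. \<phi> (word_class S R [(s, True)])) w"
proof -
  have app: "\<phi> (word_class S R (u @ w)) = \<phi> (word_class S R u) * \<phi> (word_class S R w)"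
    if "u \<in> words_on S" "w \<in> words_on S" for u w
    using mult [of "word_class S R u" "word_class S R w"] that
    by (simp add: presented_group_carrier presented_group_mult)
  have "\<phi> (word_class S R []) * \<phi> (word_class S R []) = \<phi> (word_class S R []) * 1"
    using app [of "[]" "[]"] by simp
  then have one: "\<phi> (word_class S R []) = 1" by (simp only: mult_left_cancel)
  have inv: "\<phi> (word_class S R [(s, False)]) = inverse (\<phi> (word_class S R [(s, True)]))" if "s \<in> S" for s
  proof -
    have "\<phi> (word_class S R [(s, True), (s, False)]) = 1"
      using that word_class_inverse(2) [of "[(s, True)]" S R] one by (simp add: inv_word_def)
    then have "\<phi> (word_class S R [(s, True)]) * \<phi> (word_class S R [(s, False)]) = 1"
      using app [of "[(s, True)]" "[(s, False)]"] that by simp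
    then show ?thesis by (simp add: inverse_unique)
  qed
  show ?thesis
    using w
  proof (induction w)
    case (Cons l w)
    obtain s p where l: "l = (s, p)" by fastforce
    have "\<phi> (word_class S R (l # w)) = \<phi> (word_class S R [l]) * \<phi> (word_class S R w)"
      using app [of "[l]" w] Cons.prems by simp
    with Cons show ?case using inv [of s] by (cases p) (simp_all add: l)
  qed (simp add: one)
qed

lemma weval_cong: "(\<And>s. s \<in> S \<Longrightarrow> f s = g s) \<Longrightarrow> w \<in> words_on S \<Longrightarrow> weval f w = weval g w"
  by (induction w) (simp_all add: weval_Cons letter_val_def)


section \<open>Fundamental groups of graphs of free groups\<close>

text \<open>The path group of a graph of free groups is a multiple HNN extension of a single free group:
  the base is the free product of the vertex groups, which is free on the disjoint union of their bases.\<close>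

locale free_graph_of_groups = graph_of_groups Y
  for Y :: "('v, 'e, 'g, 'h) graph_of_groups" +
  fixes X :: "'v \<Rightarrow> 'g set" and j :: "'v \<Rightarrow> 'g \<Rightarrow> 'g word set"
  assumes j: "v \<in> verts Y \<Longrightarrow> j v \<in> iso (vgroup Y v) (free_group (X v))"
begin

text \<open>The vertex group of \<open>v\<close> is embedded in the base by \<open>\<iota> v\<close>, and the edge group of \<open>e\<close> by \<open>\<epsilon> e\<close>, through the
  vertex group of its source.  So conjugation by \<open>e\<close> maps \<open>\<epsilon> (opp e) x\<close> to \<open>\<epsilon> e x\<close>.\<close>

definition \<iota> :: "'v \<Rightarrow> 'g \<Rightarrow> ('v \<times> 'g) fgrp"
  where "\<iota> v g = class_val (\<lambda>x. fg (v, x)) (j v g)"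

lemma j_word:
  assumes "v \<in> verts Y" "g \<in> carrier (vgroup Y v)"
  obtains w where "w \<in> words_on (X v)" "j v g = word_class (X v) {} w" "\<iota> v g = weval (\<lambda>x. fg (v, x)) w"
proof -
  have "j v g \<in> carrier (free_group (X v))" using j [OF assms(1)] assms(2) by (auto simp: iso_def hom_def)
  then obtain w where w: "w \<in> words_on (X v)" "j v g = word_class (X v) {} w"
    by (auto simp: free_group_def presented_group_carrier)
  then show ?thesis using that class_val [of "X v" "{}" "\<lambda>x. fg (v, x)" w] by (simp add: \<iota>_def)
qed

lemma \<iota>_mult:
  assumes v: "v \<in> verts Y" and g: "g \<in> carrier (vgroup Y v)" and h: "h \<in> carrier (vgroup Y v)"
  shows "\<iota> v (g \<otimes>\<^bsub>vgroup Y v\<^esub> h) = \<iota> v g * \<iota> v h"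
proof -
  have "j v (g \<otimes>\<^bsub>vgroup Y v\<^esub> h) = j v g \<otimes>\<^bsub>free_group (X v)\<^esub> j v h"
    and "j v g \<in> carrier (free_group (X v))" "j v h \<in> carrier (free_group (X v))"
    using j [OF v] g h by (auto simp: iso_def hom_def)
  then show ?thesis by (simp add: \<iota>_def free_group_def class_val_mult)
qed

lemma \<iota>_inj:
  assumes v: "v \<in> verts Y" and g: "g \<in> carrier (vgroup Y v)" and h: "h \<in> carrier (vgroup Y v)"
    and eq: "\<iota> v g = \<iota> v h"
  shows "g = h"
proof -
  obtain w where w: "w \<in> words_on (X v)" "j v g = word_class (X v) {} w" "\<iota> v g = weval (\<lambda>x. fg (v, x)) w"
    by (rule j_word [OF v g])
  obtain w' where w': "w' \<in> words_on (X v)" "j v h = word_class (X v) {} w'" "\<iota> v h = weval (\<lambda>x. fg (v, x)) w'"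
    by (rule j_word [OF v h])
  have "(w, w') \<in> word_eq (X v) {}"
  proof (rule word_eq_if_weval_eq [OF w(1) w'(1)])
    fix f :: "'g \<Rightarrow> 'g word set sym"
    have "fg_eval (\<lambda>(v, x). f x) (\<iota> v g) = fg_eval (\<lambda>(v, x). f x) (\<iota> v h)" by (simp only: eq)
    then show "weval f w = weval f w'" unfolding w(3) w'(3) fg_eval_weval by simp
  qed
  then have "j v g = j v h" using w w' by (simp add: word_class_eq_iff)
  then show ?thesis using j [OF v] g h by (auto simp: iso_def bij_betw_def dest: inj_onD)
qed

lemma emb_in: "e \<in> edges Y \<Longrightarrow> x \<in> carrier (egroup Y e) \<Longrightarrow> emb Y e x \<in> carrier (vgroup Y (src Y e))"
  using emb_mon [of e] by (auto simp: mon_def hom_def)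

definition \<epsilon> :: "'e \<Rightarrow> 'h \<Rightarrow> ('v \<times> 'g) fgrp"
  where "\<epsilon> e x = \<iota> (src Y e) (emb Y e x)"

lemma \<epsilon>_mult:
  assumes e: "e \<in> edges Y" and x: "x \<in> carrier (egroup Y e)" "y \<in> carrier (egroup Y e)"
  shows "\<epsilon> e (x \<otimes>\<^bsub>egroup Y e\<^esub> y) = \<epsilon> e x * \<epsilon> e y"
proof -
  have "emb Y e (x \<otimes>\<^bsub>egroup Y e\<^esub> y) = emb Y e x \<otimes>\<^bsub>vgroup Y (src Y e)\<^esub> emb Y e y"
    using emb_mon [OF e] x by (auto simp: mon_def hom_def)
  then show ?thesis by (simp add: \<epsilon>_def \<iota>_mult src_in e emb_in x)
qed

lemma \<epsilon>_inj:
  assumes e: "e \<in> edges Y" and x: "x \<in> carrier (egroup Y e)" "y \<in> carrier (egroup Y e)" and eq: "\<epsilon> e x = \<epsilon> e y"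
  shows "x = y"
proof -
  have "emb Y e x = emb Y e y"
    by (rule \<iota>_inj [OF src_in [OF e] emb_in [OF e x(1)] emb_in [OF e x(2)]]) (use eq in \<open>simp add: \<epsilon>_def\<close>)
  then show ?thesis using emb_mon [OF e] x by (auto simp: mon_def dest: inj_onD)
qed

definition stable :: "'e \<Rightarrow> ('v \<times> 'g) fgrp \<Rightarrow> ('v \<times> 'g) fgrp"
  where "stable e y = \<epsilon> e (SOME x. x \<in> carrier (egroup Y e) \<and> \<epsilon> (opp Y e) x = y)"

lemma stable_\<epsilon>: "e \<in> edges Y \<Longrightarrow> x \<in> carrier (egroup Y e) \<Longrightarrow> stable e (\<epsilon> (opp Y e) x) = \<epsilon> e x"
  unfolding stable_def
  by (rule arg_cong [of _ _ "\<epsilon> e"], rule some_equality)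
     (use \<epsilon>_inj [of "opp Y e"] in \<open>auto simp: opp_in egroup_opp\<close>)

sublocale base: hnn "edges Y" "opp Y" "\<lambda>e. \<epsilon> e ` carrier (egroup Y e)" stable
proof
  fix e assume e: "e \<in> edges Y"
  note ee = e opp_in [OF e]
  show "opp Y e \<in> edges Y" "opp Y (opp Y e) = e" "opp Y e \<noteq> e" using e by (rule opp_in opp_opp opp_neq)+
  interpret eg: group "egroup Y e" by (rule group_egroup [OF e])
  show "subgrp (\<epsilon> e ` carrier (egroup Y e))"
  proof (rule subgrpI)
    have "\<epsilon> e \<one>\<^bsub>egroup Y e\<^esub> * \<epsilon> e \<one>\<^bsub>egroup Y e\<^esub> = \<epsilon> e \<one>\<^bsub>egroup Y e\<^esub> * 1"
      using \<epsilon>_mult [OF e, of "\<one>\<^bsub>egroup Y e\<^esub>" "\<one>\<^bsub>egroup Y e\<^esub>"] by simp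
    then have one: "\<epsilon> e \<one>\<^bsub>egroup Y e\<^esub> = 1" by (simp only: mult_left_cancel)
    then show "1 \<in> \<epsilon> e ` carrier (egroup Y e)" by (metis eg.one_closed imageI)
    fix a assume "a \<in> \<epsilon> e ` carrier (egroup Y e)"
    then obtain x where x: "a = \<epsilon> e x" "x \<in> carrier (egroup Y e)" by blast
    have "a * \<epsilon> e (inv\<^bsub>egroup Y e\<^esub> x) = 1" using \<epsilon>_mult [OF e x(2), of "inv\<^bsub>egroup Y e\<^esub> x"] x one by simp
    then have "inverse a = \<epsilon> e (inv\<^bsub>egroup Y e\<^esub> x)" by (rule inverse_unique)
    then show "inverse a \<in> \<epsilon> e ` carrier (egroup Y e)" using x by simp
    fix b assume "b \<in> \<epsilon> e ` carrier (egroup Y e)"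
    then obtain y where y: "b = \<epsilon> e y" "y \<in> carrier (egroup Y e)" by blast
    have "a * b = \<epsilon> e (x \<otimes>\<^bsub>egroup Y e\<^esub> y)" by (simp add: \<epsilon>_mult e x y)
    then show "a * b \<in> \<epsilon> e ` carrier (egroup Y e)" using x y by simp
  qed
  fix y assume "y \<in> \<epsilon> (opp Y e) ` carrier (egroup Y (opp Y e))"
  then obtain x where x: "x \<in> carrier (egroup Y e)" "y = \<epsilon> (opp Y e) x" by (auto simp: egroup_opp e)
  show "stable e y \<in> \<epsilon> e ` carrier (egroup Y e)" by (simp add: x stable_\<epsilon> e)
  show "stable (opp Y e) (stable e y) = y"
    using stable_\<epsilon> [OF ee(2), of x] x by (simp add: stable_\<epsilon> e opp_opp egroup_opp)
  fix y' assume "y' \<in> \<epsilon> (opp Y e) ` carrier (egroup Y (opp Y e))"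
  then obtain x' where x': "x' \<in> carrier (egroup Y e)" "y' = \<epsilon> (opp Y e) x'" by (auto simp: egroup_opp e)
  have "y * y' = \<epsilon> (opp Y e) (x \<otimes>\<^bsub>egroup Y e\<^esub> x')"
    using \<epsilon>_mult [OF ee(2), of x x'] x x' by (simp add: egroup_opp e)
  then show "stable e (y * y') = stable e y * stable e y'"
    using x x' by (simp add: stable_\<epsilon> e \<epsilon>_mult)
qed

primrec letter_perm :: "('v, 'e, 'g) path_letter \<Rightarrow> ((('v \<times> 'g) fgrp \<times> 'e) list \<times> ('v \<times> 'g) fgrp) sym"
  where
    "letter_perm (Vert v g) = base.hsym (\<iota> v g)"
  | "letter_perm (Edge e) = base.esym e"

lemma satisfies_letter_perm: "satisfies (path_gens Y) (path_rels Y) letter_perm"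
proof -
  have "base.esym (opp Y e) = inverse (base.esym e)" if "e \<in> edges Y" for e
    using base.esym_opp [OF that] by (simp add: inverse_unique)
  moreover have "base.esym e * (base.hsym (\<iota> (tgt Y e) (emb Y (opp Y e) x)) * inverse (base.esym e))
      = base.hsym (\<iota> (src Y e) (emb Y e x))" if e: "e \<in> edges Y" and x: "x \<in> carrier (egroup Y e)" for e x
  proof -
    have "base.esym e * base.hsym (\<epsilon> (opp Y e) x) = base.hsym (\<epsilon> e x) * base.esym e"
      using base.esym_hsym [OF e, of "\<epsilon> (opp Y e) x"] e x by (simp add: egroup_opp stable_\<epsilon>)
    then show ?thesis by (simp add: \<epsilon>_def tgt_def flip: mult.assoc) (simp add: mult.assoc)
  qed
  ultimately show ?thesis
    unfolding satisfies_def path_rels_def by (auto simp: base.hsym_mult \<iota>_mult)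
qed

lemma path_gens_iff [simp]:
  "Vert v g \<in> path_gens Y \<longleftrightarrow> v \<in> verts Y \<and> g \<in> carrier (vgroup Y v)" "Edge e \<in> path_gens Y \<longleftrightarrow> e \<in> edges Y"
  by (auto simp: path_gens_def)

context
  fixes f :: "('v, 'e, 'g) path_letter \<Rightarrow> 'k::grp"
  assumes f: "satisfies (path_gens Y) (path_rels Y) f"
begin

lemma f_Vert:
  assumes "v \<in> verts Y" "g \<in> carrier (vgroup Y v)" "h \<in> carrier (vgroup Y v)"
  shows "f (Vert v (g \<otimes>\<^bsub>vgroup Y v\<^esub> h)) = f (Vert v g) * f (Vert v h)"
proof -
  interpret group "vgroup Y v" by (rule group_vgroup [OF assms(1)])
  have "(pos [Vert v g, Vert v h], pos [Vert v (g \<otimes>\<^bsub>vgroup Y v\<^esub> h)]) \<in> path_rels Y"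
    unfolding path_rels_def using assms by blast
  then show ?thesis using f assms unfolding satisfies_def by fastforce
qed

lemma f_opp: "e \<in> edges Y \<Longrightarrow> f (Edge (opp Y e)) = inverse (f (Edge e))"
proof -
  assume e: "e \<in> edges Y"
  then have "([(Edge (opp Y e), True)], [(Edge e, False)]) \<in> path_rels Y" unfolding path_rels_def by blast
  then show ?thesis using f e opp_in [OF e] unfolding satisfies_def by fastforce
qed

lemma f_Edge:
  assumes e: "e \<in> edges Y" and x: "x \<in> carrier (egroup Y e)"
  shows "f (Edge e) * f (Vert (tgt Y e) (emb Y (opp Y e) x)) = f (Vert (src Y e) (emb Y e x)) * f (Edge e)"
proof -
  have "([(Edge e, True), (Vert (tgt Y e) (emb Y (opp Y e) x), True), (Edge e, False)],
      [(Vert (src Y e) (emb Y e x), True)]) \<in> path_rels Y"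
    unfolding path_rels_def using assms by blast
  moreover have "emb Y (opp Y e) x \<in> carrier (vgroup Y (tgt Y e))" "tgt Y e \<in> verts Y"
    using e x emb_in [of "opp Y e" x] by (simp_all add: tgt_def opp_in egroup_opp src_in)
  ultimately have "f (Edge e) * (f (Vert (tgt Y e) (emb Y (opp Y e) x)) * inverse (f (Edge e)))
      = f (Vert (src Y e) (emb Y e x))"
    using f e x src_in [OF e] emb_in [OF e x] unfolding satisfies_def by fastforce
  then show ?thesis by (simp flip: mult.assoc) (metis inverse_mult mult.assoc mult_1_right)
qed

text \<open>The homomorphism on the base that extends \<open>f\<close>; it exists because the base is free on the union of the
  bases of the vertex groups.\<close>

definition basis_val :: "('v \<times> 'g) fgrp \<Rightarrow> 'k"
  where "basis_val = fg_eval (\<lambda>(v, x). f (Vert v (inv_into (carrier (vgroup Y v)) (j v) (word_class (X v) {} [(x, True)]))))"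

lemma basis_val_\<iota>:
  assumes v: "v \<in> verts Y" and g: "g \<in> carrier (vgroup Y v)"
  shows "basis_val (\<iota> v g) = f (Vert v g)"
proof -
  let ?G = "vgroup Y v" and ?F = "presented_group (X v) {}"
  define k where "k = inv_into (carrier ?G) (j v)"
  have jv: "j v \<in> iso ?G ?F" using j [OF v] by (simp add: free_group_def)
  then have "k \<in> iso ?F ?G"
    unfolding k_def by (rule group.iso_set_sym [OF group_vgroup [OF v]])
  then have k: "k K \<in> carrier ?G" "k (K \<otimes>\<^bsub>?F\<^esub> K') = k K \<otimes>\<^bsub>?G\<^esub> k K'"
    if "K \<in> carrier ?F" "K' \<in> carrier ?F" for K K'
    using that by (auto simp: iso_def hom_def)
  define \<phi> where "\<phi> K = f (Vert v (k K))" for K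
  obtain w where w: "w \<in> words_on (X v)" "j v g = word_class (X v) {} w" "\<iota> v g = weval (\<lambda>x. fg (v, x)) w"
    by (rule j_word [OF v g])
  have "basis_val (\<iota> v g) = weval (\<lambda>x. \<phi> (word_class (X v) {} [(x, True)])) w"
    unfolding w(3) basis_val_def fg_eval_weval by (simp add: \<phi>_def k_def)
  also have "\<dots> = \<phi> (word_class (X v) {} w)"
    by (rule multiplicative_class [OF _ w(1), symmetric]) (simp add: \<phi>_def k f_Vert v)
  also have "k (word_class (X v) {} w) = g"
    using jv g by (simp add: k_def w(2) [symmetric] iso_def bij_betw_def)
  then have "\<phi> (word_class (X v) {} w) = f (Vert v g)" by (simp add: \<phi>_def)
  finally show ?thesis .
qed

text \<open>Every assignment \<open>f\<close> that satisfies the relations of the path group factors through the action on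
  normal forms, by reading a normal form as a product of values of \<open>f\<close>.\<close>

lemma nf_val_letters:
  assumes "w \<in> words_on (path_gens Y)" "base.red L"
  shows "(\<lambda>(L, k). base.nf_val basis_val (\<lambda>e. f (Edge e)) L k) (app (weval letter_perm w) (L, k))
    = weval f w * base.nf_val basis_val (\<lambda>e. f (Edge e)) L k"
proof -
  let ?N = "base.nf_val basis_val (\<lambda>e. f (Edge e))"
  have H: "basis_val (h * h') = basis_val h * basis_val h'" for h h' by (simp add: basis_val_def)
  have T: "f (Edge e) * f (Edge (opp Y e)) = 1" if "e \<in> edges Y" for e by (simp add: f_opp that)
  have TH: "f (Edge e) * basis_val y = basis_val (stable e y) * f (Edge e)"
    if e: "e \<in> edges Y" and y: "y \<in> \<epsilon> (opp Y e) ` carrier (egroup Y (opp Y e))" for e y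
  proof -
    obtain x where x: "x \<in> carrier (egroup Y e)" "y = \<epsilon> (opp Y e) x" using y by (auto simp: egroup_opp e)
    have "emb Y (opp Y e) x \<in> carrier (vgroup Y (tgt Y e))" "tgt Y e \<in> verts Y"
      using e x emb_in [of "opp Y e" x] by (simp_all add: tgt_def opp_in egroup_opp src_in)
    then have "basis_val y = f (Vert (tgt Y e) (emb Y (opp Y e) x))"
      using basis_val_\<iota> by (simp add: x(2) \<epsilon>_def tgt_def)
    moreover have "stable e y = \<epsilon> e x" using e x by (simp add: stable_\<epsilon>)
    then have "basis_val (stable e y) = f (Vert (src Y e) (emb Y e x))"
      using e x by (simp add: \<epsilon>_def basis_val_\<iota> src_in emb_in)
    ultimately show ?thesis using f_Edge [OF e x(1)] by simp
  qed
  note hv = base.nf_val_hv [of basis_val "\<lambda>e. f (Edge e)", OF H T TH]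
  note ev = base.nf_val_ev [of basis_val "\<lambda>e. f (Edge e)", OF H T TH]
  have inv: "basis_val (inverse h) = inverse (basis_val h)" for h by (simp add: basis_val_def)
  have hinv: "inverse (base.hsym h) = base.hsym (inverse h)" for h
    by (rule inverse_unique) (simp flip: base.hsym_mult)
  have einv: "inverse (base.esym e) = base.esym (opp Y e)" if "e \<in> edges Y" for e
    by (rule inverse_unique) (rule base.esym_opp [OF that])
  have step: "base.red (fst (app (letter_val letter_perm l) (L, k))) \<and>
      (\<lambda>(L, k). ?N L k) (app (letter_val letter_perm l) (L, k)) = letter_val f l * ?N L k"
    if "fst l \<in> path_gens Y" "base.red L" for l L k
  proof -
    obtain s p where l: "l = (s, p)" by fastforce
    show ?thesis
    proof (cases s)
      case (Vert v g)
      then show ?thesis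
        using that by (cases p) (simp_all add: l base.app_hsym base.red_hv hv hinv inv basis_val_\<iota>)
    next
      case (Edge e)
      then show ?thesis
        using that by (cases p) (simp_all add: l base.app_esym base.red_ev ev einv f_opp opp_in)
    qed
  qed
  have "base.red (fst (app (weval letter_perm w) (L, k))) \<and>
      (\<lambda>(L, k). ?N L k) (app (weval letter_perm w) (L, k)) = weval f w * ?N L k"
    using assms(1)
  proof (induction w)
    case (Cons l w)
    obtain L' k' where e: "app (weval letter_perm w) (L, k) = (L', k')" by fastforce
    with Cons step [of l L' k'] show ?case by (simp add: weval_Cons mult.assoc)
  qed (simp add: assms(2))
  then show ?thesis by blast
qed

end

lemma letter_perm_faithful:
  assumes u: "u \<in> words_on (path_gens Y)" and w: "w \<in> words_on (path_gens Y)"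
    and eq: "weval letter_perm u = weval letter_perm w"
  shows "(u, w) \<in> word_eq (path_gens Y) (path_rels Y)"
proof (rule word_eq_if_weval_eq [OF u w])
  fix f :: "('v, 'e, 'g) path_letter \<Rightarrow> ('v, 'e, 'g) path_letter word set sym"
  assume f: "satisfies (path_gens Y) (path_rels Y) f"
  have "basis_val f 1 = 1" by (simp add: basis_val_def [OF f])
  then show "weval f u = weval f w"
    using nf_val_letters [OF f u, of "[]" 1] nf_val_letters [OF f w, of "[]" 1] eq by simp
qed

lemma weval_letter_perm_ext:
  assumes "w \<in> words_on (path_gens Y)"
  shows "weval letter_perm w \<in> base.ext"
  using assms
proof (induction w)
  case (Cons l w)
  have "letter_val letter_perm l \<in> base.ext"
  proof (cases "fst l")
    case (Vert v g) then show ?thesis by (simp add: letter_val_def subgrpD [OF base.subgrp_ext])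
  next
    case (Edge e) then show ?thesis using Cons.prems by (simp add: letter_val_def subgrpD [OF base.subgrp_ext])
  qed
  with Cons show ?case by (simp add: weval_Cons subgrpD [OF base.subgrp_ext])
qed (simp add: subgrpD [OF base.subgrp_ext])

end


section \<open>A reflection representation\<close>

definition refl_in :: "'v::real_inner \<Rightarrow> 'v \<Rightarrow> 'v"
  where "refl_in n p = p - (2 * inner p n) *\<^sub>R n"

lemma inner_refl_in: "inner (refl_in n p) q = inner p (refl_in n q)"
  by (simp add: refl_in_def inner_diff_left inner_diff_right inner_commute)

lemma refl_in_involution [simp]: "inner n n = 1 \<Longrightarrow> refl_in n (refl_in n p) = p"
  by (simp add: refl_in_def inner_diff_left algebra_simps)

lemma refl_in_conj: "inner n n = 1 \<Longrightarrow> refl_in n (refl_in m (refl_in n p)) = refl_in (refl_in n m) p"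
proof -
  assume n: "inner n n = 1"
  have lin: "refl_in n (x - r *\<^sub>R y) = refl_in n x - r *\<^sub>R refl_in n y" for x y r
    by (simp add: refl_in_def inner_diff_left algebra_simps)
  have "refl_in n (refl_in m (refl_in n p)) = refl_in n (refl_in n p - (2 * inner (refl_in n p) m) *\<^sub>R m)"
    by (simp add: refl_in_def [of m])
  also have "\<dots> = p - (2 * inner p (refl_in n m)) *\<^sub>R refl_in n m"
    unfolding lin inner_refl_in by (simp add: n)
  finally show ?thesis by (simp add: refl_in_def [of "refl_in n m"])
qed

lemma refl_in_braid:
  assumes "inner n n = 1" "inner m m = 1" and c: "4 * (inner n m)\<^sup>2 = 1"
  shows "refl_in n (refl_in m (refl_in n p)) = refl_in m (refl_in n (refl_in m p))"
proof -
  define r where "r = 2 * inner n m"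
  have r: "r * r = 1" using c by (simp add: r_def power2_eq_square)
  have e1: "refl_in m n = n - r *\<^sub>R m" and e2: "refl_in n m = m - r *\<^sub>R n"
    by (simp_all add: refl_in_def r_def inner_commute)
  have "(- r) *\<^sub>R refl_in n m = (r * r) *\<^sub>R n - r *\<^sub>R m"
    unfolding e2 by (simp add: scaleR_diff_right)
  then have e: "refl_in m n = (- r) *\<^sub>R refl_in n m" unfolding e1 r by simp
  have "refl_in ((- r) *\<^sub>R q) p = refl_in q p" for q
  proof -
    have "(2 * inner p ((- r) *\<^sub>R q)) *\<^sub>R ((- r) *\<^sub>R q) = (r * r) *\<^sub>R ((2 * inner p q) *\<^sub>R q)"
      by (simp add: mult_ac)
    then show ?thesis by (simp add: refl_in_def r)
  qed
  then show ?thesis using assms by (simp add: refl_in_conj e)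
qed

lemma refl_in_commute:
  assumes "inner n n = 1" "inner n m = 0"
  shows "refl_in n (refl_in m p) = refl_in m (refl_in n p)"
proof -
  have "refl_in n m = m" using assms by (simp add: refl_in_def inner_commute)
  then show ?thesis using refl_in_conj [OF assms(1), of m "refl_in n p"] assms(1) by simp
qed

definition refl_sym :: "'v::real_inner \<Rightarrow> 'v sym"
  where "refl_sym n = Sym (refl_in n)"

lemma app_refl_sym: "inner n n = 1 \<Longrightarrow> app (refl_sym n) p = refl_in n p"
  unfolding refl_sym_def by (rule app_Sym, rule o_bij [of "refl_in n"]) (auto simp: fun_eq_iff)

text \<open>Reflections in three-dimensional Euclidean space satisfy the Artin relations if the planes meet at suitable
  angles.  For the dihedral group \<open>\<langle>a, c\<rangle>\<close>, which acts on the factor \<open>\<complex>\<close>, every multiple of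
  \<open>\<pi> / (2 k + 1)\<close> is suitable; with \<open>k \<pi> / (2 k + 1)\<close> the Gram matrix of the normal vectors is positive
  definite for every \<open>k\<close>.\<close>

lemma odd_artin_generators_distinct:
  assumes k: "k \<ge> 1"
  obtains a b c :: "(complex \<times> real) sym"
  where "a * b = b * a" "b * c * b = c * b * c" "(c * a) ^ k * c = (a * c) ^ k * a" "a \<noteq> b"
proof -
  define t where "t = real k * pi / real (2 * k + 1)"
  define \<zeta> where "\<zeta> = cis t"
  have t: "pi / 6 < t" "t \<le> pi / 2" using k by (simp_all add: t_def field_simps)
  have sin: "1 / 2 < sin t" using sin_monotone_2pi [of "pi / 6" t] t pi_gt_zero by (simp add: sin_30)
  define s where "s = 1 / (2 * sin t)"
  have s: "0 < s" "s < 1" "s * sin t = 1 / 2" using sin by (simp_all add: s_def field_simps)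
  define r where "r = sqrt (1 - s\<^sup>2)"
  have "s\<^sup>2 < 1" using s by (simp add: power_less_one_iff)
  then have r: "0 < r" "r * r = 1 - s * s" by (simp_all add: r_def power2_eq_square)
  define na nb nc :: "complex \<times> real" where "na = (\<i>, 0)" and "nb = (of_real s, r)" and "nc = (\<i> * \<zeta>, 0)"
  have sc: "sin t * sin t + cos t * cos t = 1" using sin_cos_squared_add [of t] by (simp add: power2_eq_square)
  have norms: "inner na na = 1" "inner nb nb = 1" "inner nc nc = 1"
    using r sc by (simp_all add: na_def nb_def nc_def inner_complex_def \<zeta>_def)
  have prods: "inner na nb = 0" "inner nb nc = - (1 / 2)"
    using s(3) by (simp_all add: na_def nb_def nc_def inner_complex_def \<zeta>_def)
  have ra: "refl_in na (w, x) = (cnj w, x)" for w x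
    by (simp add: refl_in_def na_def inner_complex_def complex_eq_iff)
  have rc: "refl_in nc (w, x) = (\<zeta>\<^sup>2 * cnj w, x)" for w x
    using sc by (simp add: refl_in_def nc_def inner_complex_def complex_eq_iff \<zeta>_def power2_eq_square) algebra
  let ?a = "refl_sym na" and ?b = "refl_sym nb" and ?c = "refl_sym nc"
  have 1: "?a * ?b = ?b * ?a"
    by (rule sym_eqI) (simp add: app_refl_sym norms refl_in_commute [OF norms(1) prods(1)])
  have 2: "?b * ?c * ?b = ?c * ?b * ?c"
    by (rule sym_eqI) (simp add: app_refl_sym norms refl_in_braid [OF norms(2,3)] prods power2_eq_square)
  have ca: "app ((?c * ?a) ^ n) (w, x) = ((\<zeta>\<^sup>2) ^ n * w, x)" for n w x
    by (induction n) (simp_all add: app_refl_sym norms ra rc)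
  have ac: "app ((?a * ?c) ^ n) (w, x) = ((cnj (\<zeta>\<^sup>2)) ^ n * w, x)" for n w x
    by (induction n) (simp_all add: app_refl_sym norms ra rc)
  have "\<zeta> ^ (2 * (2 * k + 1)) = cis (2 * pi * real k)"
    unfolding \<zeta>_def DeMoivre by (rule arg_cong [of _ _ cis]) (simp add: t_def field_simps)
  then have root: "\<zeta> ^ (2 * (2 * k + 1)) = 1" by (simp add: cis_multiple_2pi)
  have unit: "\<zeta>\<^sup>2 * cnj (\<zeta>\<^sup>2) = 1"
    using complex_norm_square [of "\<zeta>\<^sup>2"] by (simp add: \<zeta>_def norm_power)
  have "(\<zeta>\<^sup>2) ^ k * \<zeta>\<^sup>2 = cnj (\<zeta>\<^sup>2) ^ k"
  proof -
    have "(\<zeta>\<^sup>2) ^ k * \<zeta>\<^sup>2 = (\<zeta>\<^sup>2) ^ (k + 1) * (\<zeta>\<^sup>2 * cnj (\<zeta>\<^sup>2)) ^ k" unfolding unit by simp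
    also have "\<dots> = (\<zeta>\<^sup>2) ^ (2 * k + 1) * cnj (\<zeta>\<^sup>2) ^ k"
      unfolding power_mult_distrib by (simp add: power_add mult_2)
    also have "(\<zeta>\<^sup>2) ^ (2 * k + 1) = 1" using root by (simp only: power_mult)
    finally show ?thesis by simp
  qed
  then have 3: "(?c * ?a) ^ k * ?c = (?a * ?c) ^ k * ?a"
    by (intro sym_eqI) (auto simp: ca ac app_refl_sym norms ra rc simp flip: mult.assoc)
  have "?a \<noteq> ?b"
  proof
    assume "?a = ?b"
    then have "app ?a (0, 1) = app ?b (0, 1)" by simp
    then have "refl_in na (0, 1) = refl_in nb (0, 1)" by (simp only: app_refl_sym norms)
    then show False using s r by (simp add: ra) (simp add: refl_in_def nb_def)
  qed
  with 1 2 3 show ?thesis by (rule that)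
qed


section \<open>Odd triangle Artin groups do not split\<close>

lemma prod_list_alternating:
  fixes g :: "'a \<Rightarrow> 'k::monoid_mult"
  shows "prod_list (map g (alternating x y (2 * n))) = (g x * g y) ^ n"
    and "prod_list (map g (alternating x y (2 * n + 1))) = (g x * g y) ^ n * g x"
proof -
  show "prod_list (map g (alternating x y (2 * n))) = (g x * g y) ^ n"
    by (induction n) (simp_all add: mult.assoc)
  show "prod_list (map g (alternating x y (2 * n + 1))) = (g x * g y) ^ n * g x"
    by (induction n) (simp_all add: mult.assoc)
qed

lemma weval_pos: "weval f (pos xs) = prod_list (map f xs)"
  by (induction xs) simp_all

lemma weval_concat: "weval f (concat ws) = prod_list (map (weval f) ws)"
  by (induction ws) simp_all

abbreviation artin_rels :: "nat \<Rightarrow> nat \<Rightarrow> nat \<Rightarrow> (artin_gen word \<times> artin_gen word) set"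
  where "artin_rels M N P \<equiv>
    {(pos (alternating Gen_a Gen_b M), pos (alternating Gen_b Gen_a M)),
     (pos (alternating Gen_b Gen_c N), pos (alternating Gen_c Gen_b N)),
     (pos (alternating Gen_c Gen_a P), pos (alternating Gen_a Gen_c P))}"

lemma artin_gens: "{Gen_a, Gen_b, Gen_c} = UNIV"
  by (auto intro: artin_gen.exhaust)

lemma alternating_2_3: "alternating x y 2 = [x, y]" "alternating x y 3 = [x, y, x]"
  by (simp_all add: eval_nat_numeral)

lemma gog_path_gens:
  assumes "graph_of_groups Y" "gog_path Y u v p"
  shows "set p \<subseteq> path_gens Y"
  using assms(2)
proof (induction rule: gog_path.induct)
  case (start g) then show ?case by (auto simp: path_gens_def)
next
  case (step e p g)
  interpret graph_of_groups Y by (rule assms(1))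
  from step show ?case by (auto simp: path_gens_def tgt_def src_in opp_in)
qed

text \<open>The images of the generators \<open>a\<close> and \<open>b\<close> in the path group act on its tree, hence coincide by
  \<open>odd_artin_tree_action\<close>.  As the path group acts faithfully on normal forms, \<open>a\<close> and \<open>b\<close> coincide in
  the fundamental group and thus in the Artin group, where reflections tell them apart.\<close>

theorem odd_artin_not_graph_of_free_groups:
  fixes Y :: "('v, 'e, 'g, 'h) graph_of_groups"
  assumes k: "k \<ge> 1" and Y: "graph_of_groups Y"
    and free: "\<And>v. v \<in> verts Y \<Longrightarrow> is_free_group (vgroup Y v)"
  shows "\<not> triangle_artin 2 3 (2 * k + 1) \<cong> fundamental_group Y v\<^sub>0"
proof
  define R where "R = artin_rels 2 3 (2 * k + 1)"
  define cl where "cl = word_class {Gen_a, Gen_b, Gen_c} R"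
  assume "triangle_artin 2 3 (2 * k + 1) \<cong> fundamental_group Y v\<^sub>0"
  then obtain \<Phi> where \<Phi>: "\<Phi> \<in> iso (presented_group {Gen_a, Gen_b, Gen_c} R) (fundamental_group Y v\<^sub>0)"
    by (auto simp: is_iso_def triangle_artin_def R_def)
  have "\<exists>(X :: 'g set) j. v \<in> verts Y \<longrightarrow> j \<in> iso (vgroup Y v) (free_group X)" for v
    using free [of v] unfolding is_free_group_def is_iso_def by blast
  then obtain X :: "'v \<Rightarrow> 'g set" and j where Xj: "\<And>v. v \<in> verts Y \<Longrightarrow> j v \<in> iso (vgroup Y v) (free_group (X v))"
    by metis
  interpret graph_of_groups Y by (rule Y)
  interpret free_graph_of_groups Y X j by unfold_locales (rule Xj)
  define pc where "pc = word_class (path_gens Y) (path_rels Y)"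
  have "\<exists>p. \<Phi> (cl [(s, True)]) = pc (pos p) \<and> set p \<subseteq> path_gens Y" for s
  proof -
    have "cl [(s, True)] \<in> carrier (presented_group {Gen_a, Gen_b, Gen_c} R)"
      by (auto simp: presented_group_carrier cl_def artin_gens)
    then have "\<Phi> (cl [(s, True)]) \<in> path_elems Y v\<^sub>0 v\<^sub>0"
      using \<Phi> by (auto simp: iso_def hom_def fundamental_group_def)
    then obtain p where "\<Phi> (cl [(s, True)]) = pc (pos p)" "gog_path Y v\<^sub>0 v\<^sub>0 p"
      by (auto simp: path_elems_def path_class_def pc_def)
    then show ?thesis using gog_path_gens [OF Y] by blast
  qed
  then obtain p where p: "\<And>s. \<Phi> (cl [(s, True)]) = pc (pos (p s))" "\<And>s. set (p s) \<subseteq> path_gens Y"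
    by metis
  \<comment> \<open>words for the generators in the path group\<close>
  define P where "P s = pos (p s)" for s
  have P: "P s \<in> words_on (path_gens Y)" for s using p(2) by (simp add: P_def)
  have \<Phi>_pos: "\<Phi> (cl (pos (s # xs))) = pc (concat (map P (s # xs)))" for s xs
  proof (induction xs arbitrary: s)
    case Nil then show ?case by (simp add: p P_def)
  next
    case (Cons s' xs)
    have in1: "[(s, True)] \<in> words_on {Gen_a, Gen_b, Gen_c}" "pos (s' # xs) \<in> words_on {Gen_a, Gen_b, Gen_c}"
      by (auto simp: artin_gens)
    have in2: "concat (map P (s' # xs)) \<in> words_on (path_gens Y)"
    proof -
      have "concat (map P ys) \<in> words_on (path_gens Y)" for ys by (induction ys) (simp_all add: P)
      then show ?thesis .
    qed
    have "cl (pos (s # s' # xs)) = cl [(s, True)] \<otimes>\<^bsub>presented_group {Gen_a, Gen_b, Gen_c} R\<^esub> cl (pos (s' # xs))"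
      unfolding cl_def presented_group_mult [OF in1] by simp
    moreover have "cl [(s, True)] \<in> carrier (presented_group {Gen_a, Gen_b, Gen_c} R)"
      "cl (pos (s' # xs)) \<in> carrier (presented_group {Gen_a, Gen_b, Gen_c} R)"
      unfolding cl_def presented_group_carrier using in1 by blast+
    ultimately have "\<Phi> (cl (pos (s # s' # xs))) = \<Phi> (cl [(s, True)]) \<otimes>\<^bsub>fundamental_group Y v\<^sub>0\<^esub> \<Phi> (cl (pos (s' # xs)))"
      using \<Phi> by (simp add: iso_def hom_def)
    also have "\<dots> = pc (P s) \<otimes>\<^bsub>path_group Y\<^esub> pc (concat (map P (s' # xs)))"
      unfolding Cons p by (simp add: fundamental_group_def P_def)
    also have "\<dots> = pc (P s @ concat (map P (s' # xs)))"
      unfolding pc_def path_group_def by (rule presented_group_mult [OF P in2])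
    finally show ?case by simp
  qed
  define g where "g s = weval letter_perm (P s)" for s
  have rel: "prod_list (map g (s # xs)) = prod_list (map g (t # ys))"
    if "(pos (s # xs), pos (t # ys)) \<in> R" for s xs t ys
  proof -
    have "(pos (s # xs), pos (t # ys)) \<in> word_eq {Gen_a, Gen_b, Gen_c} R"
      using that by (rule word_eq.relation) (simp_all add: artin_gens)
    then have "cl (pos (s # xs)) = cl (pos (t # ys))" unfolding cl_def by (rule word_class_cong)
    then have "pc (concat (map P (s # xs))) = pc (concat (map P (t # ys)))" using \<Phi>_pos by metis
    moreover have "concat (map P ys) \<in> words_on (path_gens Y)" for ys by (induction ys) (simp_all add: P)
    ultimately have "(concat (map P (s # xs)), concat (map P (t # ys))) \<in> word_eq (path_gens Y) (path_rels Y)"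
      unfolding pc_def by (subst (asm) word_class_eq_iff)
    then have "weval letter_perm (concat (map P (s # xs))) = weval letter_perm (concat (map P (t # ys)))"
      by (rule weval_cong_word_eq [OF _ satisfies_letter_perm])
    then show ?thesis unfolding weval_concat map_map comp_def g_def .
  qed
  have "g Gen_a = g Gen_b"
  proof (rule base.odd_artin_tree_action [of "g Gen_a" "g Gen_b" "g Gen_c" k])
    show "{L. base.red L} \<noteq> {}" using base.red.simps(1) by blast
    show "x \<in> {L. base.red L} \<Longrightarrow> res_tfn (base.stab x)" for x
      using base.res_tfn_stab [OF res_tfn_free] by simp
    show "g Gen_a \<in> base.ext" "g Gen_b \<in> base.ext" "g Gen_c \<in> base.ext"
      unfolding g_def by (rule weval_letter_perm_ext [OF P])+
    show "k \<ge> 1" by (rule k)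
    show "g Gen_a * g Gen_b = g Gen_b * g Gen_a"
      using rel [of Gen_a "[Gen_b]" Gen_b "[Gen_a]"] by (simp add: R_def alternating_2_3)
    show "g Gen_b * g Gen_c * g Gen_b = g Gen_c * g Gen_b * g Gen_c"
      using rel [of Gen_b "[Gen_c, Gen_b]" Gen_c "[Gen_b, Gen_c]"] by (simp add: R_def alternating_2_3 mult.assoc)
    have "prod_list (map g (alternating Gen_c Gen_a (2 * k + 1))) = prod_list (map g (alternating Gen_a Gen_c (2 * k + 1)))"
      using rel [of Gen_c "alternating Gen_a Gen_c (2 * k)" Gen_a "alternating Gen_c Gen_a (2 * k)"]
      by (simp add: R_def)
    then show "(g Gen_c * g Gen_a) ^ k * g Gen_c = (g Gen_a * g Gen_c) ^ k * g Gen_a"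
      unfolding prod_list_alternating .
  qed
  then have "(P Gen_a, P Gen_b) \<in> word_eq (path_gens Y) (path_rels Y)"
    unfolding g_def by (rule letter_perm_faithful [OF P P])
  then have "\<Phi> (cl [(Gen_a, True)]) = \<Phi> (cl [(Gen_b, True)])"
    unfolding p pc_def P_def by (rule word_class_cong)
  moreover have "cl [(s, True)] \<in> carrier (presented_group {Gen_a, Gen_b, Gen_c} R)" for s
    by (auto simp: presented_group_carrier cl_def artin_gens)
  ultimately have "cl [(Gen_a, True)] = cl [(Gen_b, True)]"
    using \<Phi> by (auto simp: iso_def bij_betw_def dest: inj_onD)
  then have eq: "([(Gen_a, True)], [(Gen_b, True)]) \<in> word_eq {Gen_a, Gen_b, Gen_c} R"
    unfolding cl_def by (subst (asm) word_class_eq_iff) auto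
  obtain a b c :: "(complex \<times> real) sym"
    where abc: "a * b = b * a" "b * c * b = c * b * c" "(c * a) ^ k * c = (a * c) ^ k * a" "a \<noteq> b"
    by (rule odd_artin_generators_distinct [OF k])
  define f where "f s = (case s of Gen_a \<Rightarrow> a | Gen_b \<Rightarrow> b | Gen_c \<Rightarrow> c)" for s
  have "satisfies {Gen_a, Gen_b, Gen_c} R f"
    unfolding satisfies_def R_def
    using abc(1,2) prod_list_alternating(2) [of f Gen_c Gen_a k] prod_list_alternating(2) [of f Gen_a Gen_c k] abc(3)
    by (auto simp: weval_pos alternating_2_3 mult.assoc f_def simp del: alternating.simps)
  from weval_cong_word_eq [OF eq this] show False using abc(4) by (simp add: f_def)
qed


section \<open>Maps between presented groups\<close>

definition subst :: "('a \<Rightarrow> 'b word) \<Rightarrow> 'a word \<Rightarrow> 'b word"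
  where "subst \<tau> w = concat (map (\<lambda>(s, p). if p then \<tau> s else inv_word (\<tau> s)) w)"

lemma weval_subst [simp]: "weval f (subst \<tau> w) = weval (\<lambda>s. weval f (\<tau> s)) w"
proof (induction w)
  case (Cons l w) then show ?case by (cases l; cases "snd l") (auto simp: subst_def)
qed (simp add: subst_def)

lemma subst_append: "subst \<tau> (u @ w) = subst \<tau> u @ subst \<tau> w"
  by (simp add: subst_def)

lemma subst_words_on: "w \<in> words_on S \<Longrightarrow> (\<And>s. s \<in> S \<Longrightarrow> \<tau> s \<in> words_on S') \<Longrightarrow> subst \<tau> w \<in> words_on S'"
  by (induction w) (auto simp: subst_def)

definition presented_map :: "'b set \<Rightarrow> ('b word \<times> 'b word) set \<Rightarrow> ('a \<Rightarrow> 'b word) \<Rightarrow> 'a word set \<Rightarrow> 'b word set"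
  where "presented_map S' R' \<tau> K = word_class S' R' (subst \<tau> (SOME w. w \<in> K))"

text \<open>That the relations are preserved is stated through values in groups, by which equality of words can
  be tested.\<close>

locale presented_hom =
  fixes S :: "'a set" and R :: "('a word \<times> 'a word) set"
    and S' :: "'b set" and R' :: "('b word \<times> 'b word) set" and \<tau> :: "'a \<Rightarrow> 'b word"
  assumes \<tau>: "s \<in> S \<Longrightarrow> \<tau> s \<in> words_on S'"
    and preserves: "satisfies S' R' (f :: 'b \<Rightarrow> 'b word set sym) \<Longrightarrow> satisfies S R (\<lambda>s. weval f (\<tau> s))"
begin

lemma presented_map_class:
  assumes w: "w \<in> words_on S"
  shows "presented_map S' R' \<tau> (word_class S R w) = word_class S' R' (subst \<tau> w)"
proof -
  define w' where "w' = (SOME w'. w' \<in> word_class S R w)"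
  have "w' \<in> word_class S R w" unfolding w'_def by (rule someI, rule word_class_refl [OF w])
  then have eq: "(w, w') \<in> word_eq S R" by (simp add: in_word_class)
  then have w': "w' \<in> words_on S" using word_eq_words_on by blast
  have "(subst \<tau> w', subst \<tau> w) \<in> word_eq S' R'"
  proof (rule word_eq_if_weval_eq)
    fix f :: "'b \<Rightarrow> 'b word set sym" assume "satisfies S' R' f"
    from weval_cong_word_eq [OF eq preserves [OF this]] show "weval f (subst \<tau> w') = weval f (subst \<tau> w)" by simp
  qed (rule subst_words_on [OF _ \<tau>], use w w' in simp_all)+
  then show ?thesis unfolding presented_map_def w'_def [symmetric] by (rule word_class_cong)
qed

lemma presented_map_hom: "presented_map S' R' \<tau> \<in> hom (presented_group S R) (presented_group S' R')"
  unfolding hom_def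
proof (intro CollectI conjI Pi_I ballI)
  fix K assume "K \<in> carrier (presented_group S R)"
  then obtain w where w: "w \<in> words_on S" "K = word_class S R w" by (auto simp: presented_group_carrier)
  have sw: "subst \<tau> w \<in> words_on S'" by (rule subst_words_on [OF w(1) \<tau>])
  then show "presented_map S' R' \<tau> K \<in> carrier (presented_group S' R')"
    by (auto simp: w presented_map_class presented_group_carrier)
  fix K' assume "K' \<in> carrier (presented_group S R)"
  then obtain w' where w': "w' \<in> words_on S" "K' = word_class S R w'" by (auto simp: presented_group_carrier)
  have sw': "subst \<tau> w' \<in> words_on S'" by (rule subst_words_on [OF w'(1) \<tau>])
  show "presented_map S' R' \<tau> (K \<otimes>\<^bsub>presented_group S R\<^esub> K')
      = presented_map S' R' \<tau> K \<otimes>\<^bsub>presented_group S' R'\<^esub> presented_map S' R' \<tau> K'"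
    using w w' sw sw' by (simp add: presented_group_mult presented_map_class subst_append)
qed

end

lemma presented_iso:
  fixes \<tau> :: "'a \<Rightarrow> 'b word" and \<sigma> :: "'b \<Rightarrow> 'a word"
  assumes "presented_hom S R S' R' \<tau>" and "presented_hom S' R' S R \<sigma>"
    and 1: "\<And>(f :: 'a \<Rightarrow> 'a word set sym) s. satisfies S R f \<Longrightarrow> s \<in> S \<Longrightarrow> weval (\<lambda>s'. weval f (\<sigma> s')) (\<tau> s) = f s"
    and 2: "\<And>(f :: 'b \<Rightarrow> 'b word set sym) s. satisfies S' R' f \<Longrightarrow> s \<in> S' \<Longrightarrow> weval (\<lambda>s'. weval f (\<tau> s')) (\<sigma> s) = f s"
  shows "presented_group S R \<cong> presented_group S' R'"
proof -
  interpret T: presented_hom S R S' R' \<tau> by (rule assms(1))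
  interpret U: presented_hom S' R' S R \<sigma> by (rule assms(2))
  have inv1: "presented_map S R \<sigma> (presented_map S' R' \<tau> K) = K" if K: "K \<in> carrier (presented_group S R)" for K
  proof -
    obtain w where w: "w \<in> words_on S" "K = word_class S R w" using K by (auto simp: presented_group_carrier)
    have sw: "subst \<tau> w \<in> words_on S'" by (rule subst_words_on [OF w(1) T.\<tau>])
    have "(subst \<sigma> (subst \<tau> w), w) \<in> word_eq S R"
    proof (rule word_eq_if_weval_eq)
      fix f :: "'a \<Rightarrow> 'a word set sym" assume f: "satisfies S R f"
      show "weval f (subst \<sigma> (subst \<tau> w)) = weval f w"
        unfolding weval_subst by (rule weval_cong [OF 1 [OF f] w(1)])
    qed (use w subst_words_on [OF sw U.\<tau>] in simp_all)
    then show ?thesis using sw w by (simp add: T.presented_map_class U.presented_map_class word_class_cong)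
  qed
  have inv2: "presented_map S' R' \<tau> (presented_map S R \<sigma> K) = K" if K: "K \<in> carrier (presented_group S' R')" for K
  proof -
    obtain w where w: "w \<in> words_on S'" "K = word_class S' R' w" using K by (auto simp: presented_group_carrier)
    have sw: "subst \<sigma> w \<in> words_on S" by (rule subst_words_on [OF w(1) U.\<tau>])
    have "(subst \<tau> (subst \<sigma> w), w) \<in> word_eq S' R'"
    proof (rule word_eq_if_weval_eq)
      fix f :: "'b \<Rightarrow> 'b word set sym" assume f: "satisfies S' R' f"
      show "weval f (subst \<tau> (subst \<sigma> w)) = weval f w"
        unfolding weval_subst by (rule weval_cong [OF 2 [OF f] w(1)])
    qed (use w subst_words_on [OF sw T.\<tau>] in simp_all)
    then show ?thesis using sw w by (simp add: T.presented_map_class U.presented_map_class word_class_cong)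
  qed
  have "bij_betw (presented_map S' R' \<tau>) (carrier (presented_group S R)) (carrier (presented_group S' R'))"
    using T.presented_map_hom U.presented_map_hom inv1 inv2
    by (intro bij_betwI [of _ _ _ "presented_map S R \<sigma>"]) (auto simp: hom_def)
  then show ?thesis using T.presented_map_hom unfolding is_iso_def iso_def by blast
qed

lemma presented_hom_free: "(\<And>s. s \<in> S \<Longrightarrow> \<tau> s \<in> words_on S') \<Longrightarrow> presented_hom S {} S' R' \<tau>"
  by unfold_locales auto

text \<open>Injectivity of a homomorphism of free groups by an induced representation: every assignment of
  values \<open>f\<close> to the generators of the domain is recovered from an action of the target on pairs
  \<open>(h, i)\<close>, where \<open>h\<close> is a value and \<open>i\<close> a vertex of a covering graph.\<close>

lemma free_hom_mon:
  fixes \<tau> :: "'a \<Rightarrow> 'b word" and v :: 'v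
  assumes \<tau>: "\<And>s. s \<in> S \<Longrightarrow> \<tau> s \<in> words_on S'"
    and action: "\<And>f :: 'a \<Rightarrow> 'a word set sym. \<exists>g :: 'b \<Rightarrow> ('a word set sym \<times> 'v) sym.
      \<forall>s\<in>S. \<forall>h. app (weval g (\<tau> s)) (h, v) = (f s * h, v)"
  shows "presented_map S' {} \<tau> \<in> mon (free_group S) (free_group S')"
proof -
  interpret presented_hom S "{}" S' "{}" \<tau> using \<tau> by (rule presented_hom_free)
  have "inj_on (presented_map S' {} \<tau>) (carrier (presented_group S {}))"
  proof (rule inj_onI)
    fix K K' assume "K \<in> carrier (presented_group S {})" "K' \<in> carrier (presented_group S {})"
      and eq: "presented_map S' {} \<tau> K = presented_map S' {} \<tau> K'"
    then obtain w w' where w: "w \<in> words_on S" "K = word_class S {} w" "w' \<in> words_on S" "K' = word_class S {} w'"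
      by (auto simp: presented_group_carrier)
    have "(subst \<tau> w, subst \<tau> w') \<in> word_eq S' {}"
      using eq w subst_words_on [OF w(1) \<tau>] subst_words_on [OF w(3) \<tau>]
      by (simp add: presented_map_class word_class_eq_iff)
    have "(w, w') \<in> word_eq S {}"
    proof (rule word_eq_if_weval_eq [OF w(1,3)])
      fix f :: "'a \<Rightarrow> 'a word set sym"
      obtain g :: "'b \<Rightarrow> ('a word set sym \<times> 'v) sym"
        where g: "\<And>s h. s \<in> S \<Longrightarrow> app (weval g (\<tau> s)) (h, v) = (f s * h, v)" using action by blast
      have act: "app (weval g (subst \<tau> w)) (h, v) = (weval f w * h, v)" if "w \<in> words_on S" for w h
        using that
      proof (induction w)
        case (Cons l w)
        obtain s p where l: "l = (s, p)" by fastforce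
        have s: "s \<in> S" using Cons.prems by (simp add: l)
        have "app (inverse (weval g (\<tau> s))) (h, v) = (inverse (f s) * h, v)" for h
          by (rule app_inverse_eq) (simp add: g s)
        with Cons g [OF s] show ?case by (cases p) (simp_all add: l mult.assoc)
      qed simp
      have "weval g (subst \<tau> w) = weval g (subst \<tau> w')"
        by (rule weval_cong_word_eq [OF \<open>(subst \<tau> w, subst \<tau> w') \<in> word_eq S' {}\<close>]) simp
      then show "weval f w = weval f w'" using act [OF w(1), of 1] act [OF w(3), of 1] by simp
    qed
    then show "K = K'" using w by (simp add: word_class_eq_iff)
  qed
  then show ?thesis using presented_map_hom by (simp add: mon_def free_group_def)
qed

text \<open>A permutation of the vertices of a covering graph, where \<open>l i\<close> is the label of the edge from \<open>i\<close> to \<open>\<pi> i\<close>.\<close>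

definition monomial :: "(nat \<Rightarrow> 'k::grp) \<Rightarrow> (nat \<Rightarrow> nat) \<Rightarrow> ('k \<times> nat) sym"
  where "monomial l \<pi> = Sym (\<lambda>(h, i). (l i * h, \<pi> i))"

lemma app_monomial:
  assumes "\<And>i. \<rho> (\<pi> i) = i" "\<And>i. \<pi> (\<rho> i) = i"
  shows "app (monomial l \<pi>) (h, i) = (l i * h, \<pi> i)"
    and "app (inverse (monomial l \<pi>)) (h, i) = (inverse (l (\<rho> i)) * h, \<rho> i)"
proof -
  have "bij (\<lambda>(h, i). (l i * h, \<pi> i))"
    by (rule o_bij [of "\<lambda>(h, i). (inverse (l (\<rho> i)) * h, \<rho> i)"]) (auto simp: fun_eq_iff assms)
  then show 1: "app (monomial l \<pi>) (h, i) = (l i * h, \<pi> i)" for h i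
    unfolding monomial_def by (subst app_Sym) auto
  show "app (inverse (monomial l \<pi>)) (h, i) = (inverse (l (\<rho> i)) * h, \<rho> i)"
    by (rule app_inverse_eq) (simp add: 1 assms)
qed


section \<open>The splitting of even triangle Artin groups\<close>

text \<open>The images of the seven generators of \<open>F\<^sub>7\<close>.  In \<open>F\<^sub>3\<close>, whose generators \<open>0, 1, 2\<close> are called \<open>u, v, y\<close>, they
  are \<open>u\<^sup>3\<close>, \<open>v u\<^sup>-\<^sup>2\<close>, \<open>u v\<close>, \<open>u\<^sup>2 v\<^bsup>k - 2\<^esup> u\<^sup>-\<^sup>1\<close>, \<open>y\<close>, \<open>u y u\<^sup>-\<^sup>1\<close>, \<open>u\<^sup>2 y u\<^sup>-\<^sup>2\<close>.  In \<open>F\<^sub>4\<close>, whose generators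
  \<open>0, 1, 2, 3\<close> are called \<open>\<delta>, x, s, y\<close>, they are \<open>\<delta>\<^sup>2\<close>, \<open>x\<close>, \<open>\<delta> x \<delta>\<close>, \<open>s\<close>, \<open>y\<close>, \<open>\<delta> x s \<delta> x\<close>, \<open>\<delta> y \<delta>\<^sup>-\<^sup>1\<close>.
  The first equation between them is the relation between the roots of the full twist in the braid group
  \<open>\<langle>b, c\<rangle>\<close>; the second and the fourth define \<open>x\<close> and \<open>s\<close>; the third says that \<open>b\<close> commutes with \<open>x\<close>; the
  fifth identifies the two generators called \<open>y\<close>; and the last two contain the relation between
  \<open>a\<close> and \<open>c\<close>.\<close>

fun words3 :: "nat \<Rightarrow> nat \<Rightarrow> nat word"
  where "words3 k i =
    [[(0, True), (0, True), (0, True)],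
     [(1, True), (0, False), (0, False)],
     [(0, True), (1, True)],
     [(0, True), (0, True)] @ replicate (k - 2) (1, True) @ [(0, False)],
     [(2, True)],
     [(0, True), (2, True), (0, False)],
     [(0, True), (0, True), (2, True), (0, False), (0, False)]] ! i"

fun words4 :: "nat \<Rightarrow> nat word"
  where "words4 i =
    [[(0, True), (0, True)],
     [(1, True)],
     [(0, True), (1, True), (0, True)],
     [(2, True)],
     [(3, True)],
     [(0, True), (1, True), (2, True), (0, True), (1, True)],
     [(0, True), (3, True), (0, False)]] ! i"

lemma less_7: "(i::nat) < 7 \<longleftrightarrow> i = 0 \<or> i = 1 \<or> i = 2 \<or> i = 3 \<or> i = 4 \<or> i = 5 \<or> i = 6"
  and less_4: "(i::nat) < 4 \<longleftrightarrow> i = 0 \<or> i = 1 \<or> i = 2 \<or> i = 3"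
  and less_3: "(i::nat) < 3 \<longleftrightarrow> i = 0 \<or> i = 1 \<or> i = 2"
  by auto

lemma weval_replicate: "weval f (replicate n (s, True)) = f s ^ n"
  by (induction n) simp_all

lemma words_on_replicate: "s \<in> S \<Longrightarrow> replicate n (s, p) \<in> words_on S"
  by (induction n) simp_all

lemma words3_words_on: "i < 7 \<Longrightarrow> words3 k i \<in> words_on {..<3}"
  and words4_words_on: "i < 7 \<Longrightarrow> words4 i \<in> words_on {..<4}"
  by (auto simp: less_7 words_on_replicate)

lemma weval_words3:
  "weval f (words3 k 0) = f 0 * f 0 * f 0" "weval f (words3 k 1) = f 1 * inverse (f 0 * f 0)"
  "weval f (words3 k 2) = f 0 * f 1" "weval f (words3 k 3) = f 0 * f 0 * f 1 ^ (k - 2) * inverse (f 0)"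
  "weval f (words3 k 4) = f 2" "weval f (words3 k 5) = f 0 * f 2 * inverse (f 0)"
  "weval f (words3 k 6) = f 0 * f 0 * f 2 * inverse (f 0 * f 0)"
  by (simp_all add: mult.assoc weval_replicate)

lemma weval_words4:
  "weval f (words4 0) = f 0 * f 0" "weval f (words4 1) = f 1" "weval f (words4 2) = f 0 * f 1 * f 0"
  "weval f (words4 3) = f 2" "weval f (words4 4) = f 3" "weval f (words4 5) = f 0 * f 1 * f 2 * f 0 * f 1"
  "weval f (words4 6) = f 0 * f 3 * inverse (f 0)"
  by (simp_all add: mult.assoc)

text \<open>On the vertices \<open>0, \<dots>, k - 1\<close> of the covering graph, \<open>u\<close> acts as the cycle \<open>0 \<rightarrow> k - 1 \<rightarrow> 1 \<rightarrow> 0\<close>, \<open>v\<close> as the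
  cycle \<open>0 \<rightarrow> 1 \<rightarrow> \<dots> \<rightarrow> k - 1 \<rightarrow> 0\<close>, and \<open>y\<close> trivially.  Each of the seven words describes a closed path
  at \<open>0\<close>, and seven edges can be labelled in such a way that each path runs through exactly one
  labelled edge.\<close>

lemma words3_mon:
  assumes k: "k \<ge> 3"
  shows "presented_map {..<3} {} (words3 k) \<in> mon (free_group {..<7}) (free_group {..<3})"
proof (rule free_hom_mon [where v = "0 :: nat"])
  fix f :: "nat \<Rightarrow> nat word set sym"
  define pu where "pu i = (if i = 1 then 0 else if i = k - 1 then 1 else if i = 0 then k - 1 else i)" for i
  define pu' where "pu' i = (if i = 0 then 1 else if i = 1 then k - 1 else if i = k - 1 then 0 else i)" for i
  define pv where "pv i = (if i < k - 1 then i + 1 else if i = k - 1 then 0 else i)" for i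
  define pv' where "pv' i = (if i = 0 then k - 1 else if i < k then i - 1 else i)" for i
  define g :: "nat \<Rightarrow> (nat word set sym \<times> nat) sym" where
    "g = (\<lambda>_. 1)(0 := monomial (\<lambda>i. if i = 0 then f 0 else 1) pu,
      1 := monomial (\<lambda>i. if i = 0 then f 2 else if i = 1 then f 3 else if i = k - 1 then f 1 else 1) pv,
      2 := monomial (\<lambda>i. if i = 0 then f 4 else if i = 1 then f 5 else if i = k - 1 then f 6 else 1) id)"
  have "pu' (pu i) = i" "pu (pu' i) = i" "pv' (pv i) = i" "pv (pv' i) = i" for i
    using k by (auto simp: pu_def pu'_def pv_def pv'_def)
  note u = app_monomial [of pu' pu, OF this(1,2)] and v = app_monomial [of pv' pv, OF this(3,4)]
  have y: "app (monomial l id) (h, i) = (l i * h, i)" for l :: "nat \<Rightarrow> nat word set sym" and h i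
    using app_monomial(1) [of id id l h i] by simp
  have vn: "app (g 1 ^ Suc n) (h, 1) = (f 3 * h, n + 2)" if "n + 3 \<le> k" for n h
    using that by (induction n) (simp_all add: g_def v pv_def)
  have vk: "app (g 1 ^ (k - 2)) (h, Suc 0) = (f 3 * h, k - 1)" for h
    using vn [of "k - 3" h] k by (simp add: Suc_diff_Suc numeral_eq_Suc)
  have k2: "k - Suc 0 \<noteq> Suc 0" using k by simp
  have "app (weval g (words3 k s)) (h, 0) = (f s * h, 0)" if "s < 7" for s h
    using that k k2 vk unfolding less_7
    by (elim disjE) (simp_all only: weval_words3, simp_all add: g_def u v y pu_def pu'_def pv_def)
  then show "\<exists>g :: nat \<Rightarrow> (nat word set sym \<times> nat) sym. \<forall>s\<in>{..<7}. \<forall>h. app (weval g (words3 k s)) (h, 0) = (f s * h, 0)"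
    by blast
qed (use words3_words_on in blast)

text \<open>The covering graph has two vertices, which only \<open>\<delta>\<close> exchanges.  The closed paths at \<open>0\<close> given by the words
  pass several labelled edges, so the labels are found by solving for the values one after another.\<close>

lemma words4_mon: "presented_map {..<4} {} words4 \<in> mon (free_group {..<7}) (free_group {..<4})"
proof (rule free_hom_mon [where v = "0 :: nat"])
  fix f :: "nat \<Rightarrow> nat word set sym"
  define pd :: "nat \<Rightarrow> nat" where "pd i = (if i = 0 then 1 else if i = 1 then 0 else i)" for i
  define g :: "nat \<Rightarrow> (nat word set sym \<times> nat) sym" where
    "g = (\<lambda>_. 1)(0 := monomial (\<lambda>i. if i = 1 then f 0 else 1) pd,
      1 := monomial (\<lambda>i. if i = 0 then f 1 else inverse (f 0) * f 2) id,
      2 := monomial (\<lambda>i. if i = 0 then f 3 else inverse (f 2) * f 5 * inverse (f 1)) id,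
      3 := monomial (\<lambda>i. if i = 0 then f 4 else inverse (f 0) * f 6 * f 0) id)"
  have "pd (pd i) = i" for i by (simp add: pd_def)
  note d = app_monomial [of pd pd, OF this this]
  have y: "app (monomial l id) (h, i) = (l i * h, i)" for l :: "nat \<Rightarrow> nat word set sym" and h i
    using app_monomial(1) [of id id l h i] by simp
  have "app (weval g (words4 s)) (h, 0) = (f s * h, 0)" if "s < 7" for s h
    using that unfolding less_7
    by (elim disjE) (simp_all only: weval_words4, simp_all add: g_def d y pd_def mult.assoc)
  then show "\<exists>g :: nat \<Rightarrow> (nat word set sym \<times> nat) sym. \<forall>s\<in>{..<7}. \<forall>h. app (weval g (words4 s)) (h, 0) = (f s * h, 0)"
    by blast
qed (use words4_words_on in blast)

lemma power_split: "k \<ge> 2 \<Longrightarrow> v * v ^ (k - 2) * v = v ^ k" for v :: "'g::monoid_mult"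
proof -
  assume "k \<ge> 2"
  then have "k = Suc (Suc (k - 2))" by simp
  then show ?thesis by (metis power_Suc power_Suc2)
qed

text \<open>Since \<open>x u\<^sup>2 = v\<close> and \<open>b v b\<^sup>-\<^sup>1 = a c\<close>, the equation for \<open>u y u\<^sup>-\<^sup>1\<close> says that \<open>y = (a c)\<^sup>k\<close>, and that for
  \<open>u\<^sup>2 y u\<^sup>-\<^sup>2\<close> says that \<open>c\<close> commutes with \<open>y\<close>.\<close>

lemma even_artin_to_amalgam:
  fixes a b c :: "'g::grp"
  assumes ab: "a * b = b * a" and bc: "b * c * b = c * b * c" and ca: "(c * a) ^ k = (a * c) ^ k"
    and k: "k \<ge> 2"
  defines "u \<equiv> b * c" and "v \<equiv> a * inverse b * c * b" and "y \<equiv> (a * c) ^ k"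
    and "\<delta> \<equiv> b * c * b" and "x \<equiv> a * inverse b * inverse b * inverse b"
  defines "s \<equiv> u * u * v ^ (k - 2) * inverse u"
  shows "u * u * u = \<delta> * \<delta>" "v * inverse (u * u) = x" "u * v = \<delta> * x * \<delta>"
    "u * y * inverse u = \<delta> * x * s * \<delta> * x" "u * u * y * inverse (u * u) = \<delta> * y * inverse \<delta>"
proof -
  have \<delta>: "\<delta> = u * b" "\<delta> = c * b * c" by (simp add: u_def \<delta>_def, simp only: \<delta>_def bc)
  have "u * u * u = b * c * b * (c * b * c)" by (simp add: u_def mult.assoc)
  then show "u * u * u = \<delta> * \<delta>" by (simp only: \<delta>(2) [symmetric] \<delta>_def [symmetric])
  have uu: "u * u = b * \<delta>" unfolding \<delta>(2) by (simp add: u_def mult.assoc)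
  have v: "v = x * (u * u)" unfolding uu by (simp add: v_def x_def \<delta>_def mult.assoc)
  then show x: "v * inverse (u * u) = x" by (simp add: mult.assoc)
  have "b * a * inverse b = a" unfolding ab [symmetric] by (simp add: mult.assoc)
  then have ba: "b * (a * (inverse b * z)) = a * z" for z by (metis mult.assoc)
  have bx: "b * x = x * b" by (simp add: x_def mult.assoc ba)
  have "u * v = u * (x * b) * \<delta>" unfolding v uu by (simp only: mult.assoc)
  also have "\<dots> = \<delta> * x * \<delta>" unfolding bx [symmetric] \<delta>(1) by (simp only: mult.assoc)
  finally show e3: "u * v = \<delta> * x * \<delta>" .
  have vk: "v * v ^ (k - 2) * v = v ^ k"
    by (rule power_split [OF k])
  have bvb: "b * v * inverse b = a * c" by (simp add: v_def mult.assoc ba)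
  have "x * s * (\<delta> * x * \<delta>) = x * (u * u) * v ^ (k - 2) * v"
    unfolding e3 [symmetric] s_def by (simp add: mult.assoc)
  also have "\<dots> = v ^ k" unfolding v [symmetric] by (rule vk)
  finally have "\<delta> * (x * s * (\<delta> * x * \<delta>)) * inverse \<delta> = \<delta> * v ^ k * inverse \<delta>" by simp
  also have "\<dots> = u * (b * v ^ k * inverse b) * inverse u" unfolding \<delta>(1) by (simp add: mult.assoc)
  also have "b * v ^ k * inverse b = y" unfolding conj_power [symmetric] bvb y_def ..
  finally show "u * y * inverse u = \<delta> * x * s * \<delta> * x" by (simp add: mult.assoc)
  have cy: "c * y = y * c" unfolding y_def alternating_power ca ..
  have "u * u * y * inverse (u * u) = u * (b * (c * y) * inverse c * inverse b) * inverse u"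
    by (simp add: u_def mult.assoc)
  also have "\<dots> = \<delta> * y * inverse \<delta>" unfolding cy \<delta>(1) by (simp add: mult.assoc)
  finally show "u * u * y * inverse (u * u) = \<delta> * y * inverse \<delta>" .
qed

text \<open>The generators are recovered from \<open>u = b c\<close>, \<open>\<delta> = u b\<close> and \<open>x = a b\<^sup>-\<^sup>3\<close>, and the previous computation is
  read backwards.\<close>

lemma even_amalgam_to_artin:
  fixes u v y \<delta> x s :: "'g::grp"
  assumes e1: "u * u * u = \<delta> * \<delta>" and e2: "v * inverse (u * u) = x" and e3: "u * v = \<delta> * x * \<delta>"
    and e4: "u * u * v ^ (k - 2) * inverse u = s"
    and e6: "u * y * inverse u = \<delta> * x * s * \<delta> * x" and e7: "u * u * y * inverse (u * u) = \<delta> * y * inverse \<delta>"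
    and k: "k \<ge> 2"
  defines "b \<equiv> inverse u * \<delta>"
  defines "c \<equiv> inverse b * u" and "a \<equiv> x * b * b * b"
  shows "a * b = b * a" "b * c * b = c * b * c" "(c * a) ^ k = (a * c) ^ k"
    "b * c = u" "a * inverse b * c * b = v" "(a * c) ^ k = y" "b * c * b = \<delta>"
    "a * inverse b * inverse b * inverse b = x"
proof -
  show u: "b * c = u" by (simp add: c_def)
  have ub: "u * b = \<delta>" by (simp add: b_def)
  show \<delta>: "b * c * b = \<delta>" unfolding u by (rule ub)
  have "u * (u * u) = u * (b * \<delta>)" using e1 by (simp add: b_def mult.assoc)
  then have uu: "u * u = b * \<delta>" by (simp only: mult_left_cancel)
  have "c * b * c = inverse b * (u * u)" using u by (simp add: c_def mult.assoc)
  also have "\<dots> = \<delta>" unfolding uu by simp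
  finally show "b * c * b = c * b * c" using \<delta> by simp
  have v: "v = x * (u * u)" unfolding e2 [symmetric] by (simp add: mult.assoc)
  have "u * (x * b) * \<delta> = u * v" unfolding v uu by (simp only: mult.assoc)
  also have "\<dots> = u * (b * x) * \<delta>" unfolding e3 ub [symmetric] by (simp only: mult.assoc)
  finally have xb: "x * b = b * x" by (simp only: mult_left_cancel mult_right_cancel)
  have "b * a = b * x * (b * (b * b))" by (simp add: a_def mult.assoc)
  also have "\<dots> = a * b" unfolding xb [symmetric] by (simp add: a_def mult.assoc)
  finally show ab: "a * b = b * a" ..
  show "a * inverse b * inverse b * inverse b = x" by (simp add: a_def mult.assoc)
  have "a * inverse b * c * b = x * (b * (b * c * b))" by (simp add: a_def mult.assoc)
  then show v': "a * inverse b * c * b = v" unfolding \<delta> v uu .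
  have vk: "v * v ^ (k - 2) * v = v ^ k"
    by (rule power_split [OF k])
  have "x * s * (\<delta> * x * \<delta>) = x * (u * u) * v ^ (k - 2) * v"
    unfolding e3 [symmetric] e4 [symmetric] by (simp add: mult.assoc)
  also have "\<dots> = v ^ k" unfolding v [symmetric] by (rule vk)
  finally have "\<delta> * (x * s * (\<delta> * x * \<delta>)) * inverse \<delta> = \<delta> * v ^ k * inverse \<delta>" by simp
  also have "\<dots> = u * (b * v ^ k * inverse b) * inverse u" unfolding ub [symmetric] by (simp add: mult.assoc)
  finally have "u * y * inverse u = u * (b * v ^ k * inverse b) * inverse u"
    unfolding e6 by (simp add: mult.assoc)
  then have y: "y = b * v ^ k * inverse b" by (simp only: mult_left_cancel mult_right_cancel)
  have "b * v * inverse b = b * a * inverse b * c" unfolding v' [symmetric] by (simp add: mult.assoc)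
  also have "\<dots> = a * c" unfolding ab [symmetric] by (simp add: mult.assoc)
  finally show acy: "(a * c) ^ k = y" unfolding y conj_power [symmetric] by simp
  have "u * (b * (c * y * inverse c) * inverse b) * inverse u = u * u * y * inverse (u * u)"
    unfolding u [symmetric] by (simp add: mult.assoc)
  also have "\<dots> = u * (b * y * inverse b) * inverse u" unfolding e7 ub [symmetric] by (simp add: mult.assoc)
  finally have "c * y * inverse c = y" by (simp only: mult_left_cancel mult_right_cancel)
  moreover have "c * y = (c * a) ^ k * c" unfolding acy [symmetric] by (rule alternating_power)
  ultimately have "(c * a) ^ k * c * inverse c = y" by simp
  then show "(c * a) ^ k = (a * c) ^ k" unfolding acy by (simp add: mult.assoc)
qed

text \<open>The generators of \<open>F\<^sub>3\<close> and \<open>F\<^sub>4\<close> as words in the generators of the Artin group, and conversely.  A generator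
  of the amalgamated product is an element of \<open>F\<^sub>3\<close> or \<open>F\<^sub>4\<close>, that is, a class of words, for which
  \<open>artin_word\<close> chooses a representative.\<close>

definition artin_word3 :: "nat \<Rightarrow> nat \<Rightarrow> artin_gen word"
  where "artin_word3 k i =
    (if i = 0 then [(Gen_b, True), (Gen_c, True)]
     else if i = 1 then [(Gen_a, True), (Gen_b, False), (Gen_c, True), (Gen_b, True)]
     else concat (replicate k [(Gen_a, True), (Gen_c, True)]))"

definition artin_word4 :: "nat \<Rightarrow> nat \<Rightarrow> artin_gen word"
  where "artin_word4 k i =
    (if i = 0 then [(Gen_b, True), (Gen_c, True), (Gen_b, True)]
     else if i = 1 then [(Gen_a, True), (Gen_b, False), (Gen_b, False), (Gen_b, False)]
     else if i = 2 then subst (artin_word3 k) (words3 k 3)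
     else concat (replicate k [(Gen_a, True), (Gen_c, True)]))"

lemma weval_alternating_word: "weval f (concat (replicate k [(s, True), (t, True)])) = (f s * f t) ^ k"
  by (induction k) (simp_all add: mult.assoc)

lemma words_on_artin_gens: "w \<in> words_on {Gen_a, Gen_b, Gen_c}"
  by (simp add: artin_gens words_on_UNIV)

abbreviation "cls \<equiv> \<lambda>(n::nat) i. word_class {..<n} {} [(i, True)]"

definition amalgam_word :: "artin_gen \<Rightarrow> (nat word set + nat word set) word"
  where "amalgam_word s = (let b = [(Inl (cls 3 0), False), (Inr (cls 4 0), True)] in
    case s of Gen_a \<Rightarrow> (Inr (cls 4 1), True) # b @ b @ b | Gen_b \<Rightarrow> b | Gen_c \<Rightarrow> inv_word b @ [(Inl (cls 3 0), True)])"

definition artin_word :: "nat \<Rightarrow> nat word set + nat word set \<Rightarrow> artin_gen word"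
  where "artin_word k s = (case s of
      Inl K \<Rightarrow> subst (artin_word3 k) (SOME w. w \<in> K)
    | Inr K \<Rightarrow> subst (artin_word4 k) (SOME w. w \<in> K))"

lemma weval_artin_word:
  "weval f (artin_word k (Inl K)) = class_val (\<lambda>i. weval f (artin_word3 k i)) K"
  "weval f (artin_word k (Inr K)) = class_val (\<lambda>i. weval f (artin_word4 k i)) K"
  by (simp_all add: artin_word_def class_val_def)

lemma weval_amalgam_word:
  fixes F :: "nat word set + nat word set \<Rightarrow> 'g::grp"
  defines "b \<equiv> inverse (F (Inl (cls 3 0))) * F (Inr (cls 4 0))"
  shows "weval F (amalgam_word Gen_b) = b" "weval F (amalgam_word Gen_c) = inverse b * F (Inl (cls 3 0))"
    "weval F (amalgam_word Gen_a) = F (Inr (cls 4 1)) * b * b * b"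
  by (simp_all add: amalgam_word_def b_def Let_def mult.assoc inv_word_def)

lemma satisfies_artin_rels:
  "satisfies {Gen_a, Gen_b, Gen_c} (artin_rels 2 3 (2 * k)) f \<longleftrightarrow>
    f Gen_a * f Gen_b = f Gen_b * f Gen_a \<and>
    f Gen_b * f Gen_c * f Gen_b = f Gen_c * f Gen_b * f Gen_c \<and>
    (f Gen_c * f Gen_a) ^ k = (f Gen_a * f Gen_c) ^ k"
  unfolding satisfies_def
  by (simp add: words_on_artin_gens weval_pos prod_list_alternating alternating_2_3 mult.assoc)

text \<open>The words above translate every assignment of values that satisfies the relations of one group
  into an assignment for the other group, by the last two computations, and the two translations are
  inverse to each other.\<close>

theorem even_artin_amalgam:
  assumes k: "k \<ge> 3"
  shows "triangle_artin 2 3 (2 * k) \<cong>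
    amalgamated_product (free_group {..<3}) (free_group {..<4}) (free_group {..<7})
      (presented_map {..<3} {} (words3 k)) (presented_map {..<4} {} words4)"
proof -
  let ?A = "free_group {..<3::nat}" and ?B = "free_group {..<4::nat}" and ?C = "free_group {..<7::nat}"
  define \<phi> where "\<phi> = presented_map {..<3} {} (words3 k)"
  define \<psi> where "\<psi> = presented_map {..<4} {} words4"
  define S' where "S' = carrier ?A <+> carrier ?B"
  define R' where "R' = {(pos [Inl x, Inl y], pos [Inl (x \<otimes>\<^bsub>?A\<^esub> y)]) | x y. x \<in> carrier ?A \<and> y \<in> carrier ?A}
    \<union> {(pos [Inr x, Inr y], pos [Inr (x \<otimes>\<^bsub>?B\<^esub> y)]) | x y. x \<in> carrier ?B \<and> y \<in> carrier ?B}
    \<union> {(pos [Inl (\<phi> z)], pos [Inr (\<psi> z)]) | z. z \<in> carrier ?C}"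
  interpret \<phi>: presented_hom "{..<7}" "{}" "{..<3}" "{}" "words3 k"
    by (rule presented_hom_free) (use words3_words_on in blast)
  interpret \<psi>: presented_hom "{..<7}" "{}" "{..<4}" "{}" words4
    by (rule presented_hom_free) (use words4_words_on in blast)
  interpret A: group ?A unfolding free_group_def by (rule group_presented_group)
  interpret B: group ?B unfolding free_group_def by (rule group_presented_group)
  have \<phi>_in: "z \<in> carrier ?C \<Longrightarrow> \<phi> z \<in> carrier ?A" and \<psi>_in: "z \<in> carrier ?C \<Longrightarrow> \<psi> z \<in> carrier ?B" for z
    using \<phi>.presented_map_hom \<psi>.presented_map_hom by (auto simp: \<phi>_def \<psi>_def free_group_def hom_def)
  have cl_in: "w \<in> words_on {..<n} \<Longrightarrow> word_class {..<n} {} w \<in> carrier (free_group {..<n})" for n :: nat and w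
    by (simp add: free_group_def presented_group_carrier)
  have k2: "k \<ge> 2" using k by simp
  \<comment> \<open>the multiplication tables determine the values on the factors by the values on their bases\<close>
  have factor: "w \<in> words_on {..<3} \<Longrightarrow> F (Inl (word_class {..<3} {} w)) = weval (\<lambda>i. F (Inl (cls 3 i))) w"
      "w' \<in> words_on {..<4} \<Longrightarrow> F (Inr (word_class {..<4} {} w')) = weval (\<lambda>i. F (Inr (cls 4 i))) w'"
    if F: "satisfies S' R' F"
    for F :: "nat word set + nat word set \<Rightarrow> (nat word set + nat word set) word set sym" and w w'
  proof -
    have "F (Inl (x \<otimes>\<^bsub>?A\<^esub> y)) = F (Inl x) * F (Inl y)" if "x \<in> carrier ?A" "y \<in> carrier ?A" for x y
    proof -
      have "(pos [Inl x, Inl y], pos [Inl (x \<otimes>\<^bsub>?A\<^esub> y)]) \<in> R'" unfolding R'_def using that by blast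
      then show ?thesis using F that unfolding satisfies_def by (fastforce simp: S'_def)
    qed
    then show "w \<in> words_on {..<3} \<Longrightarrow> F (Inl (word_class {..<3} {} w)) = weval (\<lambda>i. F (Inl (cls 3 i))) w"
      unfolding free_group_def by (rule multiplicative_class)
    have "F (Inr (x \<otimes>\<^bsub>?B\<^esub> y)) = F (Inr x) * F (Inr y)" if "x \<in> carrier ?B" "y \<in> carrier ?B" for x y
    proof -
      have "(pos [Inr x, Inr y], pos [Inr (x \<otimes>\<^bsub>?B\<^esub> y)]) \<in> R'" unfolding R'_def using that by blast
      then show ?thesis using F that unfolding satisfies_def by (fastforce simp: S'_def)
    qed
    then show "w' \<in> words_on {..<4} \<Longrightarrow> F (Inr (word_class {..<4} {} w')) = weval (\<lambda>i. F (Inr (cls 4 i))) w'"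
      unfolding free_group_def by (rule multiplicative_class)
  qed
  have edge: "weval (\<lambda>i. F (Inl (cls 3 i))) (words3 k i) = weval (\<lambda>i. F (Inr (cls 4 i))) (words4 i)"
    if F: "satisfies S' R' F" and i: "i < 7"
    for F :: "nat word set + nat word set \<Rightarrow> (nat word set + nat word set) word set sym" and i
  proof -
    have z: "cls 7 i \<in> carrier ?C" using i by (intro cl_in) simp
    then have "(pos [Inl (\<phi> (cls 7 i))], pos [Inr (\<psi> (cls 7 i))]) \<in> R'" unfolding R'_def by blast
    then have "F (Inl (\<phi> (cls 7 i))) = F (Inr (\<psi> (cls 7 i)))"
      using F \<phi>_in [OF z] \<psi>_in [OF z] unfolding satisfies_def by (fastforce simp: S'_def)
    moreover have "\<phi> (cls 7 i) = word_class {..<3} {} (words3 k i)" "\<psi> (cls 7 i) = word_class {..<4} {} (words4 i)"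
      using \<phi>.presented_map_class [of "[(i, True)]"] \<psi>.presented_map_class [of "[(i, True)]"] i
      by (simp_all add: \<phi>_def \<psi>_def subst_def del: words3.simps words4.simps)
    ultimately show ?thesis
      using factor(1) [OF F words3_words_on [OF i]] factor(2) [OF F words4_words_on [OF i]] by metis
  qed
  have rels: "satisfies {Gen_a, Gen_b, Gen_c} (artin_rels 2 3 (2 * k)) (\<lambda>s. weval F (amalgam_word s)) \<and>
      (\<forall>i<3. weval (\<lambda>s. weval F (amalgam_word s)) (artin_word3 k i) = F (Inl (cls 3 i))) \<and>
      (\<forall>i<4. weval (\<lambda>s. weval F (amalgam_word s)) (artin_word4 k i) = F (Inr (cls 4 i)))"
    if F: "satisfies S' R' F"
    for F :: "nat word set + nat word set \<Rightarrow> (nat word set + nat word set) word set sym"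
  proof -
    let ?u = "F (Inl (cls 3 0))" and ?v = "F (Inl (cls 3 1))" and ?y = "F (Inl (cls 3 2))"
      and ?d = "F (Inr (cls 4 0))" and ?x = "F (Inr (cls 4 1))" and ?s = "F (Inr (cls 4 2))"
    note e = edge [OF F, of 0] edge [OF F, of 1] edge [OF F, of 2] edge [OF F, of 3] edge [OF F, of 4]
      edge [OF F, of 5] edge [OF F, of 6]
    have y: "F (Inr (cls 4 3)) = ?y" using e(5) unfolding weval_words3 weval_words4 by simp
    have e': "?u * ?u * ?u = ?d * ?d" "?v * inverse (?u * ?u) = ?x" "?u * ?v = ?d * ?x * ?d"
      "?u * ?u * ?v ^ (k - 2) * inverse ?u = ?s" "?u * ?y * inverse ?u = ?d * ?x * ?s * ?d * ?x"
      "?u * ?u * ?y * inverse (?u * ?u) = ?d * ?y * inverse ?d"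
      using e y unfolding weval_words3 weval_words4 by simp_all
    note r = even_amalgam_to_artin [OF e' k2]
    show ?thesis
      unfolding satisfies_artin_rels weval_amalgam_word
      using r e'(4) y
      by (simp add: artin_word3_def artin_word4_def less_3 less_4 weval_alternating_word weval_amalgam_word
          weval_words3 mult.assoc del: words3.simps)
  qed
  have rels': "(\<forall>i<7. weval (\<lambda>i. weval f (artin_word3 k i)) (words3 k i) = weval (\<lambda>i. weval f (artin_word4 k i)) (words4 i))"
    if f: "satisfies {Gen_a, Gen_b, Gen_c} (artin_rels 2 3 (2 * k)) f" for f :: "artin_gen \<Rightarrow> artin_gen word set sym"
  proof -
    from f have r: "f Gen_a * f Gen_b = f Gen_b * f Gen_a"
      "f Gen_b * f Gen_c * f Gen_b = f Gen_c * f Gen_b * f Gen_c"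
      "(f Gen_c * f Gen_a) ^ k = (f Gen_a * f Gen_c) ^ k" by (simp_all add: satisfies_artin_rels)
    have w3: "weval f (artin_word3 k 0) = f Gen_b * f Gen_c"
      "weval f (artin_word3 k 1) = f Gen_a * inverse (f Gen_b) * f Gen_c * f Gen_b"
      "weval f (artin_word3 k 2) = (f Gen_a * f Gen_c) ^ k"
      by (simp_all add: artin_word3_def mult.assoc weval_alternating_word)
    have w4: "weval f (artin_word4 k 0) = f Gen_b * f Gen_c * f Gen_b"
      "weval f (artin_word4 k 1) = f Gen_a * inverse (f Gen_b) * inverse (f Gen_b) * inverse (f Gen_b)"
      "weval f (artin_word4 k 2) = weval (\<lambda>i. weval f (artin_word3 k i)) (words3 k 3)"
      "weval f (artin_word4 k 3) = (f Gen_a * f Gen_c) ^ k"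
      by (simp_all add: artin_word4_def mult.assoc weval_alternating_word del: words3.simps)
    note e = even_artin_to_amalgam [OF r k2]
    show ?thesis
      unfolding less_7
      by (intro allI impI, elim disjE)
         (simp_all only: weval_words3 weval_words4 w3 w4 e)
  qed
  have "presented_group {Gen_a, Gen_b, Gen_c} (artin_rels 2 3 (2 * k)) \<cong> presented_group S' R'"
  proof (rule presented_iso)
    show "presented_hom {Gen_a, Gen_b, Gen_c} (artin_rels 2 3 (2 * k)) S' R' amalgam_word"
    proof
      fix s
      have "Inl (cls 3 0) \<in> S'" "Inr (cls 4 0) \<in> S'" "Inr (cls 4 1) \<in> S'"
        unfolding S'_def by (auto intro: cl_in)
      then show "amalgam_word s \<in> words_on S'" by (cases s) (simp_all add: amalgam_word_def inv_word_def)
    qed (use rels in blast)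
    show "presented_hom S' R' {Gen_a, Gen_b, Gen_c} (artin_rels 2 3 (2 * k)) (artin_word k)"
    proof
      fix s show "artin_word k s \<in> words_on {Gen_a, Gen_b, Gen_c}" by (rule words_on_artin_gens)
    next
      fix f :: "artin_gen \<Rightarrow> artin_gen word set sym"
      assume f: "satisfies {Gen_a, Gen_b, Gen_c} (artin_rels 2 3 (2 * k)) f"
      let ?f3 = "\<lambda>i. weval f (artin_word3 k i)" and ?f4 = "\<lambda>i. weval f (artin_word4 k i)"
      have edge': "class_val ?f3 (\<phi> z) = class_val ?f4 (\<psi> z)" if z: "z \<in> carrier ?C" for z
      proof -
        obtain w where w: "w \<in> words_on {..<7}" "z = word_class {..<7} {} w"
          using z by (auto simp: free_group_def presented_group_carrier)
        have "class_val ?f3 (\<phi> z) = weval ?f3 (subst (words3 k) w)" "class_val ?f4 (\<psi> z) = weval ?f4 (subst words4 w)"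
          unfolding \<phi>_def \<psi>_def w(2) \<phi>.presented_map_class [OF w(1)] \<psi>.presented_map_class [OF w(1)]
          by (rule class_val [OF satisfies_empty], rule subst_words_on [OF w(1)], rule \<phi>.\<tau> \<psi>.\<tau>, assumption)+
        moreover have "weval (\<lambda>i. weval ?f3 (words3 k i)) w = weval (\<lambda>i. weval ?f4 (words4 i)) w"
          by (rule weval_cong [OF _ w(1)]) (use rels' [OF f] in blast)
        ultimately show ?thesis by simp
      qed
      show "satisfies S' R' (\<lambda>s. weval f (artin_word k s))"
        unfolding satisfies_def R'_def
        by (auto simp: weval_artin_word edge' free_group_def class_val_mult)
    qed
    fix f :: "artin_gen \<Rightarrow> artin_gen word set sym" and s
    assume "satisfies {Gen_a, Gen_b, Gen_c} (artin_rels 2 3 (2 * k)) f"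
    have "class_val g (cls n i) = g i" if "i < n" for g :: "nat \<Rightarrow> artin_gen word set sym" and n i
      using class_val [of "{..<n}" "{}" g "[(i, True)]"] that by simp
    then show "weval (\<lambda>s'. weval f (artin_word k s')) (amalgam_word s) = f s"
      by (cases s) (simp_all add: weval_amalgam_word weval_artin_word artin_word3_def artin_word4_def mult.assoc)
  next
    fix F :: "nat word set + nat word set \<Rightarrow> (nat word set + nat word set) word set sym" and s
    assume F: "satisfies S' R' F" and s: "s \<in> S'"
    show "weval (\<lambda>s'. weval F (amalgam_word s')) (artin_word k s) = F s"
    proof (cases s)
      case (Inl K)
      then obtain w where w: "w \<in> words_on {..<3}" "K = word_class {..<3} {} w"
        using s by (auto simp: S'_def free_group_def presented_group_carrier)
      show ?thesis
        unfolding Inl w(2) weval_artin_word class_val [OF satisfies_empty w(1)] factor(1) [OF F w(1)]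
        by (rule weval_cong [OF _ w(1)]) (use rels [OF F] in blast)
    next
      case (Inr K)
      then obtain w where w: "w \<in> words_on {..<4}" "K = word_class {..<4} {} w"
        using s by (auto simp: S'_def free_group_def presented_group_carrier)
      show ?thesis
        unfolding Inr w(2) weval_artin_word class_val [OF satisfies_empty w(1)] factor(2) [OF F w(1)]
        by (rule weval_cong [OF _ w(1)]) (use rels [OF F] in blast)
    qed
  qed
  then show ?thesis
    unfolding triangle_artin_def amalgamated_product_def S'_def R'_def \<phi>_def \<psi>_def .
qed

theorem theorem1p3:
  fixes M :: nat
  assumes "M \<ge> 2"
  shows "(odd M \<longrightarrow>
      (\<nexists>(Y :: ('v, 'e, 'g, 'h) graph_of_groups) v\<^sub>0.
        nontrivial_free_splitting (triangle_artin 2 3 M) Y v\<^sub>0)) \<and>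
    (even M \<and> M > 4 \<longrightarrow>
      (\<exists>\<phi> \<in> mon (free_group {..<7::nat}) (free_group {..<3::nat}).
       \<exists>\<psi> \<in> mon (free_group {..<7::nat}) (free_group {..<4::nat}).
        triangle_artin 2 3 M \<cong>
          amalgamated_product (free_group {..<3::nat}) (free_group {..<4::nat})
            (free_group {..<7::nat}) \<phi> \<psi>))"
proof (intro conjI impI)
  assume "odd M"
  then obtain k where k: "M = 2 * k + 1" by (rule oddE)
  with assms have "k \<ge> 1" by simp
  then show "\<nexists>(Y :: ('v, 'e, 'g, 'h) graph_of_groups) v\<^sub>0.
      nontrivial_free_splitting (triangle_artin 2 3 M) Y v\<^sub>0"
    unfolding k nontrivial_free_splitting_def by (meson odd_artin_not_graph_of_free_groups)
next
  assume "even M \<and> M > 4"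
  then obtain k where "M = 2 * k" "k \<ge> 3" by (elim conjE evenE) simp
  then show "\<exists>\<phi> \<in> mon (free_group {..<7::nat}) (free_group {..<3::nat}).
      \<exists>\<psi> \<in> mon (free_group {..<7::nat}) (free_group {..<4::nat}).
        triangle_artin 2 3 M \<cong>
          amalgamated_product (free_group {..<3::nat}) (free_group {..<4::nat})
            (free_group {..<7::nat}) \<phi> \<psi>"
    by (simp only:) (intro bexI, rule even_artin_amalgam, assumption, rule words4_mon, rule words3_mon, assumption)
qed

end
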